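(* Let $M$ be a positive increasing function on $\mathbb{R}_+$ such that $M(r)/r$ is a decreasing function which tends to zero as $r\to+\infty$. Then there exist a weight sequence $b=\{b_n\}_{n\in\mathbb{Z}}$ and an exact system of reproducing kernels $\{k_\lambda\}_{\lambda\in\Lambda}$ in the space of entire functions $\mathcal{H}$ corresponding to the space $\mathcal{H}(\mathbb{Z},b)$ such that the orthogonal complement to the biorthogonal system has size $M$.
   Context: A system of vectors in a Hilbert space is exact if its closed linear span is the whole space and this fails when any one vector is removed; an exact system $\{v_n\}$ has a unique biorthogonal system $\{w_m\}$, $\langle v_n,w_m\rangle=\delta_{nm}$. For a sequence $b=\{b_n\}_{n\in\mathbb{Z}}$ of positive numbers with $\sum_n\frac{b_n}{1+n^2}<+\infty$, $\mathcal{H}(\mathbb{Z},b)$ is the Hilbert space of functions $f(z)=\sum_{n\in\mathbb{Z}}\frac{a_nb_n^{1/2}}{z-n}$ with $\|f\|^2=\sum_n|a_n|^2<+\infty$. The corresponding space of entire functions is $\mathcal{H}=\{Ff: f\in\mathcal{H}(\mathbb{Z},b)\}$, where $F(z)=\sin(\pi z)$, with the norm transported by $f\mapsto Ff$. It is a Hilbert space of entire functions with reproducing kernels $k_\lambda$, $\lambda\in\mathbb{C}$ ($\langle f,k_\lambda\rangle=f(\lambda)$), and $\{k_n/\|k_n\|_{\mathcal{H}}\}_{n\in\mathbb{Z}}$ is a Riesz basis of it. For an exact system $\{k_\lambda\}_{\lambda\in\Lambda}$ of reproducing kernels in $\mathcal{H}$ (with $\Lambda\cap\mathbb{Z}=\emptyset$),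 its generating function $G$ is the entire function, unique up to a nonzero multiplicative constant, such that the biorthogonal system is $\left\{\frac{G(z)}{G'(\lambda)(z-\lambda)}\right\}_{\lambda\in\Lambda}$. The corresponding space $\mathcal{S}$ consists of all entire functions $S$ for which there is a sequence $\{a_m\}_{m\in\mathbb{Z}}\in\ell^2$ such that $$\frac{G(z)S(z)}{F(z)}=\sum_{m\in\mathbb{Z}}\frac{a_m}{\|k_m\|_{\mathcal{H}}}\cdot\frac{G(m)}{m-z},\qquad z\in\mathbb{C}\setminus\mathbb{Z}.$$ For a positive increasing function $M$ on $\mathbb{R}_+$, the orthogonal complement to the biorthogonal system has size $M$ if there exist $S\in\mathcal{S}$ and $y_0>0$ such that $\log|S(iy)|\ge M(|y|)$ for all real $y$ with $|y|>y_0$. *)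

theory Defs
  imports "HOL-Analysis.Analysis"
begin

definition ell2 :: "(int \<Rightarrow> complex) set" where
  "ell2 = {a. (\<lambda>n. (cmod (a n))\<^sup>2) summable_on UNIV}"

definition weight_seq :: "(int \<Rightarrow> real) \<Rightarrow> bool" where
  "weight_seq b \<longleftrightarrow>
     (\<forall>n. b n > 0) \<and> (\<lambda>n. b n / (1 + (real_of_int n)\<^sup>2)) summable_on UNIV"

definition sinpi :: "complex \<Rightarrow> complex" where
  "sinpi z = sin (of_real pi * z)"

definition cauchy_sum :: "(int \<Rightarrow> real) \<Rightarrow> (int \<Rightarrow> complex) \<Rightarrow> complex \<Rightarrow> complex" where
  "cauchy_sum b a z = (\<Sum>\<^sub>\<infinity>n. a n * of_real (sqrt (b n)) / (z - of_int n))"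

(* The entire function h is sinpi * f, where f in H(Z,b) is the Cauchy sum with
   coefficients a.  The identity is imposed off the integers, where f is defined;
   the values of h on the integers are then determined by continuity. *)
definition represents :: "(int \<Rightarrow> real) \<Rightarrow> (int \<Rightarrow> complex) \<Rightarrow> (complex \<Rightarrow> complex) \<Rightarrow> bool" where
  "represents b a h \<longleftrightarrow> a \<in> ell2 \<and> h holomorphic_on UNIV \<and>
     (\<forall>z. z \<notin> \<int> \<longrightarrow> h z = sinpi z * cauchy_sum b a z)"

definition hspace :: "(int \<Rightarrow> real) \<Rightarrow> (complex \<Rightarrow> complex) set" where
  "hspace b = {h. \<exists>a. represents b a h}"

(* For b > 0 the coefficients are unique: a n * sqrt (b n) is the residue of
   h / sinpi at n. *)
definition hcoeff :: "(int \<Rightarrow> real) \<Rightarrow> (complex \<Rightarrow> complex) \<Rightarrow> int \<Rightarrow> complex" where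
  "hcoeff b h = (THE a. represents b a h)"

definition hinner :: "(int \<Rightarrow> real) \<Rightarrow> (complex \<Rightarrow> complex) \<Rightarrow> (complex \<Rightarrow> complex) \<Rightarrow> complex" where
  "hinner b g h = (\<Sum>\<^sub>\<infinity>n. hcoeff b g n * cnj (hcoeff b h n))"

definition hnorm :: "(int \<Rightarrow> real) \<Rightarrow> (complex \<Rightarrow> complex) \<Rightarrow> real" where
  "hnorm b h = sqrt (\<Sum>\<^sub>\<infinity>n. (cmod (hcoeff b h n))\<^sup>2)"

definition lin_span :: "(complex \<Rightarrow> complex) set \<Rightarrow> (complex \<Rightarrow> complex) set" where
  "lin_span V = {(\<lambda>z. \<Sum>v\<in>T. c v * v z) | T c. finite T \<and> T \<subseteq> V}"

definition closed_span :: "(int \<Rightarrow> real) \<Rightarrow> (complex \<Rightarrow> complex) set \<Rightarrow> (complex \<Rightarrow> complex) set" where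
  "closed_span b V =
     {h \<in> hspace b. \<forall>\<epsilon>>0. \<exists>g\<in>lin_span V. hnorm b (\<lambda>z. h z - g z) < \<epsilon>}"

definition exact_system :: "(int \<Rightarrow> real) \<Rightarrow> ('i \<Rightarrow> complex \<Rightarrow> complex) \<Rightarrow> 'i set \<Rightarrow> bool" where
  "exact_system b v I \<longleftrightarrow> v ` I \<subseteq> hspace b \<and> closed_span b (v ` I) = hspace b \<and>
     (\<forall>i\<in>I. closed_span b (v ` (I - {i})) \<noteq> hspace b)"

definition biorthogonal ::
    "(int \<Rightarrow> real) \<Rightarrow> ('i \<Rightarrow> complex \<Rightarrow> complex) \<Rightarrow> ('i \<Rightarrow> complex \<Rightarrow> complex) \<Rightarrow> 'i set \<Rightarrow> bool" where
  "biorthogonal b v w I \<longleftrightarrow> w ` I \<subseteq> hspace b \<and>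
     (\<forall>i\<in>I. \<forall>j\<in>I. hinner b (v i) (w j) = (if i = j then 1 else 0))"

definition rkernel :: "(int \<Rightarrow> real) \<Rightarrow> complex \<Rightarrow> complex \<Rightarrow> complex" where
  "rkernel b \<mu> = (THE k. k \<in> hspace b \<and> (\<forall>h\<in>hspace b. hinner b h k = h \<mu>))"

(* The quotient G z / (G' \<mu> * (z - \<mu>)) has a removable singularity at \<mu>, where its value
   is that of the entire function w \<mu>.  G is determined up to a nonzero constant factor. *)
definition generating_function ::
    "(int \<Rightarrow> real) \<Rightarrow> complex set \<Rightarrow> (complex \<Rightarrow> complex) \<Rightarrow> bool" where
  "generating_function b \<Lambda> G \<longleftrightarrow> G holomorphic_on UNIV \<and>
     (\<exists>w. biorthogonal b (rkernel b) w \<Lambda> \<and>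
       (\<forall>\<mu>\<in>\<Lambda>. deriv G \<mu> \<noteq> 0 \<and> (\<forall>z. z \<noteq> \<mu> \<longrightarrow> w \<mu> z = G z / (deriv G \<mu> * (z - \<mu>)))))"

definition sspace :: "(int \<Rightarrow> real) \<Rightarrow> (complex \<Rightarrow> complex) \<Rightarrow> (complex \<Rightarrow> complex) set" where
  "sspace b G = {S. S holomorphic_on UNIV \<and>
     (\<exists>a\<in>ell2. \<forall>z. z \<notin> \<int> \<longrightarrow>
       ((\<lambda>m. a m / of_real (hnorm b (rkernel b (of_int m))) * (G (of_int m) / (of_int m - z)))
          has_sum (G z * S z / sinpi z)) UNIV)}"

(* The space sspace b G is unaffected by the choice of the constant factor in G.
   The conjunct S \<noteq> 0 is needed because ln 0 = 0 here, whereas log 0 means -\<infinity>. *)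
definition complement_has_size ::
    "(int \<Rightarrow> real) \<Rightarrow> complex set \<Rightarrow> (real \<Rightarrow> real) \<Rightarrow> bool" where
  "complement_has_size b \<Lambda> M \<longleftrightarrow>
     (\<exists>G. generating_function b \<Lambda> G \<and>
       (\<exists>S\<in>sspace b G. \<exists>y0>0. \<forall>y::real. \<bar>y\<bar> > y0 \<longrightarrow>
          S (\<i> * of_real y) \<noteq> 0 \<and> ln (cmod (S (\<i> * of_real y))) \<ge> M \<bar>y\<bar>))"

end

theory Submission
  imports Defs "HOL-Complex_Analysis.Complex_Analysis"
begin

text \<open>
  Start from \<open>cos (\<pi> z) = (1 - 4 z\<^sup>2) G z S z\<close>, where the zeros of \<open>S\<close> are
  a symmetric set of half-integers and \<open>\<Lambda>\<close> is the zero set of \<open>G\<close>, and put \<open>b n = \<bar>G n\<bar>\<^sup>2\<close>.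
  The zeros of \<open>S\<close> are odd multiples of \<open>3 ^ k / 2\<close> beyond a radius \<open>R (k - 1)\<close>, so \<open>S\<close> has
  exponential type zero, yet \<open>log \<bar>S (i y)\<bar>\<close> is at least a constant times \<open>\<bar>y\<bar> / 3 ^ k\<close> for
  \<open>\<bar>y\<bar>\<close> up to \<open>R k\<close>; letting the radii grow fast makes this exceed \<open>M\<close>.
  Cutting each level at a radius where its full product has absolute value 1 keeps \<open>\<bar>S n\<bar>\<close>
  bounded below by a multiple of \<open>1 / (1 + \<bar>n\<bar>)\<close> at the integers \<open>n\<close>, so that \<open>b\<close> is bounded.

  A function in the space that vanishes on \<open>\<Lambda>\<close> is \<open>G T\<close> with \<open>T\<close> entire of type zero, and the
  choice of \<open>b\<close> makes \<open>T\<close> square summable on the integers.  Such a \<open>T\<close> is recovered from its values at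
  the integers, hence bounded on a horizontal line, hence constant by Phragmen-Lindelof, hence zero.
  The same interpolation formula puts \<open>G / (z - \<lambda>)\<close> in the space and gives the expansion of \<open>G S / sin (\<pi> z)\<close>.
\<close>

section \<open>Entire functions of exponential type zero\<close>

text \<open>The weight is chosen so that it cancels: the kernel at \<open>n\<close> has norm
  \<open>pi * sqrt (b n)\<close>, which is pi times the modulus of \<open>G n\<close>. Hence both
  the coefficient condition on \<open>S\<close> and the values at the integers of a cofactor
  \<open>T = h / G\<close> become unweighted l2 conditions. The cosine serves as the full product
  because it has modulus 1 at the integers and is comparable with the sine on suitable circles and
  far out on the imaginary axis. The obstacle is the size of \<open>b\<close>. The modulus of
  \<open>G n\<close> is the reciprocal of that of \<open>(1 - 4 n\<^sup>2) S n\<close>, so a product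
  \<open>S\<close> that is nearly exponential on the imaginary axis must not become small at the
  integers. Thinning by powers of an odd base makes each full level an explicit quotient of cosines
  with zeros at half-integers only, and 3 is the smallest such base. At the integers
  \<open>cos (pi z / 3 ^ k)\<close> loses only a factor of order \<open>3 ^ k\<close>, which is at
  most linear in the radius where that cosine takes over.\<close>

lemma Re_mult_csqrt_ge:
  assumes "\<bar>Im v\<bar> \<le> Re v"
  shows "Re (v * csqrt v) \<ge> norm v * sqrt (norm v) / 4"
proof -
  \<comment> \<open>\<open>v * csqrt v\<close> is the power 3/2 of \<open>v\<close>: for
    \<open>v\<close> within angle pi/4 of the positive axis its argument is at most 3 pi/8, whose
    cosine exceeds 1/4. In coordinates the halved angle appears in the slightly weakened form
    \<open>5 * b\<^sup>2 \<le> a\<^sup>2\<close>.\<close>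
  define a b where "a = Re (csqrt v)" and "b = Im (csqrt v)"
  have v: "v = (Complex a b)\<^sup>2"
    unfolding a_def b_def complex_surj by (simp only: power2_csqrt)
  have a0: "a \<ge> 0"
    unfolding a_def using csqrt_principal[of v] by auto
  have re: "Re v = a\<^sup>2 - b\<^sup>2" and im: "Im v = 2 * a * b"
    by (simp_all add: v power2_eq_square)
  have nv: "norm v = a\<^sup>2 + b\<^sup>2"
    by (simp only: v norm_power) (simp add: cmod_power2)
  have h: "2 * a * \<bar>b\<bar> \<le> a\<^sup>2 - b\<^sup>2"
    using assms a0 by (simp add: re im abs_mult)
  have b2: "\<bar>b\<bar> * 2 \<le> a"
  proof (rule ccontr)
    assume "\<not> \<bar>b\<bar> * 2 \<le> a"
    then have "a * a \<le> a * (\<bar>b\<bar> * 2)"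
      using a0 by (intro mult_left_mono) auto
    then have "b\<^sup>2 \<le> 0" using h by (simp add: power2_eq_square algebra_simps)
    then have "b = 0" by simp
    with \<open>\<not> \<bar>b\<bar> * 2 \<le> a\<close> a0 show False by simp
  qed
  have "2 * (\<bar>b\<bar> * 2) * \<bar>b\<bar> \<le> 2 * a * \<bar>b\<bar>"
    using b2 by (intro mult_right_mono) auto
  with h have b5: "5 * b\<^sup>2 \<le> a\<^sup>2" by (simp add: power2_eq_square)
  have "sqrt (norm v) \<le> sqrt ((5/4 * a)\<^sup>2)"
  proof (rule real_sqrt_le_mono)
    have "(5/4 * a)\<^sup>2 = 25/16 * a\<^sup>2" by (simp add: power_mult_distrib power_divide)
    then show "norm v \<le> (5/4 * a)\<^sup>2" unfolding nv using b5 zero_le_power2[of a] by linarith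
  qed
  then have s: "sqrt (norm v) \<le> 5/4 * a" using a0 by simp
  have "norm v * sqrt (norm v) \<le> (6/5 * a\<^sup>2) * (5/4 * a)"
    using b5 s by (intro mult_mono) (auto simp: nv)
  also have "\<dots> = 3/2 * a\<^sup>2 * a" by simp
  finally have 1: "norm v * sqrt (norm v) / 4 \<le> 2/5 * a\<^sup>2 * a"
    using mult_nonneg_nonneg[OF zero_le_power2[of a] a0] by linarith
  have "v * csqrt v = (Complex a b)\<^sup>2 * Complex a b"
    unfolding a_def b_def complex_surj power2_csqrt ..
  then have "Re (v * csqrt v) = Re ((Complex a b)\<^sup>2 * Complex a b)" by (rule arg_cong)
  also have "\<dots> = (a\<^sup>2 - 3 * b\<^sup>2) * a"
    by (simp add: algebra_simps power2_eq_square)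
  also have "\<dots> \<ge> (2/5 * a\<^sup>2) * a"
    using b5 a0 by (intro mult_right_mono) auto
  finally show ?thesis using 1 by linarith
qed

text \<open>Phragmen-Lindelof for a right angle: the damping factor, an exponential of
  \<open>- \<eta>\<close> times the power 3/2 of \<open>w + 1\<close>, has order 3/2, above the
  order 1 of \<open>g\<close> and below the critical order 2 of the sector. The shift by 1 keeps the
  sector off the branch cut of the root. Letting \<eta> tend to 0 removes the factor.\<close>

lemma phragmen_lindelof_sector:
  fixes g :: "complex \<Rightarrow> complex"
  assumes hol: "g holomorphic_on UNIV"
    and bd: "\<And>w. \<bar>Im w\<bar> = Re w \<Longrightarrow> norm (g w) \<le> K"
    and gr: "\<And>w. norm (g w) \<le> C * exp (c * norm w)"
    and z: "\<bar>Im z\<bar> \<le> Re z"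
  shows "norm (g z) \<le> K"
proof -
  have K0: "K \<ge> 0" using order_trans[OF norm_ge_zero bd[of 0]] by simp
  have C0: "C \<ge> 0" using order_trans[OF norm_ge_zero gr[of 0]] by simp
  define q where "q = (\<lambda>w::complex. (w + 1) * csqrt (w + 1))"
  define X where "X = Re (q z)"
  have main: "norm (g z) \<le> (K + \<eta>) * exp (\<eta> * X)" if \<eta>: "\<eta> > 0" for \<eta>
  proof -
    define p where "p = (\<lambda>w. exp (- of_real \<eta> * q w))"
    \<comment> \<open>The radius is such that on the arc \<open>\<eta> * (R * sqrt R / 4)\<close> is
      at least \<open>R * (\<bar>c\<bar> + 1)\<close>; the surplus \<open>exp (- R)\<close> then
      pulls \<open>C\<close> below \<eta>, because \<open>C / \<eta> \<le> R\<close>.\<close>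
    define T where "T = (4 * (\<bar>c\<bar> + 1) / \<eta>)\<^sup>2"
    define R where "R = max (norm z + 1) (max T (C / \<eta>))"
    define Q where "Q = {w. \<bar>Im w\<bar> \<le> Re w \<and> norm w \<le> R}"
    have Qcl: "closed Q"
      unfolding Q_def by (intro closed_Collect_conj closed_Collect_le continuous_intros)
    have pos: "w + 1 \<notin> \<real>\<^sub>\<le>\<^sub>0" if "w \<in> Q" for w
      using that by (auto simp: Q_def complex_nonpos_Reals_iff)
    have holp: "(\<lambda>w. g w * p w) holomorphic_on Q"
      unfolding p_def q_def
      by (intro holomorphic_intros holomorphic_on_compose_gen[OF _ holomorphic_on_csqrt, unfolded o_def]
            holomorphic_on_subset[OF hol]) (use pos in auto)
    have np: "norm (p w) = exp (- \<eta> * Re (q w))" for w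
      by (simp add: p_def)
    have est: "Re (q w) \<ge> norm w * sqrt (norm w) / 4" if "\<bar>Im w\<bar> \<le> Re w" for w
    proof -
      have "norm w \<le> norm (w + 1)"
        using that by (auto simp: cmod_def power2_eq_square algebra_simps intro!: real_sqrt_le_mono)
      then have "norm w * sqrt (norm w) \<le> norm (w + 1) * sqrt (norm (w + 1))"
        by (intro mult_mono) auto
      moreover have "norm (w + 1) * sqrt (norm (w + 1)) / 4 \<le> Re (q w)"
        unfolding q_def using that by (intro Re_mult_csqrt_ge) auto
      ultimately show ?thesis by linarith
    qed
    have "norm (g z * p z) \<le> K + \<eta>"
    proof (rule maximum_modulus_frontier[where S = Q and f = "\<lambda>w. g w * p w"])
      show "(\<lambda>w. g w * p w) holomorphic_on interior Q"
        using holp interior_subset holomorphic_on_subset by blast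
      show "continuous_on (closure Q) (\<lambda>w. g w * p w)"
        using holp Qcl by (simp add: holomorphic_on_imp_continuous_on)
      show "bounded Q"
        by (rule bounded_subset[OF bounded_cball[of 0 R]]) (auto simp: Q_def)
      show "z \<in> Q" using z by (auto simp: Q_def R_def)
      fix w assume w: "w \<in> frontier Q"
      have wQ: "w \<in> Q" using w Qcl frontier_subset_eq by blast
      have "\<not> (\<bar>Im w\<bar> < Re w \<and> norm w < R)"
      proof
        assume a: "\<bar>Im w\<bar> < Re w \<and> norm w < R"
        have "open {w. \<bar>Im w\<bar> < Re w \<and> norm w < R}"
          by (intro open_Collect_conj open_Collect_less continuous_intros)
        moreover have "{w. \<bar>Im w\<bar> < Re w \<and> norm w < R} \<subseteq> Q" by (auto simp: Q_def)
        ultimately have "w \<in> interior Q" using a by (auto simp: interior_def)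
        with w show False by (simp add: frontier_def)
      qed
      moreover have "\<bar>Im w\<bar> \<le> Re w" "norm w \<le> R" using wQ by (simp_all add: Q_def)
      ultimately consider "\<bar>Im w\<bar> = Re w" | "norm w = R" by linarith
      then show "norm (g w * p w) \<le> K + \<eta>"
      proof cases
        case 1
        have "0 \<le> norm w * sqrt (norm w) / 4" by simp
        also have "\<dots> \<le> Re (q w)" using 1 by (intro est) simp
        finally have "0 \<le> Re (q w)" .
        then have "norm (p w) \<le> 1" unfolding np using \<eta> by simp
        then have "norm (g w) * norm (p w) \<le> K * 1"
          using bd[OF 1] K0 by (intro mult_mono) auto
        then show ?thesis using \<eta> by (simp add: norm_mult)
      next
        case 2
        have "norm z + 1 \<le> R" by (simp add: R_def)
        then have R0: "R > 0" using norm_ge_zero[of z] by linarith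
        have "sqrt T \<le> sqrt R" by (rule real_sqrt_le_mono) (simp add: R_def)
        moreover have "sqrt T = 4 * (\<bar>c\<bar> + 1) / \<eta>" unfolding T_def using \<eta> by simp
        ultimately have sR: "4 * (\<bar>c\<bar> + 1) / \<eta> \<le> sqrt R" by simp
        then have "4 * (\<bar>c\<bar> + 1) \<le> \<eta> * sqrt R" using \<eta> by (simp add: field_simps)
        then have "R * (4 * (\<bar>c\<bar> + 1)) \<le> R * (\<eta> * sqrt R)"
          using R0 by (intro mult_left_mono) auto
        then have "R * (\<bar>c\<bar> + 1) \<le> \<eta> * (R * sqrt R / 4)" by (simp add: mult_ac)
        moreover have "\<eta> * (R * sqrt R / 4) \<le> \<eta> * Re (q w)"
          using est[of w] wQ 2 \<eta> by (intro mult_left_mono) (auto simp: Q_def)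
        moreover have "c * R \<le> \<bar>c\<bar> * R" using R0 by (intro mult_right_mono) auto
        ultimately have e: "c * R - \<eta> * Re (q w) \<le> - R"
          by (simp add: algebra_simps)
        have "norm (g w * p w) \<le> (C * exp (c * R)) * exp (- \<eta> * Re (q w))"
          unfolding norm_mult np using gr[of w] 2 by (intro mult_right_mono) auto
        also have "\<dots> = C * exp (c * R - \<eta> * Re (q w))"
          by (simp add: exp_diff exp_minus field_simps)
        also have "\<dots> \<le> C * exp (- R)" using e C0 by (intro mult_left_mono) auto
        also have "\<dots> \<le> \<eta>"
        proof -
          have "C / \<eta> \<le> R" by (simp add: R_def)
          then have "C \<le> \<eta> * R" using \<eta> by (simp add: field_simps)
          also have "\<dots> \<le> \<eta> * exp R" using exp_ge_add_one_self[of R] \<eta> by (intro mult_left_mono) linarith+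
          finally show ?thesis by (simp add: exp_minus field_simps)
        qed
        finally show ?thesis using K0 by linarith
      qed
    qed
    then have "norm (g z) * exp (- (\<eta> * X)) \<le> K + \<eta>" by (simp add: norm_mult np X_def)
    then show ?thesis by (simp add: exp_minus field_simps)
  qed
  have "((\<lambda>\<eta>. (K + \<eta>) * exp (\<eta> * X)) \<longlongrightarrow> (K + 0) * exp (0 * X)) (at_right 0)"
    by (intro tendsto_intros)
  moreover have "\<forall>\<^sub>F \<eta> in at_right 0. norm (g z) \<le> (K + \<eta>) * exp (\<eta> * X)"
    using eventually_at_right_less[of "0::real"] by (rule eventually_mono) (rule main)
  ultimately have "norm (g z) \<le> (K + 0) * exp (0 * X)"
    by (rule tendsto_lowerbound) simp
  then show ?thesis by simp
qed

text \<open>Order 1 is critical for a half-plane, so it is cut into two quadrants, and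
  \<open>f\<close> is multiplied by \<open>exp (- \<epsilon> * z)\<close>. The missing bound on the
  positive real axis comes from the maximum principle: the modified function tends to 0 there, so a
  value above \<open>B\<close> would force its maximum over the closed half-plane to be attained at
  an interior point.\<close>

lemma phragmen_lindelof_half_plane:
  assumes hol: "f holomorphic_on UNIV"
    and type: "\<And>\<epsilon>. \<epsilon> > 0 \<Longrightarrow> \<exists>C. \<forall>z. norm (f z) \<le> C * exp (\<epsilon> * norm z)"
    and bd: "\<And>z. Re z = 0 \<Longrightarrow> norm (f z) \<le> B"
    and z: "Re z \<ge> 0"
  shows "norm (f z) \<le> B"
proof -
  have B0: "B \<ge> 0" using order_trans[OF norm_ge_zero bd[of 0]] by simp
  have main: "norm (f z) \<le> B * exp (\<epsilon> * Re z)" if \<epsilon>: "\<epsilon> > 0" for \<epsilon>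
  proof -
    define g where "g = (\<lambda>z. f z * exp (- of_real \<epsilon> * z))"
    have holg: "g holomorphic_on UNIV"
      unfolding g_def by (intro holomorphic_intros hol)
    have ng: "norm (g w) = norm (f w) * exp (- \<epsilon> * Re w)" for w
      by (simp add: g_def norm_mult)
    obtain C where C: "\<And>z. norm (f z) \<le> C * exp (\<epsilon>/2 * norm z)" using type[of "\<epsilon>/2"] \<epsilon> by auto
    have C0: "C \<ge> 0" using order_trans[OF norm_ge_zero C[of 0]] by simp
    have gx: "norm (g (of_real x)) \<le> C * exp (- (\<epsilon>/2) * x)" if "x \<ge> 0" for x
    proof -
      have "norm (g (of_real x)) \<le> (C * exp (\<epsilon>/2 * x)) * exp (- \<epsilon> * x)"
        unfolding ng using C[of "of_real x"] that by (auto intro!: mult_right_mono)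
      also have "\<dots> = C * exp (- (\<epsilon>/2) * x)" by (simp flip: exp_add)
      finally show ?thesis .
    qed
    have lim: "((\<lambda>x. C * exp (- (\<epsilon>/2) * x)) \<longlongrightarrow> 0) at_top"
      using \<epsilon> by real_asymp
    have gg: "norm (g w) \<le> C * exp ((2 * \<epsilon>) * norm w)" for w
    proof -
      have "norm (g w) \<le> (C * exp (\<epsilon>/2 * norm w)) * exp (\<epsilon> * norm w)"
        unfolding ng
      proof (intro mult_mono C)
        have "- (\<epsilon> * Re w) \<le> \<epsilon> * norm w" using abs_Re_le_cmod[of w] \<epsilon>
          by (metis abs_le_D2 minus_mult_right mult_left_mono less_imp_le)
        then show "exp (- \<epsilon> * Re w) \<le> exp (\<epsilon> * norm w)" by simp
      qed (use C0 in auto)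
      also have "\<dots> = C * exp (3/2 * \<epsilon> * norm w)" by (simp flip: exp_add)
      also have "\<dots> \<le> C * exp ((2 * \<epsilon>) * norm w)"
        using C0 \<epsilon> by (intro mult_left_mono) (auto intro!: mult_right_mono)
      finally show ?thesis .
    qed
    have quad: "norm (g w) \<le> K"
      if q1: "\<And>w. Re w = 0 \<Longrightarrow> norm (g w) \<le> K" and q2: "\<And>x. x \<ge> 0 \<Longrightarrow> norm (g (of_real x)) \<le> K" and q3: "Re w \<ge> 0" for w K
    proof -
      \<comment> \<open>Division by 1 + i or 1 - i turns the upper or the lower quadrant into the
        sector of \<open>phragmen_lindelof_sector\<close>; the two sides of the sector correspond to
        the imaginary and the positive real axis.\<close>
      have *: "norm (g w) \<le> K" if u: "u = Complex 1 1 \<or> u = Complex 1 (-1)" and w: "\<bar>Im (w / u)\<bar> \<le> Re (w / u)" for u w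
      proof -
        have u0: "u \<noteq> 0" using u by (auto simp: complex_eq_iff)
        have nu: "norm u \<le> 2" using u by (auto simp: cmod_def real_le_lsqrt)
        have "norm ((\<lambda>v. g (v * u)) (w / u)) \<le> K"
        proof (rule phragmen_lindelof_sector[where g = "\<lambda>v. g (v * u)" and C = C and c = "4 * \<epsilon>"])
          show "(\<lambda>v. g (v * u)) holomorphic_on UNIV"
            by (rule holomorphic_on_compose_gen[of "\<lambda>v. v * u" UNIV g UNIV, unfolded o_def])
               (use holg in \<open>auto intro!: holomorphic_intros\<close>)
          show "norm (g (v * u)) \<le> C * exp (4 * \<epsilon> * norm v)" for v
          proof -
            have "norm (v * u) \<le> norm v * 2" unfolding norm_mult by (rule mult_left_mono[OF nu]) simp
            then have "2 * \<epsilon> * norm (v * u) \<le> 2 * \<epsilon> * (norm v * 2)" using \<epsilon> by (intro mult_left_mono) auto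
            then have "C * exp (2 * \<epsilon> * norm (v * u)) \<le> C * exp (4 * \<epsilon> * norm v)"
              using C0 by (intro mult_left_mono) auto
            with gg[of "v * u"] show ?thesis by linarith
          qed
          show "norm (g (v * u)) \<le> K" if v: "\<bar>Im v\<bar> = Re v" for v
          proof (cases "Re (v * u) = 0")
            case True then show ?thesis by (rule q1)
          next
            case False
            with u v have "Im (v * u) = 0" by (auto simp: abs_if split: if_splits)
            then have "v * u = of_real (Re (v * u))" by (simp add: complex_eq_iff)
            moreover have "Re (v * u) \<ge> 0" using u v by auto
            ultimately show ?thesis using q2[of "Re (v * u)"] by metis
          qed
        qed (use w in auto)
        then show ?thesis using u0 by simp
      qed
      show ?thesis
      proof (cases "Im w \<ge> 0")
        case True
        then show ?thesis using q3 
          by (intro *[of "Complex 1 1"]) (auto simp: Re_divide Im_divide)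
      next
        case False
        then show ?thesis using q3 
          by (intro *[of "Complex 1 (-1)"]) (auto simp: Re_divide Im_divide)
      qed
    qed
    have gi: "norm (g w) \<le> B" if "Re w = 0" for w
      using bd[OF that] that by (simp add: ng)
    have real: "norm (g (of_real x)) \<le> B" if x: "x \<ge> 0" for x
    proof (rule ccontr)
      assume neg: "\<not> norm (g (of_real x)) \<le> B"
      obtain X where X: "\<And>t. t \<ge> X \<Longrightarrow> C * exp (- (\<epsilon>/2) * t) < norm (g (of_real x))"
      proof -
        have "norm (g (of_real x)) > 0" using neg B0 by linarith
        from order_tendstoD(2)[OF lim this] show ?thesis
          using that by (auto simp: eventually_at_top_linorder)
      qed
      define X' where "X' = max X x"
      have "\<exists>x0\<in>{0..X'}. \<forall>y\<in>{0..X'}. norm (g (of_real y)) \<le> norm (g (of_real x0))"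
        using x by (intro continuous_attains_sup continuous_intros
           continuous_on_compose2[OF holomorphic_on_imp_continuous_on[OF holg]]) (auto simp: X'_def)
      then obtain x0 where x0: "x0 \<ge> 0" "\<And>y. 0 \<le> y \<Longrightarrow> y \<le> X' \<Longrightarrow> norm (g (of_real y)) \<le> norm (g (of_real x0))"
        by auto
      have xx0: "norm (g (of_real x)) \<le> norm (g (of_real x0))" using x0(2)[of x] x by (simp add: X'_def)
      have all: "norm (g (of_real y)) \<le> norm (g (of_real x0))" if "y \<ge> 0" for y
      proof (cases "y \<le> X'")
        case False
        then have "y \<ge> X" by (simp add: X'_def)
        then show ?thesis using gx[OF that] X[of y] xx0 by linarith
      qed (use x0 that in auto)
      have hp: "norm (g w) \<le> norm (g (of_real x0))" if "Re w \<ge> 0" for w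
      proof (rule quad[OF _ all that])
        show "norm (g v) \<le> norm (g (of_real x0))" if "Re v = 0" for v
          using gi[OF that] neg xx0 by linarith
      qed
      have x0pos: "x0 \<noteq> 0"
      proof
        assume "x0 = 0"
        then have "norm (g (of_real x0)) \<le> B" using gi[of 0] by simp
        with neg xx0 show False by linarith
      qed
      have "g constant_on {w. Re w > 0}"
      proof (rule maximum_modulus_principle[where U = "{w. Re w > 0}" and \<xi> = "of_real x0"])
        show "g holomorphic_on {w. Re w > 0}" using holg holomorphic_on_subset by blast
      qed (use x0pos x0(1) hp in \<open>auto intro!: open_halfspace_Re_gt convex_connected convex_halfspace_Re_gt\<close>)
      then obtain k where k: "\<And>w. Re w > 0 \<Longrightarrow> g w = k" by (auto simp: constant_on_def)
      have "norm (g (of_real (max X 1))) < norm (g (of_real x))"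
        by (rule order.strict_trans1[OF gx X]) auto
      moreover have "norm (g (of_real (max X 1))) = norm (g (of_real x0))"
        using k[of "of_real (max X 1)"] k[of "of_real x0"] x0pos x0(1) by auto
      ultimately show False using xx0 by simp
    qed
    have "norm (g z) \<le> B" by (rule quad[OF gi real z])
    then show ?thesis by (simp add: ng exp_minus field_simps)
  qed
  have "((\<lambda>\<epsilon>. B * exp (\<epsilon> * Re z)) \<longlongrightarrow> B * exp (0 * Re z)) (at_right 0)"
    by (intro tendsto_intros)
  moreover have "\<forall>\<^sub>F \<epsilon> in at_right 0. norm (f z) \<le> B * exp (\<epsilon> * Re z)"
    using eventually_at_right_less[of "0::real"] by (rule eventually_mono) (rule main)
  ultimately have "norm (f z) \<le> B * exp (0 * Re z)"
    by (rule tendsto_lowerbound) simp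
  then show ?thesis by simp
qed

lemma zero_type_bounded_imp_constant:
  assumes hol: "f holomorphic_on UNIV"
    and type: "\<And>\<epsilon>. \<epsilon> > 0 \<Longrightarrow> \<exists>C. \<forall>z. norm (f z) \<le> C * exp (\<epsilon> * norm z)"
    and bd: "\<And>z. Re z = 0 \<Longrightarrow> norm (f z) \<le> B"
  obtains c where "\<And>z. f z = c"
proof -
  have "norm (f z) \<le> B" for z
  proof (cases "Re z \<ge> 0")
    case True
    show ?thesis by (rule phragmen_lindelof_half_plane[OF hol type bd True])
  next
    case False
    have "norm ((\<lambda>z. f (- z)) (- z)) \<le> B"
    proof (rule phragmen_lindelof_half_plane[where f = "\<lambda>z. f (- z)"])
      show "(\<lambda>z. f (- z)) holomorphic_on UNIV"
        by (rule holomorphic_on_compose_gen[of uminus UNIV f UNIV, unfolded o_def])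
           (use hol in \<open>auto intro!: holomorphic_intros\<close>)
      show "\<exists>C. \<forall>z. norm (f (- z)) \<le> C * exp (\<epsilon> * norm z)" if "\<epsilon> > 0" for \<epsilon>
        using type[OF that] by (metis norm_minus_cancel)
    qed (use False bd in auto)
    then show ?thesis by simp
  qed
  then have "bounded (range f)" by (auto simp: bounded_iff)
  then have "f constant_on UNIV" using Liouville_theorem hol by blast
  then show ?thesis using that by (auto simp: constant_on_def)
qed

lemma zero_type_from_circles:
  assumes hol: "f holomorphic_on UNIV"
    and "\<epsilon> > 0"
    and circ: "\<And>n z. n \<ge> N \<Longrightarrow> norm z = real n + 1/4 \<Longrightarrow> norm (f z) \<le> C * exp (\<epsilon> * norm z)"
  shows "\<exists>C. \<forall>z. norm (f z) \<le> C * exp (\<epsilon> * norm z)"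
proof (intro exI allI)
  fix z :: complex
  define n where "n = max N (nat \<lceil>norm z\<rceil>)"
  define r where "r = real n + 1/4"
  have r: "norm z \<le> r" "r \<le> norm z + real N + 2"
    unfolding r_def n_def using of_nat_0_le_iff[of N] norm_ge_zero[of z] by linarith+
  have C0: "C \<ge> 0"
    using circ[of n "of_real r"] norm_ge_zero[of "f (of_real r)"]
    by (smt (verit) exp_gt_zero mult_neg_pos norm_of_real max.cobounded1 n_def r_def of_nat_0_le_iff divide_nonneg_nonneg)
  have "norm (f z) \<le> C * exp (\<epsilon> * r)"
  proof (rule maximum_modulus_frontier[where S = "cball 0 r" and f = f])
    show "norm (f w) \<le> C * exp (\<epsilon> * r)" if "w \<in> frontier (cball 0 r)" for w
      using circ[of n w] that by (auto simp: frontier_cball r_def n_def)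
  qed (use hol r in \<open>auto intro: holomorphic_on_subset holomorphic_on_imp_continuous_on\<close>)
  also have "\<dots> \<le> C * (exp (\<epsilon> * (real N + 2)) * exp (\<epsilon> * norm z))"
    using C0 r \<open>\<epsilon> > 0\<close> by (intro mult_left_mono) (auto simp flip: exp_add distrib_left intro!: mult_left_mono)
  finally show "norm (f z) \<le> (C * exp (\<epsilon> * (real N + 2))) * exp (\<epsilon> * norm z)" by (simp add: mult_ac)
qed

section \<open>Sine and cosine on circles of radius n + 1/4 and on the whole plane\<close>

text \<open>The radius lies midway between \<open>n\<close> and the half-integer
  \<open>n + 1/2\<close>, so the circle avoids the zeros of sine and cosine alike. Off the real axis
  \<open>cosh\<close> is at least 5/4; near it \<open>\<bar>Re z\<bar> - n\<close> lies in
  [3/16, 1/4], where the cosine of the doubled angle is at most 1/2.\<close>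

lemma abs_cos_double_le_on_circle:
  assumes "norm z = real n + 1/4"
  shows "\<bar>cos (2 * (pi * Re z))\<bar> \<le> 4/5 * cosh (2 * (pi * Im z))"
proof (cases "\<bar>Im z\<bar> \<ge> 1/8")
  case True
  define t where "t = 2 * (pi * Im z)"
  have "1 / 8 * 6 \<le> \<bar>Im z\<bar> * (2 * pi)"
    using True pi_gt3 by (intro mult_mono) auto
  then have t: "\<bar>t\<bar> \<ge> 3/4" by (simp add: t_def abs_mult mult_ac)
  have "exp \<bar>t\<bar> \<ge> 1 + \<bar>t\<bar> + \<bar>t\<bar>\<^sup>2 / 2"
    by (rule exp_lower_Taylor_quadratic) simp
  moreover have "(3/4)\<^sup>2 \<le> \<bar>t\<bar>\<^sup>2" using t by (intro power_mono) auto
  ultimately have e2: "exp \<bar>t\<bar> \<ge> 2" using t by (simp add: power2_eq_square)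
  then have "(exp \<bar>t\<bar> - 2) * (exp \<bar>t\<bar> - 1/2) \<ge> 0" by (intro mult_nonneg_nonneg) auto
  then have "exp \<bar>t\<bar> + inverse (exp \<bar>t\<bar>) \<ge> 5/2"
    using e2 by (simp add: field_simps)
  then have "cosh \<bar>t\<bar> \<ge> 5/4" by (simp add: cosh_def exp_minus)
  then have "cosh t \<ge> 5/4" by (simp add: abs_if split: if_splits)
  moreover have "\<bar>cos (2 * (pi * Re z))\<bar> \<le> 1" by simp
  ultimately show ?thesis unfolding t_def by linarith
next
  case False
  define x y where "x = \<bar>Re z\<bar>" and "y = Im z"
  have "(real n + 1/4)\<^sup>2 = x\<^sup>2 + y\<^sup>2"
    using assms by (metis cmod_power2 x_def y_def power2_abs)
  have y2: "y\<^sup>2 \<le> (1/8)\<^sup>2" using False by (intro power2_le_iff_abs_le[THEN iffD2]) (auto simp: y_def)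
  have "x \<le> real n + 1/4" using abs_Re_le_cmod[of z] assms by (simp add: x_def)
  moreover have "real n + 3/16 \<le> x"
  proof (rule power2_le_imp_le)
    have "(real n + 3/16)\<^sup>2 + (1/8)\<^sup>2 \<le> (real n + 1/4)\<^sup>2"
      by (simp add: power2_eq_square algebra_simps)
    then show "(real n + 3/16)\<^sup>2 \<le> x\<^sup>2" using y2 \<open>(real n + 1/4)\<^sup>2 = x\<^sup>2 + y\<^sup>2\<close> by linarith
  qed (simp add: x_def)
  ultimately have u: "3/16 \<le> x - real n" "x - real n \<le> 1/4" by auto
  define u where "u = 2 * pi * (x - real n)"
  have "cos (2 * (pi * Re z)) = cos (2 * (pi * x))"
    by (cases "Re z \<ge> 0") (auto simp: x_def)
  also have "\<dots> = cos (u + 2 * real n * pi)" by (simp add: u_def algebra_simps)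
  also have "\<dots> = cos u" by (simp only: cos_add cos_2npi sin_2npi)
  finally have c: "cos (2 * (pi * Re z)) = cos u" .
  have "2 * pi * (1/6) \<le> u" "u \<le> 2 * pi * (1/4)"
    unfolding u_def using u by (intro mult_left_mono; simp)+
  then have "pi / 3 \<le> u" "u \<le> pi / 2" by simp_all
  then have "0 \<le> cos u" "cos u \<le> cos (pi/3)"
    using pi_gt_zero by (auto intro!: cos_ge_zero cos_monotone_0_pi_le)
  then have "\<bar>cos u\<bar> \<le> 1/2" by (simp add: cos_60)
  moreover have "cosh (2 * (pi * Im z)) \<ge> 1" by (rule cosh_real_ge_1)
  ultimately show ?thesis unfolding c by linarith
qed

lemma norm_sin_cosh: "(norm (sin (z::complex)))\<^sup>2 = (cosh (2 * Im z) - cos (2 * Re z)) / 2"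
  and norm_cos_cosh: "(norm (cos (z::complex)))\<^sup>2 = (cosh (2 * Im z) + cos (2 * Re z)) / 2"
proof -
  show "(norm (sin z))\<^sup>2 = (cosh (2 * Im z) - cos (2 * Re z)) / 2"
    by (simp only: norm_sin_squared cosh_def exp_minus real_scaleR_def) (simp add: field_simps)
  have "(cos (Re z))\<^sup>2 = (cos (2 * Re z) + 1) / 2" by (simp only: cos_double_cos) argo
  moreover have "(exp (Im z) - inverse (exp (Im z)))\<^sup>2 = exp (2 * Im z) + exp (- (2 * Im z)) - 2"
    by (simp add: power2_eq_square algebra_simps flip: exp_minus exp_add)
  ultimately show "(norm (cos z))\<^sup>2 = (cosh (2 * Im z) + cos (2 * Re z)) / 2"
    by (simp only: norm_cos_squared cosh_def real_scaleR_def) (simp add: field_simps)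
qed

text \<open>With \<open>\<bar>d\<bar> \<le> 4/5 * c\<close> the quotient of \<open>c - d\<close> and
  \<open>c + d\<close> is at most 9 either way, which gives the constant 3; the lower bounds follow
  from \<open>c \<ge> 1\<close>.\<close>

lemma trig_on_circle:
  assumes "norm (z::complex) = real n + 1/4"
  shows "norm (sin (of_real pi * z)) \<le> 3 * norm (cos (of_real pi * z))"
    and "norm (cos (of_real pi * z)) \<le> 3 * norm (sin (of_real pi * z))"
    and "norm (sin (of_real pi * z)) \<ge> 1/4"
    and "norm (cos (of_real pi * z)) \<ge> 1/4"
proof -
  define c where "c = cosh (2 * (pi * Im z))"
  have c1: "c \<ge> 1" unfolding c_def by (rule cosh_real_ge_1)
  define d where "d = cos (2 * (pi * Re z))"
  have d: "\<bar>d\<bar> \<le> 4/5 * c" unfolding c_def d_def by (rule abs_cos_double_le_on_circle[OF assms])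
  have s: "(norm (sin (of_real pi * z)))\<^sup>2 = (c - d) / 2"
    and k: "(norm (cos (of_real pi * z)))\<^sup>2 = (c + d) / 2"
    by (simp_all add: norm_sin_cosh norm_cos_cosh c_def d_def)
  show "norm (sin (of_real pi * z)) \<le> 3 * norm (cos (of_real pi * z))"
    by (rule power2_le_imp_le) (use d s k c1 in \<open>auto simp: power_mult_distrib\<close>)
  show "norm (cos (of_real pi * z)) \<le> 3 * norm (sin (of_real pi * z))"
    by (rule power2_le_imp_le) (use d s k c1 in \<open>auto simp: power_mult_distrib\<close>)
  show "norm (sin (of_real pi * z)) \<ge> 1/4"
    by (rule power2_le_imp_le) (use d s k c1 in \<open>auto simp: power_divide\<close>)
  show "norm (cos (of_real pi * z)) \<ge> 1/4"
    by (rule power2_le_imp_le) (use d s k c1 in \<open>auto simp: power_divide\<close>)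
qed

section \<open>Square summable sequences\<close>

definition l2ip :: "(int \<Rightarrow> complex) \<Rightarrow> (int \<Rightarrow> complex) \<Rightarrow> complex" where
  "l2ip a b = (\<Sum>\<^sub>\<infinity>n. a n * cnj (b n))"

definition l2sq :: "(int \<Rightarrow> complex) \<Rightarrow> real" where
  "l2sq a = (\<Sum>\<^sub>\<infinity>n. (cmod (a n))\<^sup>2)"

lemma ell2D: "a \<in> ell2 \<Longrightarrow> (\<lambda>n. (cmod (a n))\<^sup>2) summable_on UNIV"
  by (simp add: ell2_def)

lemma l2sq_nonneg: "l2sq a \<ge> 0"
  unfolding l2sq_def by (intro infsum_nonneg) auto

lemma
  assumes "\<And>F. finite F \<Longrightarrow> (\<Sum>n\<in>F. (cmod (a n))\<^sup>2) \<le> B"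
  shows ell2_bounded_sums: "a \<in> ell2" and l2sq_le: "l2sq a \<le> B"
proof -
  show "a \<in> ell2" unfolding ell2_def mem_Collect_eq
    by (intro nonneg_bdd_above_summable_on bdd_aboveI2[where M = B]) (use assms in auto)
  then show "l2sq a \<le> B" unfolding l2sq_def
    by (intro infsum_le_finite_sums ell2D) (use assms in auto)
qed

lemma ell2_dominated:
  assumes "a \<in> ell2" and "\<And>n. cmod (b n) \<le> C * cmod (a n)"
  shows "b \<in> ell2"
proof -
  have "(\<lambda>n. C\<^sup>2 * (cmod (a n))\<^sup>2) summable_on UNIV"
    by (intro summable_on_cmult_right ell2D assms)
  then have "(\<lambda>n. (cmod (b n))\<^sup>2) summable_on UNIV"
  proof (rule summable_on_comparison_test)
    show "(cmod (b n))\<^sup>2 \<le> C\<^sup>2 * (cmod (a n))\<^sup>2" for n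
      using power_mono[OF assms(2)[of n], of 2] by (simp add: power_mult_distrib)
  qed auto
  then show ?thesis by (simp add: ell2_def)
qed

lemma ell2_add:
  assumes "a \<in> ell2" "b \<in> ell2"
  shows "(\<lambda>n. a n + b n) \<in> ell2"
proof -
  have "(\<lambda>n. 2 * (cmod (a n))\<^sup>2 + 2 * (cmod (b n))\<^sup>2) summable_on UNIV"
    by (intro summable_on_add summable_on_cmult_right ell2D assms)
  then have "(\<lambda>n. (cmod (a n + b n))\<^sup>2) summable_on UNIV"
  proof (rule summable_on_comparison_test)
    fix n
    have "(cmod (a n + b n))\<^sup>2 \<le> (cmod (a n) + cmod (b n))\<^sup>2"
      by (intro power_mono norm_triangle_ineq) auto
    also have "\<dots> \<le> 2 * (cmod (a n))\<^sup>2 + 2 * (cmod (b n))\<^sup>2"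
      using zero_le_power2[of "cmod (a n) - cmod (b n)"] by (simp add: power2_eq_square algebra_simps)
    finally show "(cmod (a n + b n))\<^sup>2 \<le> 2 * (cmod (a n))\<^sup>2 + 2 * (cmod (b n))\<^sup>2" .
  qed auto
  then show ?thesis by (simp add: ell2_def)
qed

lemma ell2_scale: "a \<in> ell2 \<Longrightarrow> (\<lambda>n. c * a n) \<in> ell2"
  by (erule ell2_dominated[where C = "cmod c"]) (simp add: norm_mult)

lemma ell2_diff: "a \<in> ell2 \<Longrightarrow> b \<in> ell2 \<Longrightarrow> (\<lambda>n. a n - b n) \<in> ell2"
  using ell2_add[of a "\<lambda>n. (-1) * b n"] ell2_scale[of b "-1"] by simp

lemma ell2_0: "(\<lambda>n. 0) \<in> ell2" by (simp add: ell2_def)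

lemma l2ip_abs_summable:
  assumes "a \<in> ell2" "b \<in> ell2"
  shows "(\<lambda>n. cmod (a n * cnj (b n))) summable_on UNIV"
proof -
  have "(\<lambda>n. (cmod (a n))\<^sup>2 + (cmod (b n))\<^sup>2) summable_on UNIV"
    by (intro summable_on_add ell2D assms)
  then show ?thesis
  proof (rule summable_on_comparison_test)
    fix n
    have "0 \<le> (cmod (a n) - cmod (b n))\<^sup>2 + (cmod (a n) * cmod (a n) + cmod (b n) * cmod (b n))"
      by (intro add_nonneg_nonneg) auto
    then show "cmod (a n * cnj (b n)) \<le> (cmod (a n))\<^sup>2 + (cmod (b n))\<^sup>2"
      by (simp add: norm_mult power2_eq_square algebra_simps)
  qed auto
qed

lemma l2ip_summable: "a \<in> ell2 \<Longrightarrow> b \<in> ell2 \<Longrightarrow> (\<lambda>n. a n * cnj (b n)) summable_on UNIV"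
  by (rule abs_summable_summable[OF l2ip_abs_summable])

lemma l2ip_add_left:
  "a \<in> ell2 \<Longrightarrow> b \<in> ell2 \<Longrightarrow> c \<in> ell2 \<Longrightarrow> l2ip (\<lambda>n. a n + b n) c = l2ip a c + l2ip b c"
  unfolding l2ip_def by (subst infsum_add[symmetric]) (auto intro: l2ip_summable simp: algebra_simps)

lemma l2ip_scale_left: "l2ip (\<lambda>n. k * a n) c = k * l2ip a c"
  unfolding l2ip_def by (simp add: mult.assoc infsum_cmult_right')

lemma l2ip_diff_left:
  "a \<in> ell2 \<Longrightarrow> b \<in> ell2 \<Longrightarrow> c \<in> ell2 \<Longrightarrow> l2ip (\<lambda>n. a n - b n) c = l2ip a c - l2ip b c"
  using l2ip_add_left[of a "\<lambda>n. (-1) * b n" c] ell2_scale[of b "-1"] l2ip_scale_left[of "-1" b c] by simp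

lemma l2ip_commute: "l2ip b a = cnj (l2ip a b)"
  unfolding l2ip_def by (subst infsum_cnj[symmetric]) (simp add: mult.commute)

lemma l2ip_self:
  assumes "a \<in> ell2" shows "l2ip a a = of_real (l2sq a)"
proof -
  have "((\<lambda>n. of_real ((cmod (a n))\<^sup>2) :: complex) has_sum of_real (l2sq a)) UNIV"
    unfolding has_sum_of_real_iff l2sq_def using assms by (intro has_sum_infsum ell2D)
  then show ?thesis
    unfolding l2ip_def complex_norm_square by (rule infsumI)
qed

lemma l2sq_eq_0:
  assumes "a \<in> ell2" "l2sq a = 0" shows "a n = 0"
  using nonneg_infsum_le_0D[of "\<lambda>n. (cmod (a n))\<^sup>2" UNIV n] assms
  by (auto simp: l2sq_def ell2D)

lemma l2sq_diff_scale:
  assumes "a \<in> ell2" "b \<in> ell2"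
  shows "l2sq (\<lambda>n. a n - t * b n) = l2sq a - 2 * Re (cnj t * l2ip a b) + (cmod t)\<^sup>2 * l2sq b"
proof -
  let ?u = "\<lambda>n. a n - t * b n" and ?tb = "\<lambda>n. t * b n"
  have tb: "?tb \<in> ell2" using assms by (simp add: ell2_scale)
  have u: "?u \<in> ell2" using assms tb by (simp add: ell2_diff)
  have ab: "l2ip a ?tb = cnj t * l2ip a b"
    by (subst l2ip_commute, subst l2ip_scale_left) (simp add: l2ip_commute[of a b])
  have "l2ip ?u ?u = l2ip a ?u - l2ip ?tb ?u" using assms tb u by (simp add: l2ip_diff_left)
  also have "l2ip a ?u = cnj (l2ip ?u a)" by (rule l2ip_commute)
  also have "l2ip ?u a = l2ip a a - l2ip ?tb a" using assms tb by (simp add: l2ip_diff_left)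
  also have "l2ip ?tb ?u = cnj (l2ip ?u ?tb)" by (rule l2ip_commute)
  also have "l2ip ?u ?tb = l2ip a ?tb - l2ip ?tb ?tb" using assms tb by (simp add: l2ip_diff_left)
  also have "l2ip ?tb ?tb = t * cnj t * l2ip b b"
    by (subst l2ip_scale_left, subst l2ip_commute, subst l2ip_scale_left) (simp add: l2ip_self assms)
  also have "l2ip ?tb a = cnj (l2ip a ?tb)" by (rule l2ip_commute)
  finally have "of_real (l2sq ?u) =
     of_real (l2sq a) - cnj t * l2ip a b - cnj (cnj t * l2ip a b) + of_real ((cmod t)\<^sup>2 * l2sq b)"
    unfolding ab l2ip_self[OF assms(1)] l2ip_self[OF assms(2)] l2ip_self[OF u] by (simp add: complex_norm_square algebra_simps del: of_real_power)
  then have "Re (of_real (l2sq ?u)) = Re (of_real (l2sq a) - cnj t * l2ip a b - cnj (cnj t * l2ip a b) + of_real ((cmod t)\<^sup>2 * l2sq b))"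
    by (rule arg_cong)
  then show ?thesis by simp
qed

lemma l2_cauchy_schwarz:
  assumes "a \<in> ell2" "b \<in> ell2"
  shows "cmod (l2ip a b) \<le> sqrt (l2sq a) * sqrt (l2sq b)"
proof (cases "l2sq b = 0")
  case True
  then have "b n = 0" for n using l2sq_eq_0 assms by blast
  then show ?thesis by (simp add: l2ip_def l2sq_nonneg)
next
  case False
  then have B: "l2sq b > 0" using l2sq_nonneg[of b] by linarith
  define t where "t = l2ip a b / of_real (l2sq b)"
  have "0 \<le> l2sq a - 2 * Re (cnj t * l2ip a b) + (cmod t)\<^sup>2 * l2sq b"
    using l2sq_nonneg[of "\<lambda>n. a n - t * b n"] l2sq_diff_scale[OF assms, of t] by simp
  also have "cnj t * l2ip a b = of_real ((cmod (l2ip a b))\<^sup>2 / l2sq b)"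
    by (simp only: t_def complex_cnj_divide complex_cnj_complex_of_real of_real_divide complex_norm_square) simp
  also have "(cmod t)\<^sup>2 * l2sq b = (cmod (l2ip a b))\<^sup>2 / l2sq b"
    using B by (simp add: t_def norm_divide power_divide power2_eq_square)
  finally have "(cmod (l2ip a b))\<^sup>2 \<le> l2sq a * l2sq b"
    using B by (simp add: field_simps)
  then show ?thesis
    by (simp add: real_le_rsqrt flip: real_sqrt_mult)
qed

text \<open>The parallelogram law, solved for the difference: this is what makes minimising
  sequences Cauchy.\<close>

lemma l2sq_diff_eq:
  assumes "a \<in> ell2" "b \<in> ell2"
  shows "l2sq (\<lambda>n. a n - b n) = 2 * l2sq a + 2 * l2sq b - 4 * l2sq (\<lambda>n. (a n + b n) / 2)"
proof -
  have "l2sq (\<lambda>n. a n - 1 * b n) = l2sq a - 2 * Re (l2ip a b) + l2sq b"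
    using l2sq_diff_scale[OF assms, of 1] by simp
  moreover have "l2sq (\<lambda>n. a n - (-1) * b n) = l2sq a + 2 * Re (l2ip a b) + l2sq b"
    using l2sq_diff_scale[OF assms, of "-1"] by simp
  moreover have "(cmod ((a n + b n) / 2))\<^sup>2 = (1/4) * (cmod (a n + b n))\<^sup>2" for n
    by (simp add: norm_divide power_divide)
  then have "l2sq (\<lambda>n. (a n + b n) / 2) = (1/4) * l2sq (\<lambda>n. a n + b n)"
    unfolding l2sq_def by (simp only: infsum_cmult_right')
  ultimately show ?thesis by simp
qed

lemma cmod_square_le_l2sq:
  assumes "a \<in> ell2" shows "(cmod (a n))\<^sup>2 \<le> l2sq a"
  unfolding l2sq_def using finite_sum_le_infsum[OF ell2D[OF assms], of "{n}"] by simp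

text \<open>Projection argument for a subspace that need not be closed: the residuals of a
  minimising sequence converge to some \<open>w\<close>, minimality makes \<open>w\<close>
  orthogonal to \<open>V\<close>, hence \<open>w\<close> is 0 and the residuals tend to 0 in
  norm.\<close>

theorem ell2_dense_subspace:
  assumes V: "V \<subseteq> ell2" and V0: "(\<lambda>n. 0) \<in> V"
    and Vlin: "\<And>u v c. u \<in> V \<Longrightarrow> v \<in> V \<Longrightarrow> (\<lambda>n. u n + c * v n) \<in> V"
    and orth: "\<And>u. u \<in> ell2 \<Longrightarrow> (\<And>v. v \<in> V \<Longrightarrow> l2ip u v = 0) \<Longrightarrow> u = (\<lambda>n. 0)"
    and x: "x \<in> ell2" and e: "\<epsilon> > 0"
  shows "\<exists>v\<in>V. l2sq (\<lambda>n. x n - v n) < \<epsilon>"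
proof -
  define D where "D = (\<lambda>v. l2sq (\<lambda>n. x n - v n)) ` V"
  define d where "d = Inf D"
  have D: "D \<noteq> {}" "bdd_below D" using V0 l2sq_nonneg by (auto simp: D_def intro!: bdd_belowI2[where m = 0])
  have d_le: "d \<le> l2sq (\<lambda>n. x n - v n)" if "v \<in> V" for v
    unfolding d_def using that D by (intro cInf_lower) (auto simp: D_def)
  have "\<forall>i. \<exists>v. v \<in> V \<and> l2sq (\<lambda>n. x n - v n) < d + 1 / real (Suc i)"
  proof
    fix i
    have "Inf D < d + 1 / real (Suc i)" by (simp add: d_def)
    from cInf_lessD[OF D(1) this] show "\<exists>v. v \<in> V \<and> l2sq (\<lambda>n. x n - v n) < d + 1 / real (Suc i)"
      by (auto simp: D_def)
  qed
  from choice[OF this] obtain v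
    where v: "\<And>i. v i \<in> V" "\<And>i. l2sq (\<lambda>n. x n - v i n) < d + 1 / real (Suc i)" by auto
  define u where "u = (\<lambda>i n. x n - v i n)"
  have u: "u i \<in> ell2" for i unfolding u_def using v V x by (intro ell2_diff) auto
  have ud: "l2sq (u i) < d + 1 / real (Suc i)" for i using v(2)[of i] by (simp add: u_def)
  have close: "l2sq (\<lambda>n. u i n - u j n) \<le> 2 / real (Suc i) + 2 / real (Suc j)" for i j
  proof -
    have "(\<lambda>n. (0 + (1/2) * v i n) + (1/2) * v j n) \<in> V" by (intro Vlin V0 v(1))
    from d_le[OF this] have "d \<le> l2sq (\<lambda>n. (u i n + u j n) / 2)"
      by (simp add: u_def field_simps)
    then show ?thesis using l2sq_diff_eq[OF u u, of i j] ud[of i] ud[of j] by linarith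
  qed
  have lim0: "(\<lambda>i. 1 / real (Suc i)) \<longlonglongrightarrow> 0" by real_asymp
  have "Cauchy (\<lambda>i. u i n)" for n
  proof (rule metric_CauchyI)
    fix r :: real assume r: "r > 0"
    then have "\<forall>\<^sub>F i in sequentially. 1 / real (Suc i) < r\<^sup>2 / 4"
      by (intro order_tendstoD[OF lim0]) auto
    then obtain N where N: "\<And>i. i \<ge> N \<Longrightarrow> 1 / real (Suc i) < r\<^sup>2 / 4"
      by (auto simp: eventually_sequentially)
    show "\<exists>M. \<forall>i\<ge>M. \<forall>j\<ge>M. dist (u i n) (u j n) < r"
    proof (intro exI allI impI)
      fix i j assume "i \<ge> N" "j \<ge> N"
      have "(cmod (u i n - u j n))\<^sup>2 \<le> l2sq (\<lambda>n. u i n - u j n)"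
        using cmod_square_le_l2sq[OF ell2_diff[OF u[of i] u[of j]], of n] by simp
      also have "\<dots> < r\<^sup>2" using close[of i j] N[OF \<open>i \<ge> N\<close>] N[OF \<open>j \<ge> N\<close>] by linarith
      finally show "dist (u i n) (u j n) < r" using r by (simp add: dist_norm power2_less_imp_less)
    qed
  qed
  then have "\<forall>n. \<exists>l. (\<lambda>i. u i n) \<longlonglongrightarrow> l"
    by (simp add: Cauchy_convergent_iff convergent_def)
  from choice[OF this] obtain w where w: "\<And>n. (\<lambda>i. u i n) \<longlonglongrightarrow> w n" by auto
  \<comment> \<open>Coordinatewise limits are enough: letting \<open>j\<close> tend to infinity in
    each finite partial sum of \<open>close\<close> bounds \<open>u i - w\<close> in l2.\<close>
  have diff: "(\<lambda>n. u i n - w n) \<in> ell2 \<and> l2sq (\<lambda>n. u i n - w n) \<le> 2 / real (Suc i)" for i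
  proof -
    have "(\<Sum>n\<in>F. (cmod (u i n - w n))\<^sup>2) \<le> 2 / real (Suc i)" if F: "finite F" for F
    proof (rule tendsto_le[OF sequentially_bot])
      show "(\<lambda>j. \<Sum>n\<in>F. (cmod (u i n - u j n))\<^sup>2) \<longlonglongrightarrow> (\<Sum>n\<in>F. (cmod (u i n - w n))\<^sup>2)"
        by (intro tendsto_intros w)
      show "(\<lambda>j. 2 / real (Suc i) + 2 / real (Suc j)) \<longlonglongrightarrow> 2 / real (Suc i)" by real_asymp
      show "\<forall>\<^sub>F j in sequentially. (\<Sum>n\<in>F. (cmod (u i n - u j n))\<^sup>2) \<le> 2 / real (Suc i) + 2 / real (Suc j)"
      proof (intro always_eventually allI)
        fix j
        have "(\<Sum>n\<in>F. (cmod (u i n - u j n))\<^sup>2) \<le> l2sq (\<lambda>n. u i n - u j n)"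
          unfolding l2sq_def by (intro finite_sum_le_infsum ell2D ell2_diff u F) auto
        with close[of i j] show "(\<Sum>n\<in>F. (cmod (u i n - u j n))\<^sup>2) \<le> 2 / real (Suc i) + 2 / real (Suc j)"
          by linarith
      qed
    qed
    then show ?thesis by (intro conjI ell2_bounded_sums l2sq_le)
  qed
  have well: "w \<in> ell2"
    using ell2_diff[OF u conjunct1[OF diff], of 0 0] by simp
  have "w = (\<lambda>n. 0)"
  proof (rule orth[OF well])
    fix y assume y: "y \<in> V"
    then have yl: "y \<in> ell2" using V by auto
    have tend: "(\<lambda>i. l2ip (u i) y) \<longlonglongrightarrow> l2ip w y"
    proof (rule Lim_transform_bound[THEN LIM_zero_cancel])
      show "\<forall>\<^sub>F i in sequentially. norm (l2ip (u i) y - l2ip w y) \<le> norm (sqrt (2 / real (Suc i)) * sqrt (l2sq y))"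
      proof (intro always_eventually allI)
        fix i
        have "l2ip (u i) y - l2ip w y = l2ip (\<lambda>n. u i n - w n) y" using u well yl by (simp add: l2ip_diff_left)
        also have "norm \<dots> \<le> sqrt (l2sq (\<lambda>n. u i n - w n)) * sqrt (l2sq y)"
          using diff yl by (intro l2_cauchy_schwarz) auto
        also have "\<dots> \<le> sqrt (2 / real (Suc i)) * sqrt (l2sq y)"
          using diff[of i] by (intro mult_right_mono real_sqrt_le_mono) (auto simp: l2sq_nonneg)
        finally show "norm (l2ip (u i) y - l2ip w y) \<le> norm (sqrt (2 / real (Suc i)) * sqrt (l2sq y))"
          by (simp add: l2sq_nonneg)
      qed
      show "(\<lambda>i. sqrt (2 / real (Suc i)) * sqrt (l2sq y)) \<longlonglongrightarrow> 0"
        by (rule tendsto_mult_left_zero) real_asymp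
    qed
    \<comment> \<open>Minimality of \<open>d\<close> is tested with the competitor
      \<open>v i + t * y\<close>; the unknown \<open>d\<close> cancels against the upper bound
      \<open>ud\<close> for the residual.\<close>
    have var: "2 * Re (cnj t * l2ip w y) \<le> (cmod t)\<^sup>2 * l2sq y" for t
    proof (rule tendsto_le[OF sequentially_bot])
      show "(\<lambda>i. 2 * Re (cnj t * l2ip (u i) y)) \<longlonglongrightarrow> 2 * Re (cnj t * l2ip w y)"
        by (intro tendsto_intros tend)
      show "(\<lambda>i. 1 / real (Suc i) + (cmod t)\<^sup>2 * l2sq y) \<longlonglongrightarrow> (cmod t)\<^sup>2 * l2sq y"
        using tendsto_add[OF lim0 tendsto_const[of "(cmod t)\<^sup>2 * l2sq y"]] by simp
      show "\<forall>\<^sub>F i in sequentially. 2 * Re (cnj t * l2ip (u i) y) \<le> 1 / real (Suc i) + (cmod t)\<^sup>2 * l2sq y"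
      proof (intro always_eventually allI)
        fix i
        have "d \<le> l2sq (\<lambda>n. x n - (v i n + t * y n))" by (intro d_le Vlin v(1) y)
        also have "(\<lambda>n. x n - (v i n + t * y n)) = (\<lambda>n. u i n - t * y n)" by (simp add: u_def algebra_simps)
        finally show "2 * Re (cnj t * l2ip (u i) y) \<le> 1 / real (Suc i) + (cmod t)\<^sup>2 * l2sq y"
          using ud[of i] l2sq_diff_scale[OF u yl, of i t] by linarith
      qed
    qed
    \<comment> \<open>With \<open>t\<close> a multiple \<open>s\<close> of the inner product, the
      left side of \<open>var\<close> is linear in \<open>s\<close> and the right side quadratic, so
      a small \<open>s\<close> forces the inner product to vanish;
      \<open>s = 1 / (1 + l2sq y)\<close> is small enough.\<close>
    have "2 * (cmod (l2ip w y))\<^sup>2 \<le> s * ((cmod (l2ip w y))\<^sup>2 * l2sq y)" if s: "s > 0" for s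
    proof -
      have "cnj (of_real s * l2ip w y) * l2ip w y = of_real (s * (cmod (l2ip w y))\<^sup>2)"
        by (simp only: of_real_mult complex_norm_square) simp
      then have "Re (cnj (of_real s * l2ip w y) * l2ip w y) = s * (cmod (l2ip w y))\<^sup>2"
        by (simp only: Re_complex_of_real)
      then have "2 * (s * (cmod (l2ip w y))\<^sup>2) \<le> s\<^sup>2 * (cmod (l2ip w y))\<^sup>2 * l2sq y"
        using var[of "of_real s * l2ip w y"] by (simp only: norm_mult power_mult_distrib norm_of_real power2_abs)
      then have "s * (2 * (cmod (l2ip w y))\<^sup>2) \<le> s * (s * ((cmod (l2ip w y))\<^sup>2 * l2sq y))"
        by (simp add: power2_eq_square mult_ac)
      then show ?thesis using s by (simp only: mult_le_cancel_left_pos)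
    qed
    from this[of "1 / (1 + l2sq y)"] have "(cmod (l2ip w y))\<^sup>2 * (2 + l2sq y) \<le> 0"
      using l2sq_nonneg[of y] by (simp add: field_simps)
    then have "(cmod (l2ip w y))\<^sup>2 \<le> 0"
      using l2sq_nonneg[of y] by (simp add: mult_le_0_iff)
    then show "l2ip w y = 0" by simp
  qed
  then have ui: "l2sq (u i) \<le> 2 / real (Suc i)" for i using diff[of i] by simp
  have "\<forall>\<^sub>F i in sequentially. 1 / real (Suc i) < \<epsilon> / 2"
    using e by (intro order_tendstoD[OF lim0]) auto
  then obtain i where "1 / real (Suc i) < \<epsilon> / 2" by (auto simp: eventually_sequentially)
  with ui[of i] have "l2sq (u i) < \<epsilon>" by linarith
  then show ?thesis using v(1)[of i] by (auto simp: u_def)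
qed

section \<open>Products over half-integers\<close>

text \<open>The index \<open>m\<close> encodes the pair of zeros m + 1/2 and -(m + 1/2). Symmetric
  sets of half-integers thus become sets of naturals, and the pairing makes the products converge
  without exponential factors.\<close>

definition hfac :: "nat \<Rightarrow> complex \<Rightarrow> complex" where
  "hfac m z = 1 - z\<^sup>2 / (of_nat m + 1/2)\<^sup>2"

definition hpart :: "nat set \<Rightarrow> nat \<Rightarrow> complex \<Rightarrow> complex" where
  "hpart X L z = (\<Prod>m<L. if m \<in> X then hfac m z else 1)"

definition hprod :: "nat set \<Rightarrow> complex \<Rightarrow> complex" where
  "hprod X z = lim (\<lambda>L. hpart X L z)"

lemma summable_half_integers: "summable (\<lambda>m. 1 / (real m + 1/2)\<^sup>2)"
proof (rule summable_comparison_test'[where N = 1])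
  show "summable (\<lambda>m. 1 / real m ^ 2)"
    using inverse_power_summable[of 2, where 'a = real] by (simp add: inverse_eq_divide power_divide)
  show "norm (1 / (real m + 1/2)\<^sup>2) \<le> 1 / real m ^ 2" if "m \<ge> 1" for m
    using that by (auto intro!: divide_left_mono power_mono)
qed

lemma uniform_limit_hpart: "uniform_limit (cball 0 R) (hpart X) (hprod X) sequentially"
proof -
  have "uniformly_convergent_on (cball 0 R) (\<lambda>L z. \<Prod>m<L. if m \<in> X then hfac m z else 1)"
  proof (rule uniformly_convergent_on_prod')
    show "continuous_on (cball 0 R) (\<lambda>z. if m \<in> X then hfac m z else 1)" for m
    proof -
      have "of_nat m + 1/2 \<noteq> (0::complex)" by (auto simp: complex_eq_iff)
      then show ?thesis unfolding hfac_def by (cases "m \<in> X") (auto intro!: continuous_intros)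
    qed
    show "uniformly_convergent_on (cball 0 R) (\<lambda>L z. \<Sum>m<L. norm ((if m \<in> X then hfac m z else 1) - 1))"
    proof (rule Weierstrass_m_test')
      show "summable (\<lambda>m. R\<^sup>2 * (1 / (real m + 1/2)\<^sup>2))"
        by (intro summable_mult summable_half_integers)
      show "norm (norm ((if m \<in> X then hfac m z else 1) - 1)) \<le> R\<^sup>2 * (1 / (real m + 1/2)\<^sup>2)"
        if "z \<in> cball 0 R" for m z
      proof -
        have "norm (complex_of_nat m + 1/2) = real m + 1/2"
          using norm_of_real[of "real m + 1/2", where 'a = complex] by simp
        moreover have "(norm z)\<^sup>2 \<le> R\<^sup>2" using that by (intro power_mono) auto
        ultimately show ?thesis
          by (auto simp: hfac_def norm_divide norm_power divide_right_mono)
      qed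
    qed
  qed auto
  then show ?thesis
    unfolding uniformly_convergent_uniform_limit_iff hpart_def hprod_def by simp
qed

lemma hpart_LIMSEQ: "(\<lambda>L. hpart X L z) \<longlonglongrightarrow> hprod X z"
  by (rule tendsto_uniform_limitI[OF uniform_limit_hpart[where R = "norm z"]]) simp

lemma holomorphic_hprod: "hprod X holomorphic_on S"
proof (rule holomorphic_on_subset)
  show "hprod X holomorphic_on UNIV"
  proof (rule holomorphic_uniform_sequence)
    show "hpart X n holomorphic_on UNIV" for n
    proof -
      have "(\<lambda>z. if m \<in> X then hfac m z else 1) holomorphic_on UNIV" for m
      proof -
        have "of_nat m + 1/2 \<noteq> (0::complex)" by (auto simp: complex_eq_iff)
        then show ?thesis unfolding hfac_def by (cases "m \<in> X") (auto intro!: holomorphic_intros)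
      qed
      then show ?thesis unfolding hpart_def[abs_def] by (intro holomorphic_intros)
    qed
    fix z :: complex
    have "uniform_limit (cball z 1) (hpart X) (hprod X) sequentially"
      by (rule uniform_limit_on_subset[OF uniform_limit_hpart[where R = "norm z + 1"]])
         (simp add: cball_subset_cball_iff)
    then show "\<exists>d>0. cball z d \<subseteq> UNIV \<and> uniform_limit (cball z d) (hpart X) (hprod X) sequentially"
      by (intro exI[of _ 1]) auto
  qed auto
qed auto

lemma hprod_mult: "X \<inter> Y = {} \<Longrightarrow> hprod X z * hprod Y z = hprod (X \<union> Y) z"
proof -
  assume d: "X \<inter> Y = {}"
  have "hpart X L z * hpart Y L z = hpart (X \<union> Y) L z" for L
    unfolding hpart_def prod.distrib[symmetric] using d by (intro prod.cong) auto
  then have "(\<lambda>L. hpart (X \<union> Y) L z) \<longlonglongrightarrow> hprod X z * hprod Y z"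
    using tendsto_mult[OF hpart_LIMSEQ[of X z] hpart_LIMSEQ[of Y z]] by simp
  then show ?thesis using LIMSEQ_unique hpart_LIMSEQ by blast
qed

lemma hprod_finite:
  assumes "finite X" shows "hprod X z = (\<Prod>m\<in>X. hfac m z)"
proof -
  obtain K where K: "X \<subseteq> {..<K}" using assms finite_nat_bounded by blast
  have "hpart X L z = (\<Prod>m\<in>X. hfac m z)" if "L \<ge> K" for L
    unfolding hpart_def using K that
    by (subst prod.inter_restrict[symmetric]) (auto intro!: prod.cong)
  then have "(\<lambda>L. hpart X L z) \<longlonglongrightarrow> (\<Prod>m\<in>X. hfac m z)"
    by (intro tendsto_eventually) (auto simp: eventually_sequentially)
  then show ?thesis using LIMSEQ_unique hpart_LIMSEQ by blast
qed

text \<open>Size estimates for infinite products are reduced here to comparisons of single factors;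
  allowing the factor 1 on either side also covers adding and deleting zeros.\<close>

lemma norm_hprod_mono:
  assumes "\<And>m. norm (if m \<in> X then hfac m z else 1) \<le> norm (if m \<in> Y then hfac m w else 1)"
  shows "norm (hprod X z) \<le> norm (hprod Y w)"
proof (rule tendsto_le[OF sequentially_bot])
  show "(\<lambda>L. norm (hpart X L z)) \<longlonglongrightarrow> norm (hprod X z)" by (intro tendsto_norm hpart_LIMSEQ)
  show "(\<lambda>L. norm (hpart Y L w)) \<longlonglongrightarrow> norm (hprod Y w)" by (intro tendsto_norm hpart_LIMSEQ)
  show "\<forall>\<^sub>F L in sequentially. norm (hpart X L z) \<le> norm (hpart Y L w)"
    unfolding hpart_def prod_norm[symmetric]
    by (intro always_eventually allI prod_mono) (use assms in auto)
qed

text \<open>Euler's product for the cosine, from the Gauss limits of \<open>rGamma\<close> at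
  \<open>1/2 + z\<close> and \<open>1/2 - z\<close>: the Pochhammer products combine to the partial
  products, the powers of \<open>n\<close> match those at \<open>1/2\<close>, and the reflection
  formula evaluates the limit.\<close>

lemma hprod_UNIV: "hprod UNIV z = cos (of_real pi * z)"
proof -
  have prt: "rGamma_series (1/2 + z) n * rGamma_series (1/2 - z) n =
      rGamma_series (1/2) n * rGamma_series (1/2) n * hpart UNIV (Suc n) z" for n
  proof -
    have "pochhammer (1/2 + z) (n + 1) * pochhammer (1/2 - z) (n + 1) =
      pochhammer (1/2) (n + 1) * pochhammer (1/2) (n + 1) * hpart UNIV (Suc n) z"
      unfolding pochhammer_prod hpart_def atLeast0LessThan prod.distrib[symmetric] Suc_eq_plus1
    proof (intro prod.cong refl)
      fix m
      define t :: complex where "t = of_nat m + 1/2"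
      have "t \<noteq> 0" by (auto simp: t_def complex_eq_iff)
      then have "(t + z) * (t - z) = t * t * (1 - z\<^sup>2 / t\<^sup>2)"
        by (simp add: power2_eq_square field_simps)
      moreover have "1/2 + z + of_nat m = t + z" "1/2 - z + of_nat m = t - z" "1/2 + of_nat m = t"
        by (simp_all add: t_def)
      ultimately show "(1/2 + z + of_nat m) * (1/2 - z + of_nat m) =
        (1/2 + of_nat m) * (1/2 + of_nat m) * (if m \<in> UNIV then hfac m z else 1)"
        by (simp only: hfac_def t_def[symmetric] UNIV_I if_True)
    qed
    moreover have "(fact n * exp ((1/2 + z) * of_real (ln (real n)))) * (fact n * exp ((1/2 - z) * of_real (ln (real n))))
      = (fact n * exp (1/2 * of_real (ln (real n)))) * (fact n * exp (1/2 * of_real (ln (real n))))"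
      by (simp add: algebra_simps flip: exp_add)
    ultimately show ?thesis
      unfolding rGamma_series_def times_divide_times_eq of_real_of_nat_eq by simp
  qed
  have r: "rGamma (1/2 + z) * rGamma (1/2 - z) = cos (of_real pi * z) / of_real pi" for z :: complex
  proof -
    have "rGamma (1/2 + z) * rGamma (1 - (1/2 + z)) = sin (of_real pi * (1/2 + z)) / of_real pi"
      by (rule rGamma_reflection_complex)
    moreover have "sin (of_real pi * (1/2 + z)) = cos (of_real pi * z)"
      by (simp add: distrib_left sin_add)
    ultimately show ?thesis by (simp add: algebra_simps)
  qed
  have r0: "rGamma (1/2) * rGamma (1/2) = (1 / of_real pi :: complex)" using r[of 0] by simp
  have "(\<lambda>n. rGamma_series (1/2) n * rGamma_series (1/2) n * hpart UNIV (Suc n) z) \<longlonglongrightarrow>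
      rGamma (1/2) * rGamma (1/2) * hprod UNIV z"
    by (intro tendsto_intros LIMSEQ_Suc hpart_LIMSEQ)
  moreover have "(\<lambda>n. rGamma_series (1/2) n * rGamma_series (1/2) n * hpart UNIV (Suc n) z) \<longlonglongrightarrow>
      rGamma (1/2 + z) * rGamma (1/2 - z)"
    unfolding prt[symmetric] by (intro tendsto_intros)
  ultimately have "rGamma (1/2) * rGamma (1/2) * hprod UNIV z = rGamma (1/2 + z) * rGamma (1/2 - z)"
    by (rule LIMSEQ_unique)
  then show ?thesis unfolding r r0 by (simp add: field_simps)
qed

text \<open>For \<open>q = 2 * p + 1\<close> the members are \<open>m = q * i + p\<close>, that is
  \<open>m + 1/2 = q * (i + 1/2)\<close>: all half-integers scaled by \<open>q\<close>, which stay
  half-integers because \<open>q\<close> is odd. The partial products up to \<open>q * N\<close>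
  coincide with those of the cosine at \<open>z / of_nat q\<close>.\<close>

lemma hprod_odd_multiples:
  assumes "odd q"
  shows "hprod {m. q dvd 2 * m + 1} z = cos (of_real pi * z / of_nat q)"
proof -
  let ?D = "{m. q dvd 2 * m + 1}"
  obtain p where p: "q = 2 * p + 1" using assms oddE by blast
  have q0: "q > 0" using p by simp
  have "hpart ?D (q * N) z = hpart UNIV N (z / of_nat q)" for N
  proof -
    have "hpart ?D (q * N) z = (\<Prod>m\<in>{..<q*N} \<inter> ?D. hfac m z)"
      unfolding hpart_def by (subst prod.inter_restrict) auto
    also have "{..<q*N} \<inter> ?D = (\<lambda>i. q * i + p) ` {..<N}"
    proof (intro equalityI subsetI)
      fix m assume "m \<in> {..<q*N} \<inter> ?D"
      then obtain c where c: "2 * m + 1 = q * c" and m: "m < q * N" by (auto elim: dvdE)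
      then have "odd (q * c)" by (metis even_plus_one_iff dvd_triv_left)
      then have "odd c" by simp
      then obtain i where i: "c = 2 * i + 1" using oddE by blast
      have "m = q * i + p" using c i p by (simp add: algebra_simps)
      moreover have "i < N"
      proof (rule ccontr)
        assume "\<not> i < N"
        then have "q * N \<le> q * i" by simp
        with m \<open>m = q * i + p\<close> show False by simp
      qed
      ultimately show "m \<in> (\<lambda>i. q * i + p) ` {..<N}" by auto
    next
      fix m assume "m \<in> (\<lambda>i. q * i + p) ` {..<N}"
      then obtain i where i: "m = q * i + p" "i < N" by auto
      have "2 * m + 1 = q * (2 * i + 1)" using i p by (simp add: algebra_simps)
      moreover have "q * Suc i \<le> q * N" using i by (intro mult_le_mono2) auto
      then have "m < q * N" using i p by simp
      ultimately show "m \<in> {..<q*N} \<inter> ?D" by simp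
    qed
    also have "(\<Prod>m\<in>(\<lambda>i. q * i + p) ` {..<N}. hfac m z) = (\<Prod>i<N. hfac (q * i + p) z)"
      using q0 by (subst prod.reindex) (auto simp: inj_on_def)
    also have "\<dots> = (\<Prod>i<N. hfac i (z / of_nat q))"
    proof (intro prod.cong refl)
      fix i
      have "of_nat (q * i + p) + 1/2 = (of_nat q * (of_nat i + 1/2) :: complex)"
        by (simp add: p field_simps)
      then show "hfac (q * i + p) z = hfac i (z / of_nat q)"
        by (simp add: hfac_def power_mult_distrib power_divide)
    qed
    finally show ?thesis by (simp add: hpart_def)
  qed
  then have "(\<lambda>N. hpart ?D (q * N) z) \<longlonglongrightarrow> hprod UNIV (z / of_nat q)"
    using hpart_LIMSEQ[of UNIV "z / of_nat q"] by simp
  moreover have "(\<lambda>N. hpart ?D (q * N) z) \<longlonglongrightarrow> hprod ?D z"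
    by (rule filterlim_compose[OF hpart_LIMSEQ]) (use q0 in \<open>simp add: mult_nat_left_at_top\<close>)
  ultimately have "hprod ?D z = hprod UNIV (z / of_nat q)" using LIMSEQ_unique by blast
  then show ?thesis by (simp add: hprod_UNIV)
qed

lemma hfac_of_real: "hfac m (of_real r) = of_real (1 - r\<^sup>2 / (real m + 1/2)\<^sup>2)"
  by (simp add: hfac_def)

lemma hfac_imag: "hfac m (\<i> * of_real r) = of_real (1 + r\<^sup>2 / (real m + 1/2)\<^sup>2)"
  by (simp add: hfac_def power_mult_distrib)

text \<open>On a circle about 0 the modulus of \<open>1 - w\<close> is least at the positive and
  greatest at the negative point. Every factor takes its extremes in the same directions, so on a
  circle a whole product is smallest on the real axis and largest on the imaginary axis.\<close>

lemma norm_hfac_bounds: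
  shows "norm (hfac m (of_real (norm z))) \<le> norm (hfac m z)"
    and "norm (hfac m z) \<le> norm (hfac m (\<i> * of_real (norm z)))"
proof -
  define w where "w = z\<^sup>2 / (of_real (real m + 1/2))\<^sup>2"
  have f: "hfac m z = 1 - w" by (simp add: hfac_def w_def)
  have nw: "norm w = (norm z)\<^sup>2 / (real m + 1/2)\<^sup>2" 
    unfolding w_def norm_divide norm_power norm_of_real by simp
  have "\<bar>1 - norm w\<bar> \<le> norm (1 - w)" using norm_triangle_ineq3[of 1 w] by simp
  then show "norm (hfac m (of_real (norm z))) \<le> norm (hfac m z)"
    unfolding hfac_of_real norm_of_real f nw .
  have "norm (1 - w) \<le> \<bar>1 + norm w\<bar>" using norm_triangle_ineq4[of 1 w] by simp
  then show "norm (hfac m z) \<le> norm (hfac m (\<i> * of_real (norm z)))"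
    unfolding hfac_imag norm_of_real f nw .
qed

lemma norm_hprod_bounds:
  shows "norm (hprod X (of_real (norm z))) \<le> norm (hprod X z)"
    and "norm (hprod X z) \<le> norm (hprod X (\<i> * of_real (norm z)))"
  by (rule norm_hprod_mono; simp add: norm_hfac_bounds)+

lemma norm_hfac_imag_ge_1: "norm (hfac m (\<i> * of_real r)) \<ge> 1"
  unfolding hfac_imag norm_of_real by (simp add: abs_of_nonneg)

lemma norm_hprod_imag_mono:
  "X \<subseteq> Y \<Longrightarrow> norm (hprod X (\<i> * of_real r)) \<le> norm (hprod Y (\<i> * of_real r))"
  by (rule norm_hprod_mono) (auto simp: norm_hfac_imag_ge_1)

lemma norm_hprod_imag_ge_1: "norm (hprod X (\<i> * of_real r)) \<ge> 1"
  using norm_hprod_imag_mono[of "{}" X r] by (simp add: hprod_finite)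

lemma sin_pi_mult_ge:
  assumes "\<bar>u\<bar> \<le> 1/2"
  shows "\<bar>sin (pi * u)\<bar> \<ge> 2 * \<bar>u\<bar>"
proof -
  have main: "sin (pi * u) \<ge> 2 * u" if u: "0 \<le> u" "u \<le> 1/2" for u
  proof -
    have "convex_on {0..pi} (\<lambda>x. - sin x)"
    proof (rule f''_ge0_imp_convex)
      show "((\<lambda>x. - sin x) has_real_derivative - cos x) (at x)" for x by (auto intro!: derivative_eq_intros)
      show "((\<lambda>x. - cos x) has_real_derivative sin x) (at x)" for x by (auto intro!: derivative_eq_intros)
    qed (auto intro: sin_ge_zero)
    then have "concave_on {0..pi} sin" by (simp add: concave_on_def)
    then have "sin ((1 - 2 * u) *\<^sub>R 0 + (2 * u) *\<^sub>R (pi/2)) \<ge> (1 - 2 * u) * sin 0 + (2 * u) * sin (pi/2)"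
      using u by (intro concave_onD) auto
    then show ?thesis by (simp add: mult.commute)
  qed
  have "\<bar>sin (pi * u)\<bar> = \<bar>sin (pi * \<bar>u\<bar>)\<bar>" by (simp add: abs_if)
  with main[of "\<bar>u\<bar>"] assms show ?thesis by simp
qed

lemma quarter_le_dist_half_int:
  "0 \<le> c \<Longrightarrow> c \<le> 1/4 \<Longrightarrow> \<bar>(real_of_int n + c) - (real_of_int i + 1/2)\<bar> \<ge> 1/4"
proof (cases "n \<le> i")
  case True
  then have "real_of_int n \<le> real_of_int i" by simp
  moreover assume "0 \<le> c" "c \<le> 1/4"
  ultimately show ?thesis by linarith
next
  case False
  then have "real_of_int i + 1 \<le> real_of_int n" by linarith
  moreover assume "0 \<le> c" "c \<le> 1/4"
  ultimately show ?thesis by linarith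
qed

text \<open>The zeros \<open>q * (i + 1/2)\<close> of this cosine are half-integers because
  \<open>q\<close> is odd. Hence \<open>r / q\<close> is at least \<open>1 / (4 * q)\<close> away
  from every half-integer, and Jordan's inequality doubles this distance.\<close>

lemma cos_lower_bound:
  fixes r :: real and q :: nat
  assumes q: "odd q" and r: "\<And>i::int. \<bar>r - (real_of_int i + 1/2)\<bar> \<ge> 1/4"
  shows "\<bar>cos (pi * r / q)\<bar> \<ge> 1 / (2 * real q)"
proof -
  define x where "x = r / q"
  define i where "i = \<lfloor>x\<rfloor>"
  define u where "u = x - real_of_int i - 1/2"
  have q0: "real q > 0" using q by (cases q) auto
  have u: "\<bar>u\<bar> \<le> 1/2" unfolding u_def i_def by linarith
  obtain p where p: "q = 2 * p + 1" using q oddE by blast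
  have "r - (real_of_int (int q * i + int p) + 1/2) = real q * u"
    using q0 by (simp add: u_def x_def p field_simps)
  then have "1/4 \<le> real q * \<bar>u\<bar>" using r[of "int q * i + int p"] q0 by (simp add: abs_mult)
  then have "1 / (2 * real q) \<le> 2 * \<bar>u\<bar>" using q0 by (simp add: field_simps)
  also have "\<dots> \<le> \<bar>sin (pi * u)\<bar>" by (rule sin_pi_mult_ge[OF u])
  finally have le: "1 / (2 * real q) \<le> \<bar>sin (pi * u)\<bar>" .
  have "sin (real_of_int i * pi) = 0" by (simp add: sin_times_pi_eq_0)
  moreover from this have "(cos (real_of_int i * pi))\<^sup>2 = 1" using sin_cos_squared_add[of "real_of_int i * pi"] by simp
  then have "\<bar>cos (real_of_int i * pi)\<bar> = 1" by (auto simp: power2_eq_1_iff)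
  moreover have "pi * r / q = (pi * u + pi / 2) + real_of_int i * pi"
    unfolding u_def by (simp add: x_def algebra_simps)
  ultimately have "\<bar>cos (pi * r / q)\<bar> = \<bar>cos (pi * u + pi / 2)\<bar>"
    by (simp only: cos_add[of _ "real_of_int i * pi"] abs_mult mult_zero_right diff_zero mult_1_right)
  with le show ?thesis by (simp add: cos_add)
qed

section \<open>Levels by powers of 3 and the truncated product\<close>

text \<open>As \<open>2 * m + 1\<close> is odd, membership means that \<open>m + 1/2\<close> is an
  odd multiple of \<open>3 ^ k / 2\<close>, a zero of \<open>cos (pi z / 3 ^ k)\<close>. The exact
  exponent of 3 in \<open>2 * m + 1\<close> is the level of \<open>m\<close>.\<close>

definition odd_mult :: "nat \<Rightarrow> nat set" where
  "odd_mult k = {m. 3 ^ k dvd 2 * m + 1}"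

lemma odd_mult_antimono: "j \<le> k \<Longrightarrow> odd_mult k \<subseteq> odd_mult j"
  unfolding odd_mult_def by (auto intro: dvd_trans[OF le_imp_power_dvd])

lemma hprod_odd_mult: "hprod (odd_mult k) z = cos (of_real pi * z / 3 ^ k)"
  using hprod_odd_multiples[of "3 ^ k" z] by (simp add: odd_mult_def)

lemma odd_mult_level: "\<exists>j. m \<in> odd_mult j - odd_mult (Suc j)"
proof -
  have "finite {j. m \<in> odd_mult j}"
  proof (rule finite_subset)
    show "{j. m \<in> odd_mult j} \<subseteq> {..2 * m + 1}"
    proof
      fix j assume "j \<in> {j. m \<in> odd_mult j}"
      then have "3 ^ j \<le> 2 * m + 1" unfolding odd_mult_def by (auto intro: dvd_imp_le)
      moreover have "j < 3 ^ j" by (rule power_gt_expt) simp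
      ultimately show "j \<in> {..2 * m + 1}" by simp
    qed
  qed simp
  moreover have "0 \<in> {j. m \<in> odd_mult j}" by (simp add: odd_mult_def)
  ultimately have M: "m \<in> odd_mult (Max {j. m \<in> odd_mult j})" and
    le: "\<And>j. m \<in> odd_mult j \<Longrightarrow> j \<le> Max {j. m \<in> odd_mult j}"
    using Max_in[of "{j. m \<in> odd_mult j}"] by auto
  have "m \<notin> odd_mult (Suc (Max {j. m \<in> odd_mult j}))" using le by (meson Suc_n_not_le_n)
  with M show ?thesis by blast
qed

lemma quadratic_le_exp:
  fixes \<delta> r :: real
  assumes \<delta>: "\<delta> > 0" and r: "r \<ge> 0"
  shows "1 + 4 * r\<^sup>2 \<le> (1 + 8 / \<delta>\<^sup>2) * exp (\<delta> * r)"
proof -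
  have e: "exp (\<delta> * r) \<ge> 1 + \<delta> * r + (\<delta> * r)\<^sup>2 / 2" using \<delta> r by (intro exp_lower_Taylor_quadratic) auto
  moreover have d0: "\<delta> * r \<ge> 0" using \<delta> r by simp
  ultimately have "(\<delta> * r)\<^sup>2 / 2 \<le> exp (\<delta> * r)" by linarith
  then have "8 / \<delta>\<^sup>2 * ((\<delta> * r)\<^sup>2 / 2) \<le> 8 / \<delta>\<^sup>2 * exp (\<delta> * r)"
    by (intro mult_left_mono) auto
  moreover have "8 / \<delta>\<^sup>2 * ((\<delta> * r)\<^sup>2 / 2) = 4 * r\<^sup>2" using \<delta> by (simp add: power_mult_distrib)
  moreover have "exp (\<delta> * r) \<ge> 1" using d0 by simp
  ultimately show ?thesis unfolding distrib_right mult_1 by linarith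
qed

locale truncated_levels =
  fixes N :: "nat \<Rightarrow> nat"
  assumes N_0: "N 0 = 0" and N_mono: "strict_mono N"
begin

text \<open>The product over the full level \<open>j\<close> is the quotient of
  \<open>cos (pi z / 3 ^ j)\<close> by \<open>cos (pi z / 3 ^ Suc j)\<close>; at a multiple of
  \<open>3 ^ Suc j\<close> both cosines are 1 or -1. The sequence \<open>N\<close> stays free, to be
  adapted to \<open>M\<close>.\<close>

definition R :: "nat \<Rightarrow> real" where "R j = 3 ^ Suc j * real (N j)"

definition B :: "nat set" where
  "B = {m. \<exists>j. m \<in> odd_mult j - odd_mult (Suc j) \<and> real m + 1/2 < R j}"

lemma R_0: "R 0 = 0" by (simp add: R_def N_0)

lemma R_mono: "j \<le> k \<Longrightarrow> R j \<le> R k"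
  unfolding R_def using strict_mono_less_eq[OF N_mono, of j k] by (intro mult_mono power_increasing) auto

lemma B_level: "m \<in> odd_mult j - odd_mult (Suc j) \<Longrightarrow> m \<in> B \<longleftrightarrow> real m + 1/2 < R j"
proof -
  assume m: "m \<in> odd_mult j - odd_mult (Suc j)"
  have "i = j" if "m \<in> odd_mult i - odd_mult (Suc i)" for i
    using that m odd_mult_antimono[of "Suc i" j] odd_mult_antimono[of "Suc j" i] by (cases i j rule: linorder_cases) auto
  then show ?thesis using m unfolding B_def by blast
qed

lemma zero_notin_B: "0 \<notin> B"
  using B_level[of 0 0] by (simp add: odd_mult_def R_0)

lemma norm_hfac_real_le_1:
  assumes "0 \<le> r" "r \<le> real m + 1/2" shows "norm (hfac m (of_real r)) \<le> 1"
proof -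
  have "0 \<le> r\<^sup>2 / (real m + 1/2)\<^sup>2" "r\<^sup>2 \<le> (real m + 1/2)\<^sup>2"
    using assms by (auto intro: power_mono)
  moreover have "(real m + 1/2)\<^sup>2 > 0" by (intro zero_less_power) simp
  ultimately have "r\<^sup>2 / (real m + 1/2)\<^sup>2 \<in> {0..1}" by simp
  then show ?thesis unfolding hfac_of_real norm_of_real by auto
qed

lemma norm_hfac_real_mono:
  assumes "real m + 1/2 \<le> s" "s \<le> r" shows "norm (hfac m (of_real s)) \<le> norm (hfac m (of_real r))"
proof -
  have p: "(real m + 1/2)\<^sup>2 > 0" by (intro zero_less_power) simp
  have "(real m + 1/2)\<^sup>2 \<le> s\<^sup>2" "s\<^sup>2 \<le> r\<^sup>2"
    using assms by (auto intro!: power_mono)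
  then have "1 \<le> s\<^sup>2 / (real m + 1/2)\<^sup>2" "s\<^sup>2 / (real m + 1/2)\<^sup>2 \<le> r\<^sup>2 / (real m + 1/2)\<^sup>2"
    using p by (auto intro: divide_right_mono)
  then show ?thesis unfolding hfac_of_real norm_of_real by simp
qed

text \<open>The truncation radius is chosen such that the full level product has absolute value 1 there.\<close>
lemma norm_level_ge_1:
  assumes r: "r \<ge> R j"
  shows "norm (hprod (B \<inter> (odd_mult j - odd_mult (Suc j))) (of_real r)) \<ge> 1"
proof -
  let ?A = "odd_mult j - odd_mult (Suc j)"
  have R0: "R j \<ge> 0" by (simp add: R_def)
  have "hprod ?A (of_real (R j)) * hprod (odd_mult (Suc j)) (of_real (R j)) = hprod (odd_mult j) (of_real (R j))"
    using odd_mult_antimono[of j "Suc j"] by (subst hprod_mult) (auto intro!: arg_cong2[where f = hprod])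
  moreover have "of_real pi * of_real (R j) / 3 ^ Suc j = (of_real (pi * real (N j)) :: complex)"
    by (simp add: R_def)
  moreover have "of_real pi * of_real (R j) / 3 ^ j = (of_real (pi * real (3 * N j)) :: complex)"
    by (simp add: R_def)
  ultimately have "hprod ?A (of_real (R j)) * of_real (cos (pi * real (N j))) = of_real (cos (pi * real (3 * N j)))"
    unfolding hprod_odd_mult by (simp only: cos_of_real)
  then have "hprod ?A (of_real (R j)) * (-1) ^ N j = (-1) ^ (3 * N j)"
    by (simp only: cos_npi2) simp
  then have "norm (hprod ?A (of_real (R j))) * norm ((-1::complex) ^ N j) = norm ((-1::complex) ^ (3 * N j))"
    by (simp only: norm_mult[symmetric])
  then have "1 = norm (hprod ?A (of_real (R j)))" by (simp add: norm_power)
  \<comment> \<open>Truncation discards only factors of modulus at most 1 at \<open>R j\<close>, and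
    the kept ones, with zeros below \<open>R j\<close>, grow when the point moves out to
    \<open>r\<close>.\<close>
  also have "\<dots> \<le> norm (hprod (B \<inter> ?A) (of_real r))"
  proof (rule norm_hprod_mono)
    fix m
    show "norm (if m \<in> ?A then hfac m (of_real (R j)) else 1) \<le> norm (if m \<in> B \<inter> ?A then hfac m (of_real r) else 1)"
    proof (cases "m \<in> ?A")
      case True
      then show ?thesis
        using norm_hfac_real_mono[of m "R j" r] norm_hfac_real_le_1[of "R j" m] r R0 B_level[OF True] by auto
    qed auto
  qed
  finally show ?thesis .
qed

lemma norm_initial_levels_ge_1:
  assumes "\<And>j. j < k \<Longrightarrow> r \<ge> R j"
  shows "norm (hprod (B - odd_mult k) (of_real r)) \<ge> 1"
  using assms
proof (induction k)
  case 0
  have e: "B - odd_mult 0 = {}" by (auto simp: odd_mult_def)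
  show ?case unfolding e by (simp add: hprod_finite)
next
  case (Suc k)
  have "hprod (B - odd_mult k) (of_real r) * hprod (B \<inter> (odd_mult k - odd_mult (Suc k))) (of_real r)
     = hprod (B - odd_mult (Suc k)) (of_real r)"
    using odd_mult_antimono[of k "Suc k"] by (subst hprod_mult) (auto intro!: arg_cong2[where f = hprod])
  moreover have "1 * 1 \<le> norm (hprod (B - odd_mult k) (of_real r)) * norm (hprod (B \<inter> (odd_mult k - odd_mult (Suc k))) (of_real r))"
    using Suc.IH Suc.prems norm_level_ge_1[of k r] by (intro mult_mono) auto
  ultimately show ?case by (simp add: norm_mult[symmetric])
qed

text \<open>Levels up to \<open>k\<close> contribute at least 1 by the choice of the radii. From
  level \<open>Suc k\<close> on, \<open>B\<close> omits only zeros at or beyond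
  \<open>R (Suc k) \<ge> r\<close>, whose factors have modulus at most 1 at \<open>r\<close>, so the
  full cosine is a lower bound for the rest.\<close>

lemma norm_hprod_B_ge_cos:
  assumes "R k \<le> r" "r \<le> R (Suc k)"
  shows "norm (hprod B (of_real r)) \<ge> \<bar>cos (pi * r / 3 ^ Suc k)\<bar>"
proof -
  have r0: "r \<ge> 0" using assms R_mono[of 0 k] R_0 by simp
  have "\<bar>cos (pi * r / 3 ^ Suc k)\<bar> = norm (hprod (odd_mult (Suc k)) (of_real r))"
  proof -
    have "of_real pi * of_real r / 3 ^ Suc k = (of_real (pi * r / 3 ^ Suc k) :: complex)" by simp
    then show ?thesis unfolding hprod_odd_mult by (simp only: cos_of_real norm_of_real)
  qed
  also have "\<dots> \<le> norm (hprod (B \<inter> odd_mult (Suc k)) (of_real r))"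
  proof (rule norm_hprod_mono)
    fix m
    obtain j where j: "m \<in> odd_mult j - odd_mult (Suc j)" using odd_mult_level by blast
    show "norm (if m \<in> odd_mult (Suc k) then hfac m (of_real r) else 1) \<le> norm (if m \<in> B \<inter> odd_mult (Suc k) then hfac m (of_real r) else 1)"
    proof (cases "m \<in> odd_mult (Suc k) \<and> m \<notin> B")
      case True
      have "Suc k \<le> j"
      proof (rule ccontr)
        assume "\<not> Suc k \<le> j"
        then show False using odd_mult_antimono[of "Suc j" "Suc k"] j True by auto
      qed
      then have "r \<le> R j" using assms R_mono[of "Suc k" j] by linarith
      then show ?thesis using True B_level[OF j] norm_hfac_real_le_1[of r m] r0 by auto
    qed auto
  qed
  also have "\<dots> \<le> norm (hprod (B - odd_mult (Suc k)) (of_real r)) * norm (hprod (B \<inter> odd_mult (Suc k)) (of_real r))"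
  proof -
    have "norm (hprod (B - odd_mult (Suc k)) (of_real r)) \<ge> 1"
      by (rule norm_initial_levels_ge_1) (use assms order_trans[OF R_mono] in \<open>auto simp: less_Suc_eq_le\<close>)
    from mult_right_mono[OF this norm_ge_zero] show ?thesis by simp
  qed
  also have "\<dots> = norm (hprod B (of_real r))"
    unfolding norm_mult[symmetric] by (subst hprod_mult) (auto intro!: arg_cong2[where f = hprod] arg_cong[where f = norm])
  finally show ?thesis .
qed

lemma N_ge: "N j \<ge> j" by (rule strict_mono_imp_increasing[OF N_mono])

text \<open>The third bound turns the loss \<open>3 ^ Suc k\<close> in
  \<open>cos_lower_bound\<close> into one linear in \<open>r\<close>. It holds because
  \<open>N k \<ge> 1\<close> for positive \<open>k\<close>; the summand 3 covers
  \<open>k = 0\<close>.\<close>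

lemma R_interval:
  assumes "r \<ge> 0"
  obtains k where "R k \<le> r" "r \<le> R (Suc k)" "3 ^ Suc k \<le> 3 + r"
proof -
  have "\<exists>n. r < R n"
  proof -
    obtain n :: nat where n: "r < real n" using reals_Archimedean2 by blast
    have "1 * real n \<le> R n" unfolding R_def using N_ge[of n] one_le_power[of "3::real" "Suc n"] by (intro mult_mono) auto
    with n show ?thesis by (intro exI[of _ n]) simp
  qed
  define n where "n = (LEAST n. r < R n)"
  have n: "r < R n" unfolding n_def using \<open>\<exists>n. r < R n\<close> by (rule LeastI_ex)
  have "n \<noteq> 0" using n R_0 assms by (cases n) auto
  then obtain k where k: "n = Suc k" by (cases n) auto
  have Rk: "R k \<le> r"
    using not_less_Least[of k "\<lambda>n. r < R n"] k[unfolded n_def] by auto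
  have "3 ^ Suc k \<le> 3 + r"
  proof (cases k)
    case 0 then show ?thesis using assms by simp
  next
    case (Suc k')
    have "3 ^ Suc k * 1 \<le> R k" unfolding R_def using N_ge[of k] Suc by (intro mult_left_mono) auto
    then show ?thesis using Rk by simp
  qed
  then show ?thesis using that Rk n k by auto
qed

lemma norm_hprod_B_real_ge:
  assumes "r \<ge> 0" "\<And>i::int. \<bar>r - (real_of_int i + 1/2)\<bar> \<ge> 1/4"
  shows "norm (hprod B (of_real r)) \<ge> 1 / (2 * (3 + r))"
proof -
  obtain k where k: "R k \<le> r" "r \<le> R (Suc k)" "3 ^ Suc k \<le> 3 + r" using R_interval[OF assms(1)] .
  have "1 / (2 * (3 + r)) \<le> 1 / (2 * real (3 ^ Suc k))"
    using k(3) assms(1) by (intro divide_left_mono mult_left_mono) auto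
  also have "\<dots> \<le> \<bar>cos (pi * r / real (3 ^ Suc k))\<bar>" by (intro cos_lower_bound assms(2)) simp
  also have "\<dots> \<le> norm (hprod B (of_real r))" using norm_hprod_B_ge_cos[OF k(1,2)] by simp
  finally show ?thesis .
qed

lemma norm_hprod_B_ge_on_circle:
  assumes "norm z = real n + 1/4"
  shows "norm (hprod B z) \<ge> 1 / (2 * (3 + norm z))"
proof -
  have "norm (hprod B (of_real (norm z))) \<ge> 1 / (2 * (3 + norm z))"
  proof (rule norm_hprod_B_real_ge)
    fix i :: int
    show "1/4 \<le> \<bar>norm z - (real_of_int i + 1/2)\<bar>" using quarter_le_dist_half_int[of "1/4" "int n" i] unfolding assms by simp
  qed simp
  then show ?thesis using norm_hprod_bounds(1)[of B z] by linarith
qed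

lemma norm_hprod_B_ge_at_int:
  "norm (hprod B (of_int n)) \<ge> 1 / (2 * (3 + \<bar>real_of_int n\<bar>))"
proof -
  have "norm (hprod B (of_real \<bar>real_of_int n\<bar>)) \<ge> 1 / (2 * (3 + \<bar>real_of_int n\<bar>))"
  proof (rule norm_hprod_B_real_ge)
    fix i :: int
    show "1/4 \<le> \<bar>\<bar>real_of_int n\<bar> - (real_of_int i + 1/2)\<bar>" using quarter_le_dist_half_int[of 0 "\<bar>n\<bar>" i] by simp
  qed simp
  then show ?thesis using norm_hprod_bounds(1)[of B "of_int n"] by simp
qed

text \<open>Levels below \<open>k\<close> have finitely many zeros, all below \<open>R k\<close>,
  hence polynomial growth. The others are dominated on the imaginary axis by
  \<open>cos (pi z / 3 ^ k)\<close>, whose type \<open>pi / 3 ^ k\<close> is as small as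
  desired.\<close>

lemma hprod_B_zero_type:
  assumes "\<epsilon> > 0"
  shows "\<exists>C. \<forall>z. norm (hprod B z) \<le> C * exp (\<epsilon> * norm z)"
proof -
  obtain k where k: "2 * pi / \<epsilon> < 3 ^ k" using real_arch_pow[of 3 "2 * pi / \<epsilon>"] by auto
  define F where "F = B - odd_mult k"
  have "F \<subseteq> {m. real m < R k}"
  proof
    fix m assume m: "m \<in> F"
    then obtain j where j: "m \<in> odd_mult j - odd_mult (Suc j)" "real m + 1/2 < R j" by (auto simp: F_def B_def)
    have "j < k" using m j odd_mult_antimono[of k j] by (force simp: F_def)
    then show "m \<in> {m. real m < R k}" using R_mono[of j k] j(2) by simp
  qed
  also have "\<dots> \<subseteq> {..nat \<lceil>R k\<rceil>}" by (auto simp: le_nat_iff) linarith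
  finally have F: "finite F" by (rule finite_subset) simp
  define c where "c = card F"
  \<comment> \<open>Half of \<epsilon> is shared among the \<open>c\<close> factors of the finite
    part; the added 1 covers \<open>c = 0\<close>.\<close>
  define \<delta> where "\<delta> = \<epsilon> / (2 * (real c + 1))"
  have \<delta>: "\<delta> > 0" "real c * \<delta> \<le> \<epsilon> / 2" using assms by (auto simp: \<delta>_def field_simps)
  have "norm (hprod B z) \<le> (1 + 8 / \<delta>\<^sup>2) ^ c * exp (\<epsilon> * norm z)" for z
  proof -
    define r where "r = norm z"
    have r0: "r \<ge> 0" by (simp add: r_def)
    have 1: "norm (hprod F (\<i> * of_real r)) \<le> (1 + 8 / \<delta>\<^sup>2) ^ c * exp (\<epsilon> / 2 * r)"
    proof -
      have "norm (hprod F (\<i> * of_real r)) = (\<Prod>m\<in>F. norm (hfac m (\<i> * of_real r)))"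
        using F by (simp add: hprod_finite prod_norm)
      also have "\<dots> \<le> (\<Prod>m\<in>F. (1 + 8 / \<delta>\<^sup>2) * exp (\<delta> * r))"
      proof (intro prod_mono conjI)
        fix m
        have "(1/2)\<^sup>2 \<le> (real m + 1/2)\<^sup>2" by (intro power_mono) auto
        then have "r\<^sup>2 / (real m + 1/2)\<^sup>2 \<le> r\<^sup>2 / (1/2)\<^sup>2" by (intro divide_left_mono) auto
        then have "norm (hfac m (\<i> * of_real r)) \<le> 1 + 4 * r\<^sup>2"
          unfolding hfac_imag norm_of_real by (simp add: power_divide)
        with quadratic_le_exp[OF \<delta>(1) r0] show "norm (hfac m (\<i> * of_real r)) \<le> (1 + 8 / \<delta>\<^sup>2) * exp (\<delta> * r)" by linarith
      qed auto
      also have "\<dots> = (1 + 8 / \<delta>\<^sup>2) ^ c * exp (real c * \<delta> * r)"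
        by (simp add: c_def power_mult_distrib mult.assoc flip: exp_of_nat_mult)
      also have "\<dots> \<le> (1 + 8 / \<delta>\<^sup>2) ^ c * exp (\<epsilon> / 2 * r)"
        using mult_right_mono[OF \<delta>(2) r0] by (intro mult_left_mono) auto
      finally show ?thesis .
    qed
    have 2: "norm (hprod (B \<inter> odd_mult k) (\<i> * of_real r)) \<le> exp (\<epsilon> / 2 * r)"
    proof -
      have "norm (hprod (B \<inter> odd_mult k) (\<i> * of_real r)) \<le> norm (hprod (odd_mult k) (\<i> * of_real r))"
        by (rule norm_hprod_imag_mono) auto
      also have "\<dots> \<le> exp (norm (of_real pi * (\<i> * of_real r) / 3 ^ k))"
        unfolding hprod_odd_mult by (rule norm_cos_le)
      also have "\<dots> \<le> exp (\<epsilon> / 2 * r)"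
      proof -
        have "pi / 3 ^ k \<le> \<epsilon> / 2" using k assms by (simp add: field_simps)
        then have "pi / 3 ^ k * r \<le> \<epsilon> / 2 * r" using r0 by (rule mult_right_mono)
        moreover have "norm (of_real pi * (\<i> * of_real r) / 3 ^ k) = pi / 3 ^ k * r"
          using r0 by (simp add: norm_mult norm_divide norm_power)
        ultimately show ?thesis by simp
      qed
      finally show ?thesis .
    qed
    have "norm (hprod B z) \<le> norm (hprod B (\<i> * of_real r))" unfolding r_def by (rule norm_hprod_bounds)
    also have "hprod B (\<i> * of_real r) = hprod F (\<i> * of_real r) * hprod (B \<inter> odd_mult k) (\<i> * of_real r)"
      unfolding F_def by (subst hprod_mult) (auto intro!: arg_cong2[where f = hprod])
    also have "norm \<dots> \<le> ((1 + 8 / \<delta>\<^sup>2) ^ c * exp (\<epsilon> / 2 * r)) * exp (\<epsilon> / 2 * r)"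
      unfolding norm_mult using 1 2 by (intro mult_mono) auto
    also have "\<dots> = (1 + 8 / \<delta>\<^sup>2) ^ c * exp (\<epsilon> * r)"
      by (simp add: mult.assoc flip: exp_add)
    finally show ?thesis by (simp add: r_def)
  qed
  then show ?thesis by blast
qed

text \<open>On the imaginary axis every factor is at least 1, and a factor whose zero has modulus at
  most \<open>y\<close> is at least 2. It therefore suffices to count about
  \<open>y / 3 ^ Suc k\<close> zeros, which level \<open>k\<close> supplies since it is complete
  below \<open>R k\<close>.\<close>

lemma ln_norm_hprod_B_imag_ge:
  assumes y: "y > 0" "y \<le> R k"
  shows "ln (norm (hprod B (\<i> * of_real y))) \<ge> ln 2 * (y / 3 ^ Suc k - 1)"
proof -
  define n where "n = nat \<lfloor>y / 3 ^ Suc k + 1/2\<rfloor>"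
  \<comment> \<open>These zeros are the multiples of \<open>3 ^ k / 2\<close> by
    \<open>6 * i + 1\<close>, a number prime to 3, so the level is exactly \<open>k\<close>; their
    spacing is \<open>3 ^ Suc k\<close>.\<close>
  define idx where "idx = (\<lambda>i. 3 ^ k * 3 * i + (3 ^ k - 1) div 2 :: nat)"
  have idx: "2 * idx i + 1 = 3 ^ k * (6 * i + 1)" for i
  proof -
    have "odd ((3::nat) ^ k)" by simp
    then obtain p :: nat where p: "3 ^ k = 2 * p + 1" by (rule oddE)
    show ?thesis unfolding idx_def p by (simp add: algebra_simps)
  qed
  have idx_r: "real (idx i) + 1/2 = 3 ^ k * (3 * real i + 1/2)" for i
    using arg_cong[OF idx[of i], of real] by (simp add: algebra_simps)
  have inj: "inj idx" by (auto simp: inj_def idx_def)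
  define X where "X = idx ` {..<n}"
  have Xy: "real m + 1/2 \<le> y" and XB: "m \<in> B" if mX: "m \<in> X" for m
  proof -
    obtain i where i: "m = idx i" "i < n" using mX by (auto simp: X_def)
    \<comment> \<open>The rounding in \<open>n\<close> leaves a gap of \<open>3 ^ k\<close> below
      \<open>y\<close>, which yields the strict inequality with \<open>R k\<close> demanded by
      \<open>B\<close>.\<close>
    have "real i + 1 \<le> y / 3 ^ Suc k + 1/2" using i(2) unfolding n_def by linarith
    then have "3 * real i + 1/2 \<le> y / 3 ^ k - 1" by simp
    then have "3 ^ k * (3 * real i + 1/2) \<le> 3 ^ k * (y / 3 ^ k - 1)" by (intro mult_left_mono) auto
    then have lt: "real m + 1/2 \<le> y - 3 ^ k" unfolding i(1) idx_r by (simp add: algebra_simps)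
    moreover have "(0::real) < 3 ^ k" by simp
    ultimately show "real m + 1/2 \<le> y" by linarith
    have "m \<in> odd_mult k - odd_mult (Suc k)"
    proof -
      have "\<not> 3 dvd 6 * i + 1" by presburger
      then have "\<not> 3 ^ k * 3 dvd 3 ^ k * (6 * i + 1)" by (subst dvd_times_left_cancel_iff) auto
      then show ?thesis unfolding odd_mult_def i(1) Diff_iff mem_Collect_eq idx power_Suc2 by auto
    qed
    moreover have "real m + 1/2 < R k" using lt \<open>(0::real) < 3 ^ k\<close> y by linarith
    ultimately show "m \<in> B" by (simp add: B_level)
  qed
  have Xfin: "finite X" and Xcard: "card X = n" using inj by (auto simp: X_def card_image inj_on_subset)
  have "(2::real) ^ n = (\<Prod>m\<in>X. 2)" by (simp add: Xcard)
  also have "\<dots> \<le> (\<Prod>m\<in>X. norm (hfac m (\<i> * of_real y)))"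
  proof (intro prod_mono conjI)
    fix m assume "m \<in> X"
    have "(real m + 1/2)\<^sup>2 \<le> y\<^sup>2" using Xy[OF \<open>m \<in> X\<close>] by (intro power_mono) auto
    moreover have "(real m + 1/2)\<^sup>2 > 0" by (intro zero_less_power) simp
    ultimately have "1 \<le> y\<^sup>2 / (real m + 1/2)\<^sup>2" by simp
    then show "2 \<le> norm (hfac m (\<i> * of_real y))" unfolding hfac_imag norm_of_real by simp
  qed simp
  also have "\<dots> = norm (hprod X (\<i> * of_real y))" by (simp add: hprod_finite Xfin prod_norm)
  also have "\<dots> \<le> norm (hprod B (\<i> * of_real y))" using XB by (intro norm_hprod_imag_mono) auto
  finally have "2 ^ n \<le> norm (hprod B (\<i> * of_real y))" .
  moreover have "(0::real) < 2 ^ n" by simp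
  ultimately have "ln (2 ^ n) \<le> ln (norm (hprod B (\<i> * of_real y)))"
    by (meson ln_mono less_le_trans)
  moreover have "ln (2 ^ n :: real) = ln 2 * real n" by (simp add: ln_realpow)
  moreover have "y / 3 ^ Suc k - 1 \<le> real n" unfolding n_def by linarith
  then have "ln 2 * (y / 3 ^ Suc k - 1) \<le> ln 2 * real n" by (intro mult_left_mono) auto
  ultimately show ?thesis by linarith
qed

end

section \<open>Cauchy sums and interpolation at the integers\<close>

text \<open>The zeros of \<open>g\<close> are simple, so the removable values are quotients of
  derivatives; near such a zero \<open>q\<close> is the quotient of the two difference quotients,
  which are themselves entire.\<close>

lemma entire_quotient:
  fixes f g :: "complex \<Rightarrow> complex"
  assumes f: "f holomorphic_on UNIV" and g: "g holomorphic_on UNIV"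
    and zeros: "\<And>z. g z = 0 \<Longrightarrow> f z = 0 \<and> deriv g z \<noteq> 0"
  obtains q where "q holomorphic_on UNIV" "\<And>z. f z = g z * q z"
proof
  define q where "q = (\<lambda>z. if g z = 0 then deriv f z / deriv g z else f z / g z)"
  show "f z = g z * q z" for z using zeros[of z] by (simp add: q_def)
  have "\<exists>U. open U \<and> z0 \<in> U \<and> q holomorphic_on U" for z0
  proof (cases "g z0 = 0")
    case False
    have "open {z. g z \<noteq> 0}"
      using continuous_open_preimage[OF holomorphic_on_imp_continuous_on[OF g] open_UNIV, of "- {0}"]
      by (auto simp: vimage_def)
    moreover have "q holomorphic_on {z. g z \<noteq> 0}"
    proof (rule holomorphic_transform)
      show "(\<lambda>z. f z / g z) holomorphic_on {z. g z \<noteq> 0}"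
        by (intro holomorphic_intros holomorphic_on_subset[OF f] holomorphic_on_subset[OF g]) auto
    qed (auto simp: q_def)
    ultimately show ?thesis using False by blast
  next
    case True
    define f1 where "f1 = (\<lambda>z. if z = z0 then deriv f z0 else (f z - f z0) / (z - z0))"
    define g1 where "g1 = (\<lambda>z. if z = z0 then deriv g z0 else (g z - g z0) / (z - z0))"
    have f1: "f1 holomorphic_on UNIV" unfolding f1_def by (rule pole_lemma_open[OF f]) simp
    have g1: "g1 holomorphic_on UNIV" unfolding g1_def by (rule pole_lemma_open[OF g]) simp
    have "open {z. g1 z \<noteq> 0}"
      using continuous_open_preimage[OF holomorphic_on_imp_continuous_on[OF g1] open_UNIV, of "- {0}"]
      by (auto simp: vimage_def)
    moreover have "q holomorphic_on {z. g1 z \<noteq> 0}"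
    proof (rule holomorphic_transform)
      show "(\<lambda>z. f1 z / g1 z) holomorphic_on {z. g1 z \<noteq> 0}"
        by (intro holomorphic_intros holomorphic_on_subset[OF f1] holomorphic_on_subset[OF g1]) auto
      show "f1 z / g1 z = q z" if "z \<in> {z. g1 z \<noteq> 0}" for z
        using that True zeros[OF True] by (auto simp: q_def f1_def g1_def)
    qed
    moreover have "g1 z0 \<noteq> 0" using zeros[OF True] by (simp add: g1_def)
    ultimately show ?thesis by blast
  qed
  then have "q analytic_on UNIV" unfolding analytic_on_def
    by (meson UNIV_I holomorphic_on_subset open_contains_ball)
  then show "q holomorphic_on UNIV" by (rule analytic_imp_holomorphic)
qed

lemma entire_bounded_on_cball:
  fixes f :: "complex \<Rightarrow> complex"
  assumes "f holomorphic_on UNIV"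
  obtains K where "\<And>z. norm z \<le> R \<Longrightarrow> norm (f z) \<le> K"
proof -
  have "continuous_on (cball 0 R) f"
    using assms holomorphic_on_imp_continuous_on holomorphic_on_subset by blast
  then have "bounded (f ` cball 0 R)" by (intro compact_imp_bounded compact_continuous_image) auto
  then obtain K where "\<forall>x\<in>f ` cball 0 R. norm x \<le> K" by (auto simp: bounded_iff)
  then have "norm (f z) \<le> K" if "norm z \<le> R" for z using that by simp
  then show ?thesis by (rule that)
qed

section \<open>Trigonometric kernels at the integers\<close>

text \<open>This is (-1)^n, kept as a cosine because it enters through the addition formula and the
  derivative of the sine.\<close>

definition cospi :: "int \<Rightarrow> complex" where "cospi n = cos (of_real pi * of_int n)"

lemma sinpi_eq_0_iff: "sinpi z = 0 \<longleftrightarrow> z \<in> \<int>"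
proof -
  have "of_real pi * z = of_real (of_int n * pi) \<longleftrightarrow> z = of_int n" for n :: int
    using pi_neq_zero by (simp add: mult.commute)
  then show ?thesis unfolding sinpi_def sin_eq_0 by (auto elim!: Ints_cases)
qed

lemma sinpi_of_int [simp]: "sinpi (of_int n) = 0"
  by (simp add: sinpi_eq_0_iff)

lemma cospi_square [simp]: "cospi n * cospi n = 1"
  using sin_cos_squared_add[of "of_real pi * of_int n :: complex"] sinpi_of_int[of n]
  by (simp add: cospi_def sinpi_def power2_eq_square)

lemma norm_cospi [simp]: "norm (cospi n) = 1"
proof -
  have "norm (cospi n) * norm (cospi n) = 1" by (simp flip: norm_mult)
  then show ?thesis by (metis abs_norm_cancel abs_square_eq_1 power2_eq_square)
qed

lemma cospi_nonzero [simp]: "cospi n \<noteq> 0" using norm_cospi[of n] by (metis norm_zero zero_neq_one)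

lemma holomorphic_sinpi: "sinpi holomorphic_on A"
  unfolding sinpi_def[abs_def] by (intro holomorphic_intros)

lemma deriv_sinpi: "deriv sinpi z = of_real pi * cos (of_real pi * z)"
  unfolding sinpi_def[abs_def] by (rule DERIV_imp_deriv) (auto intro!: derivative_eq_intros)

text \<open>With the singularity at \<open>n\<close> filled in, \<open>sinpi\<close> times a Cauchy
  sum becomes a series of entire functions, with no exception at the integers.\<close>

definition sker :: "int \<Rightarrow> complex \<Rightarrow> complex" where
  "sker n z = (if z = of_int n then of_real pi * cospi n else sinpi z / (z - of_int n))"

lemma holomorphic_sker: "sker n holomorphic_on UNIV"
proof -
  have "(\<lambda>z. if z = of_int n then deriv sinpi (of_int n) else (sinpi z - sinpi (of_int n)) / (z - of_int n))
      holomorphic_on UNIV"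
    by (rule pole_lemma_open[OF holomorphic_sinpi]) simp
  then show ?thesis unfolding sker_def[abs_def] deriv_sinpi cospi_def sinpi_of_int diff_zero .
qed

lemma sker_of_int: "sker n (of_int m) = (if m = n then of_real pi * cospi n else 0)"
  by (simp add: sker_def)

lemma sinpi_diff_of_int: "sinpi z = cospi n * sinpi (z - of_int n)"
proof -
  have "of_real pi * z = of_real pi * (z - of_int n) + of_real pi * of_int n" by (simp add: algebra_simps)
  then have "sinpi z = sinpi (z - of_int n) * cospi n + cos (of_real pi * (z - of_int n)) * sinpi (of_int n)"
    unfolding sinpi_def cospi_def by (metis sin_add)
  then show ?thesis by simp
qed

text \<open>Within distance 1 of \<open>n\<close> the kernel is, up to sign, a translate of
  \<open>sker 0\<close>; farther away, a sine that is bounded on the disc is divided by the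
  distance.\<close>

lemma sker_bound:
  obtains K where "K \<ge> 0" "\<And>n z. norm z \<le> R \<Longrightarrow> norm (sker n z) \<le> K / (1 + \<bar>real_of_int n\<bar>)"
proof -
  obtain K1 where K1: "\<And>w. norm w \<le> 1 \<Longrightarrow> norm (sker 0 w) \<le> K1"
    using entire_bounded_on_cball[OF holomorphic_sker[of 0], of 1] by blast
  obtain K2 where K2: "\<And>w. norm w \<le> R \<Longrightarrow> norm (sinpi w) \<le> K2"
    using entire_bounded_on_cball[OF holomorphic_sinpi, of R] by blast
  define L where "L = \<bar>K1\<bar> + \<bar>K2\<bar>"
  have "norm (sker n z) \<le> L * (2 + \<bar>R\<bar>) / (1 + \<bar>real_of_int n\<bar>)" if z: "norm z \<le> R" for n and z :: complex
  proof -
    define d where "d = max 1 (norm (z - of_int n))"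
    have n: "norm (of_int n :: complex) = \<bar>real_of_int n\<bar>" by simp
    have "norm (of_int n :: complex) \<le> norm z + norm (z - of_int n)"
      using norm_triangle_ineq2[of "of_int n :: complex" z] by (simp add: norm_minus_commute)
    then have d1: "1 + \<bar>real_of_int n\<bar> \<le> 1 + \<bar>R\<bar> + d" using z unfolding n d_def by linarith
    have "1 \<le> d" by (simp add: d_def)
    then have "(1 + \<bar>R\<bar>) * 1 \<le> (1 + \<bar>R\<bar>) * d" by (intro mult_left_mono) auto
    with d1 have d2: "1 + \<bar>real_of_int n\<bar> \<le> (2 + \<bar>R\<bar>) * d" by (simp add: algebra_simps)
    have "norm (sker n z) \<le> L / d"
    proof (cases "norm (z - of_int n) \<le> 1")
      case True
      have "sker n z = cospi n * sker 0 (z - of_int n)"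
        using sinpi_diff_of_int[of z n] by (auto simp: sker_def cospi_def)
      then have "norm (sker n z) \<le> K1" using K1[OF True] by (simp add: norm_mult)
      moreover have "d = 1" using True by (simp add: d_def)
      ultimately show ?thesis by (simp add: L_def)
    next
      case False
      then have "d = norm (z - of_int n)" "z \<noteq> of_int n" by (auto simp: d_def)
      then have "norm (sker n z) = norm (sinpi z) / d" by (simp add: sker_def norm_divide)
      also have "\<dots> \<le> L / d" using K2[OF z] \<open>1 \<le> d\<close> by (intro divide_right_mono) (auto simp: L_def)
      finally show ?thesis .
    qed
    also have "L / d \<le> L * (2 + \<bar>R\<bar>) / (1 + \<bar>real_of_int n\<bar>)"
    proof -
      have "L * (1 + \<bar>real_of_int n\<bar>) \<le> L * ((2 + \<bar>R\<bar>) * d)" using d2 by (intro mult_left_mono) (auto simp: L_def)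
      then show ?thesis using \<open>1 \<le> d\<close> by (simp add: field_simps)
    qed
    finally show ?thesis .
  qed
  then show ?thesis by (intro that[of "L * (2 + \<bar>R\<bar>)"]) (auto simp: L_def)
qed

lemma inverse_squares_summable: "(\<lambda>n::int. 1 / (1 + \<bar>real_of_int n\<bar>)\<^sup>2) summable_on UNIV"
proof -
  have "summable (\<lambda>n. 1 / (real (Suc n))\<^sup>2)"
    using inverse_power_summable[of 2, where 'a = real] summable_Suc_iff[of "\<lambda>n. inverse (real n ^ 2)"]
    by (simp add: inverse_eq_divide)
  then have nat: "(\<lambda>n. 1 / (1 + real n)\<^sup>2) summable_on UNIV"
    by (intro summable_nonneg_imp_summable_on) auto
  have "(\<lambda>n::int. 1 / (1 + \<bar>real_of_int n\<bar>)\<^sup>2) summable_on range int"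
    using nat by (subst summable_on_reindex) (auto simp: o_def)
  moreover have "(\<lambda>n::int. 1 / (1 + \<bar>real_of_int n\<bar>)\<^sup>2) summable_on range (\<lambda>n. - 1 - int n)"
  proof (subst summable_on_reindex)
    have "(\<lambda>n. 1 / (2 + real n)\<^sup>2) summable_on UNIV"
      by (rule summable_on_comparison_test[OF nat]) (auto intro!: divide_left_mono power_mono)
    then show "((\<lambda>n::int. 1 / (1 + \<bar>real_of_int n\<bar>)\<^sup>2) \<circ> (\<lambda>n. - 1 - int n)) summable_on UNIV"
      by (simp add: o_def abs_if algebra_simps)
  qed (auto simp: inj_on_def)
  ultimately have "(\<lambda>n::int. 1 / (1 + \<bar>real_of_int n\<bar>)\<^sup>2) summable_on (range int \<union> range (\<lambda>n. - 1 - int n))"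
    by (rule summable_on_Un_disjoint) auto
  also have "range int \<union> range (\<lambda>n. - 1 - int n) = UNIV"
  proof -
    have *: "n \<in> range int \<union> range (\<lambda>n. - 1 - int n)" for n
    proof (cases "n \<ge> 0")
      case True
      then show ?thesis by (intro UnI1 image_eqI[of _ _ "nat n"]) auto
    next
      case False
      then show ?thesis by (intro UnI2 image_eqI[of _ _ "nat (- 1 - n)"]) auto
    qed
    show ?thesis by (rule UNIV_eq_I[symmetric]) (rule *)
  qed
  finally show ?thesis .
qed

lemma inverse_ell2: "(\<lambda>n. of_real (K / (1 + \<bar>real_of_int n\<bar>))) \<in> ell2"
  using summable_on_cmult_right[OF inverse_squares_summable, of "K\<^sup>2"]
  by (simp add: ell2_def power_divide norm_divide norm_mult del: of_real_divide of_real_mult)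

lemma ell2_sker: "(\<lambda>n. sker n z) \<in> ell2"
proof -
  obtain K where "K \<ge> 0" "\<And>n w. norm w \<le> norm z \<Longrightarrow> norm (sker n w) \<le> K / (1 + \<bar>real_of_int n\<bar>)"
    using sker_bound[of "norm z"] by blast
  then show ?thesis
    by (intro ell2_dominated[OF inverse_ell2[of K], where C = 1]) (auto simp del: of_real_divide)
qed

section \<open>Cauchy sums with square summable coefficients\<close>

definition csum :: "(int \<Rightarrow> complex) \<Rightarrow> complex \<Rightarrow> complex" where
  "csum c z = (\<Sum>\<^sub>\<infinity>n. c n / (z - of_int n))"

definition hsum :: "(int \<Rightarrow> complex) \<Rightarrow> complex \<Rightarrow> complex" where
  "hsum c z = (\<Sum>\<^sub>\<infinity>n. c n * sker n z)"

lemma hsum_has_sum: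
  assumes "c \<in> ell2" shows "((\<lambda>n. c n * sker n z) has_sum hsum c z) UNIV"
proof -
  have "(\<lambda>n. cnj (sker n z)) \<in> ell2" using ell2_sker[of z] by (simp add: ell2_def)
  from l2ip_summable[OF assms this] show ?thesis unfolding hsum_def by simp
qed

lemma hsum_add: "c \<in> ell2 \<Longrightarrow> d \<in> ell2 \<Longrightarrow> hsum (\<lambda>n. c n + k * d n) z = hsum c z + k * hsum d z"
proof -
  assume cd: "c \<in> ell2" "d \<in> ell2"
  have "((\<lambda>n. c n * sker n z + k * (d n * sker n z)) has_sum (hsum c z + k * hsum d z)) UNIV"
    by (intro has_sum_add has_sum_cmult_right hsum_has_sum cd)
  then have "((\<lambda>n. (c n + k * d n) * sker n z) has_sum (hsum c z + k * hsum d z)) UNIV"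
    by (simp add: algebra_simps)
  then show ?thesis unfolding hsum_def by (rule infsumI)
qed

lemma hsum_of_int: "hsum c (of_int m) = of_real pi * cospi m * c m"
proof -
  have "hsum c (of_int m) = (\<Sum>\<^sub>\<infinity>n\<in>{m}. c n * sker n (of_int m))"
    unfolding hsum_def by (rule infsum_cong_neutral) (auto simp: sker_of_int)
  then show ?thesis by (simp add: sker_of_int)
qed

lemma of_int_ne: "z \<notin> \<int> \<Longrightarrow> z \<noteq> of_int n" by auto

lemma csum_has_sum:
  assumes "c \<in> ell2" "z \<notin> \<int>"
  shows "((\<lambda>n. c n / (z - of_int n)) has_sum csum c z) UNIV" and "hsum c z = sinpi z * csum c z"
proof -
  have s: "sinpi z \<noteq> 0" using assms by (simp add: sinpi_eq_0_iff)
  have "((\<lambda>n. c n * sker n z * inverse (sinpi z)) has_sum hsum c z * inverse (sinpi z)) UNIV"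
    by (intro has_sum_cmult_left hsum_has_sum assms)
  moreover have "(\<lambda>n. c n * sker n z * inverse (sinpi z)) = (\<lambda>n. c n / (z - of_int n))"
    using s of_int_ne[OF assms(2)] by (auto simp: sker_def field_simps)
  ultimately have *: "((\<lambda>n. c n / (z - of_int n)) has_sum hsum c z * inverse (sinpi z)) UNIV" by simp
  then have e: "csum c z = hsum c z * inverse (sinpi z)" unfolding csum_def by (rule infsumI)
  from * show "((\<lambda>n. c n / (z - of_int n)) has_sum csum c z) UNIV" unfolding e .
  show "hsum c z = sinpi z * csum c z" using s by (simp add: e)
qed

lemma mult_le_sum_squares: "(x::real) * y \<le> x\<^sup>2 + y\<^sup>2"
proof -
  have "0 \<le> (x - y)\<^sup>2 + (x\<^sup>2 + y\<^sup>2)" by simp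
  then show ?thesis by (simp add: power2_eq_square algebra_simps)
qed

lemma holomorphic_hsum:
  assumes c: "c \<in> ell2" shows "hsum c holomorphic_on UNIV"
proof -
  have "hsum c holomorphic_on ball 0 R" for R
  proof -
    obtain K where K: "K \<ge> 0" "\<And>n w. norm w \<le> R \<Longrightarrow> norm (sker n w) \<le> K / (1 + \<bar>real_of_int n\<bar>)"
      using sker_bound[of R] by blast
    have "uniform_limit (cball 0 R) (\<lambda>X z. \<Sum>n\<in>X. c n * sker n z) (hsum c) (finite_subsets_at_top UNIV)"
    proof (rule Weierstrass_m_test_general')
      show "(\<lambda>n. (cmod (c n))\<^sup>2 + K\<^sup>2 * (1 / (1 + \<bar>real_of_int n\<bar>)\<^sup>2)) summable_on UNIV"
        by (intro summable_on_add summable_on_cmult_right inverse_squares_summable ell2D c)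
      show "((\<lambda>n. c n * sker n z) has_sum hsum c z) UNIV" for z by (rule hsum_has_sum[OF c])
      show "norm (c n * sker n z) \<le> (cmod (c n))\<^sup>2 + K\<^sup>2 * (1 / (1 + \<bar>real_of_int n\<bar>)\<^sup>2)" if "z \<in> cball 0 R" for n z
      proof -
        have "norm (c n * sker n z) \<le> cmod (c n) * (K / (1 + \<bar>real_of_int n\<bar>))"
          unfolding norm_mult using K(2)[of z n] that by (intro mult_left_mono) auto
        also have "\<dots> \<le> (cmod (c n))\<^sup>2 + (K / (1 + \<bar>real_of_int n\<bar>))\<^sup>2" by (rule mult_le_sum_squares)
        finally show ?thesis by (simp add: power_divide)
      qed
    qed
    then show ?thesis
    proof (rule holomorphic_uniform_limit[rotated])
      show "\<forall>\<^sub>F X in finite_subsets_at_top UNIV. continuous_on (cball 0 R) (\<lambda>z. \<Sum>n\<in>X. c n * sker n z) \<and>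
          (\<lambda>z. \<Sum>n\<in>X. c n * sker n z) holomorphic_on ball 0 R"
      proof (intro always_eventually allI)
        fix X
        have "(\<lambda>z. \<Sum>n\<in>X. c n * sker n z) holomorphic_on UNIV"
          by (intro holomorphic_intros holomorphic_sker)
        then show "continuous_on (cball 0 R) (\<lambda>z. \<Sum>n\<in>X. c n * sker n z) \<and>
          (\<lambda>z. \<Sum>n\<in>X. c n * sker n z) holomorphic_on ball 0 R"
          by (meson holomorphic_on_imp_continuous_on holomorphic_on_subset subset_UNIV)
      qed
    qed auto
  qed
  then have "hsum c holomorphic_on (\<Union>R\<in>UNIV. ball 0 R)"
    by (intro holomorphic_on_UN_open) auto
  moreover have "(\<Union>R\<in>UNIV. ball 0 R) = (UNIV :: complex set)"
    by (auto intro: gt_ex)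
  ultimately show ?thesis by simp
qed

definition inv_sq_sum :: real where
  "inv_sq_sum = (\<Sum>\<^sub>\<infinity>n::int. 1 / (1 + \<bar>real_of_int n\<bar>)\<^sup>2)"

text \<open>The bound must not depend on the position of \<open>z\<close>, so the index is centred
  at \<open>m = \<lfloor>Re z\<rfloor>\<close>: then the distance from \<open>z\<close> to
  \<open>n\<close> is at least \<open>(1 + \<bar>n - m\<bar>) / 8\<close>, both near
  \<open>m\<close> and far from it. The constant 64 is the square of 8.\<close>

lemma norm_csum_le:
  assumes c: "c \<in> ell2" and z: "\<And>n::int. norm (z - of_int n) \<ge> 1/4"
  shows "norm (csum c z) \<le> l2sq c + 64 * inv_sq_sum"
proof -
  have zi: "z \<notin> \<int>"
  proof
    assume "z \<in> \<int>"
    then obtain n where "z = of_int n" by (elim Ints_cases)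
    with z[of n] show False by simp
  qed
  define m where "m = \<lfloor>Re z\<rfloor>"
  have bij: "bij_betw (\<lambda>n::int. n - m) UNIV UNIV"
    by (rule bij_betw_byWitness[where f' = "\<lambda>n. n + m"]) auto
  have "((\<lambda>n::int. 1 / (1 + \<bar>real_of_int n\<bar>)\<^sup>2) has_sum inv_sq_sum) UNIV"
    unfolding inv_sq_sum_def by (intro has_sum_infsum inverse_squares_summable)
  then have "((\<lambda>n::int. 1 / (1 + \<bar>real_of_int (n - m)\<bar>)\<^sup>2) has_sum inv_sq_sum) UNIV"
    by (subst has_sum_reindex_bij_betw[OF bij])
  then have dom: "((\<lambda>n. (cmod (c n))\<^sup>2 + 64 * (1 / (1 + \<bar>real_of_int (n - m)\<bar>)\<^sup>2)) has_sum (l2sq c + 64 * inv_sq_sum)) UNIV"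
    unfolding l2sq_def by (intro has_sum_add has_sum_cmult_right has_sum_infsum ell2D c)
  have "norm (c n / (z - of_int n)) \<le> (cmod (c n))\<^sup>2 + 64 * (1 / (1 + \<bar>real_of_int (n - m)\<bar>)\<^sup>2)" for n
  proof -
    have "norm (z - of_int n) \<ge> \<bar>Re z - real_of_int n\<bar>" using abs_Re_le_cmod[of "z - of_int n"] by simp
    moreover have "real_of_int m \<le> Re z" "Re z < real_of_int m + 1" unfolding m_def by linarith+
    moreover define t where "t = \<bar>real_of_int (n - m)\<bar>"
    ultimately have zt: "norm (z - of_int n) \<ge> t - 1" unfolding of_int_diff by linarith
    have "t \<le> 1 \<or> t \<ge> 2"
    proof -
      have "t = real_of_int \<bar>n - m\<bar>" by (simp add: t_def)
      then show ?thesis by (cases "\<bar>n - m\<bar> \<le> 1") linarith+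
    qed
    then have d: "norm (z - of_int n) \<ge> (1 + \<bar>real_of_int (n - m)\<bar>) / 8"
      unfolding t_def[symmetric] using z[of n] zt by (elim disjE; simp)
    have "norm (c n / (z - of_int n)) = cmod (c n) * (1 / norm (z - of_int n))" by (simp add: norm_divide)
    also have "\<dots> \<le> cmod (c n) * (8 / (1 + \<bar>real_of_int (n - m)\<bar>))"
    proof (rule mult_left_mono)
      have "1 / norm (z - of_int n) \<le> 1 / ((1 + \<bar>real_of_int (n - m)\<bar>) / 8)"
        using d z[of n] by (intro divide_left_mono mult_pos_pos) auto
      then show "1 / norm (z - of_int n) \<le> 8 / (1 + \<bar>real_of_int (n - m)\<bar>)" by simp
    qed simp
    also have "\<dots> \<le> (cmod (c n))\<^sup>2 + (8 / (1 + \<bar>real_of_int (n - m)\<bar>))\<^sup>2" by (rule mult_le_sum_squares)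
    finally show ?thesis by (simp add: power_divide)
  qed
  then show ?thesis by (intro norm_infsum_le[OF csum_has_sum(1)[OF c zi] dom])
qed

lemma norm_diff_of_int_imag: "norm (\<i> * of_real y - of_int n) \<ge> \<bar>y\<bar>" "norm (\<i> * of_real y - of_int n) \<ge> \<bar>real_of_int n\<bar>"
  using abs_Im_le_cmod[of "\<i> * of_real y - of_int n"] abs_Re_le_cmod[of "\<i> * of_real y - of_int n"] by simp_all

lemma imag_not_int: "y \<noteq> 0 \<Longrightarrow> \<i> * of_real y \<notin> \<int>"
  using norm_diff_of_int_imag(1)[of y] by (auto elim!: Ints_cases)

lemma csum_imag_tendsto_0:
  assumes c: "c \<in> ell2"
  shows "((\<lambda>y. csum c (\<i> * of_real y)) \<longlongrightarrow> 0) at_top"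
proof (rule tendstoI)
  fix e :: real assume e: "e > 0"
  have "uniform_limit {1..} (\<lambda>X y. \<Sum>n\<in>X. c n / (\<i> * of_real y - of_int n)) (\<lambda>y. csum c (\<i> * of_real y))
    (finite_subsets_at_top UNIV)"
  proof (rule Weierstrass_m_test_general')
    show "(\<lambda>n. (cmod (c n))\<^sup>2 + 4 * (1 / (1 + \<bar>real_of_int n\<bar>)\<^sup>2)) summable_on UNIV"
      by (intro summable_on_add summable_on_cmult_right inverse_squares_summable ell2D c)
    show "((\<lambda>n. c n / (\<i> * of_real y - of_int n)) has_sum csum c (\<i> * of_real y)) UNIV" if "y \<in> {1..}" for y
      using that imag_not_int[of y] by (intro csum_has_sum c) auto
    show "norm (c n / (\<i> * of_real y - of_int n)) \<le> (cmod (c n))\<^sup>2 + 4 * (1 / (1 + \<bar>real_of_int n\<bar>)\<^sup>2)" if "y \<in> {1..}" for n y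
    proof -
      have d: "norm (\<i> * of_real y - of_int n) \<ge> (1 + \<bar>real_of_int n\<bar>) / 2"
        using norm_diff_of_int_imag[where y = y and n = n] that by simp
      have "norm (c n / (\<i> * of_real y - of_int n)) = cmod (c n) * (1 / norm (\<i> * of_real y - of_int n))"
        by (simp add: norm_divide)
      also have "\<dots> \<le> cmod (c n) * (1 / ((1 + \<bar>real_of_int n\<bar>) / 2))"
        using d by (intro mult_left_mono divide_left_mono mult_pos_pos) (auto intro: order.strict_trans2[OF _ d])
      also have "\<dots> \<le> (cmod (c n))\<^sup>2 + (1 / ((1 + \<bar>real_of_int n\<bar>) / 2))\<^sup>2" by (rule mult_le_sum_squares)
      finally show ?thesis by (simp add: power_divide)
    qed
  qed
  then have "\<forall>\<^sub>F X in finite_subsets_at_top UNIV. \<forall>y\<in>{1..}. dist (\<Sum>n\<in>X. c n / (\<i> * of_real y - of_int n)) (csum c (\<i> * of_real y)) < e / 2"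
    using e by (intro uniform_limitD) auto
  then obtain X where X: "\<And>y. y \<ge> 1 \<Longrightarrow> dist (\<Sum>n\<in>X. c n / (\<i> * of_real y - of_int n)) (csum c (\<i> * of_real y)) < e / 2"
    unfolding eventually_finite_subsets_at_top by auto
  have "((\<lambda>y. \<Sum>n\<in>X. c n / (\<i> * of_real y - of_int n)) \<longlongrightarrow> 0) at_top"
  proof (rule tendsto_null_sum)
    fix n
    show "((\<lambda>y. c n / (\<i> * of_real y - of_int n)) \<longlongrightarrow> 0) at_top"
    proof (rule Lim_null_comparison)
      show "((\<lambda>y. cmod (c n) / y) \<longlongrightarrow> 0) at_top" by real_asymp
      show "\<forall>\<^sub>F y in at_top. norm (c n / (\<i> * of_real y - of_int n)) \<le> cmod (c n) / y"
        using eventually_gt_at_top[of 0]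
      proof eventually_elim
        case (elim y)
        have "norm (\<i> * of_real y - of_int n) \<ge> y" using norm_diff_of_int_imag(1)[of y n] elim by simp
        then show ?case unfolding norm_divide using elim by (intro divide_left_mono mult_pos_pos) auto
      qed
    qed
  qed
  then have "\<forall>\<^sub>F y in at_top. norm (\<Sum>n\<in>X. c n / (\<i> * of_real y - of_int n)) < e / 2"
    using e by (auto simp: tendsto_iff dest: spec[of _ "e/2"])
  then show "\<forall>\<^sub>F y in at_top. dist (csum c (\<i> * of_real y)) 0 < e"
    using eventually_ge_at_top[of 1]
  proof eventually_elim
    case (elim y)
    have "norm (csum c (\<i> * of_real y)) \<le> norm (\<Sum>n\<in>X. c n / (\<i> * of_real y - of_int n)) +
       dist (\<Sum>n\<in>X. c n / (\<i> * of_real y - of_int n)) (csum c (\<i> * of_real y))"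
      unfolding dist_norm by (metis norm_minus_commute norm_triangle_sub)
    then show ?case using elim X[of y] by simp
  qed
qed

lemma dist_int_on_circle:
  fixes z :: complex
  assumes "norm z = real n + 1/4" shows "norm (z - of_int m) \<ge> 1/4"
proof -
  have "\<bar>norm z - norm (of_int m :: complex)\<bar> \<le> norm (z - of_int m)" by (rule norm_triangle_ineq3)
  moreover have "\<bar>(real n + 1/4) - \<bar>real_of_int m\<bar>\<bar> \<ge> 1/4"
  proof (cases "\<bar>m\<bar> \<le> int n")
    case True
    then have "\<bar>real_of_int m\<bar> \<le> real n" by linarith
    then show ?thesis by linarith
  next
    case False
    then have "\<bar>real_of_int m\<bar> \<ge> real n + 1" by linarith
    then show ?thesis by linarith
  qed
  ultimately show ?thesis using assms by simp
qed

lemma sinpi_ne_0_on_circle: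
  fixes z :: complex
  assumes "norm z = real n + 1/4" shows "z \<notin> \<int>" "sinpi z \<noteq> 0"
proof -
  show "z \<notin> \<int>"
  proof
    assume "z \<in> \<int>"
    then obtain m where "z = of_int m" by (rule Ints_cases)
    with dist_int_on_circle[OF assms, of m] show False by simp
  qed
  then show "sinpi z \<noteq> 0" by (simp add: sinpi_eq_0_iff)
qed

text \<open>\<open>h - hsum c\<close> vanishes at the integers, so its quotient \<open>E\<close> by
  the sine is entire. The circle bound makes \<open>E\<close> of type zero, the bound on the
  imaginary axis makes it constant, and the limit along the upper half of that axis makes the
  constant 0.\<close>

theorem interpolation_formula:
  assumes h: "h holomorphic_on UNIV"
    and c: "c \<in> ell2" and ch: "\<And>n. h (of_int n) = of_real pi * cospi n * c n"
    and circ: "\<And>\<epsilon>. \<epsilon> > 0 \<Longrightarrow> \<exists>C N. \<forall>n\<ge>N. \<forall>z. norm z = real n + 1/4 \<longrightarrow> norm (h z / sinpi z) \<le> C * exp (\<epsilon> * norm z)"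
    and imag: "\<And>y. \<bar>y\<bar> \<ge> 1 \<Longrightarrow> norm (h (\<i> * of_real y) / sinpi (\<i> * of_real y)) \<le> D"
    and lim: "((\<lambda>y. h (\<i> * of_real y) / sinpi (\<i> * of_real y)) \<longlongrightarrow> 0) at_top"
  shows "h z = hsum c z"
proof -
  define L where "L = l2sq c + 64 * inv_sq_sum"
  have hol: "(\<lambda>z. h z - hsum c z) holomorphic_on UNIV" by (intro holomorphic_intros h holomorphic_hsum c)
  have zeros: "h z - hsum c z = 0 \<and> deriv sinpi z \<noteq> 0" if "sinpi z = 0" for z
  proof -
    have "z \<in> \<int>" using that by (simp add: sinpi_eq_0_iff)
    then obtain n where n: "z = of_int n" by (rule Ints_cases)
    show ?thesis using cospi_nonzero[of n] unfolding n ch hsum_of_int deriv_sinpi by (simp add: cospi_def)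
  qed
  obtain E where E: "E holomorphic_on UNIV" "\<And>z. h z - hsum c z = sinpi z * E z"
    using entire_quotient[OF hol holomorphic_sinpi zeros] by blast
  have Ez: "E z = h z / sinpi z - csum c z" if "z \<notin> \<int>" for z
    using E(2)[of z] csum_has_sum(2)[OF c that] that by (simp add: sinpi_eq_0_iff field_simps)
  have type: "\<exists>C. \<forall>z. norm (E z) \<le> C * exp (\<epsilon> * norm z)" if \<epsilon>: "\<epsilon> > 0" for \<epsilon>
  proof -
    obtain C N where CN: "\<And>n z. n \<ge> N \<Longrightarrow> norm z = real n + 1/4 \<Longrightarrow> norm (h z / sinpi z) \<le> C * exp (\<epsilon> * norm z)"
      using circ[OF \<epsilon>] by blast
    show ?thesis
    proof (rule zero_type_from_circles[OF E(1) \<epsilon>])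
      fix n and z :: complex assume nz: "n \<ge> N" "norm z = real n + 1/4"
      have "norm (E z) \<le> norm (h z / sinpi z) + norm (csum c z)"
        unfolding Ez[OF sinpi_ne_0_on_circle(1)[OF nz(2)]] by (rule norm_triangle_ineq4)
      moreover have "norm (csum c z) \<le> L"
        unfolding L_def by (intro norm_csum_le c dist_int_on_circle[OF nz(2)])
      moreover have "L \<le> \<bar>L\<bar> * exp (\<epsilon> * norm z)"
      proof -
        have "\<bar>L\<bar> * 1 \<le> \<bar>L\<bar> * exp (\<epsilon> * norm z)" using \<epsilon> by (intro mult_left_mono) auto
        then show ?thesis by linarith
      qed
      ultimately show "norm (E z) \<le> (C + \<bar>L\<bar>) * exp (\<epsilon> * norm z)"
        using CN[OF nz] unfolding distrib_right by linarith
    qed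
  qed
  obtain B0 where B0: "\<And>z. norm z \<le> 1 \<Longrightarrow> norm (E z) \<le> B0"
    using entire_bounded_on_cball[OF E(1), of 1] by blast
  have bd: "norm (E z) \<le> \<bar>B0\<bar> + (\<bar>D\<bar> + \<bar>L\<bar>)" if "Re z = 0" for z
  proof (cases "norm z \<le> 1")
    case True then show ?thesis using B0[OF True] by linarith
  next
    case False
    have z: "z = \<i> * of_real (Im z)" using that by (simp add: complex_eq_iff)
    have y1: "\<bar>Im z\<bar> \<ge> 1" using False cmod_eq_Im[OF that] by linarith
    have "norm (E z) \<le> norm (h z / sinpi z) + norm (csum c z)"
    proof -
      have "Im z \<noteq> 0" using y1 by auto
      then have "z \<notin> \<int>" using imag_not_int[of "Im z"] unfolding z[symmetric] by blast
      from Ez[OF this] show ?thesis by (simp only: norm_triangle_ineq4)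
    qed
    moreover have "norm (csum c z) \<le> L"
      unfolding L_def
    proof (intro norm_csum_le c)
      show "1/4 \<le> norm (z - of_int n)" for n
        using norm_diff_of_int_imag(1)[where y = "Im z" and n = n] y1 unfolding z[symmetric] by linarith
    qed
    moreover have "norm (h z / sinpi z) \<le> D" using imag[OF y1] unfolding z[symmetric] .
    ultimately show ?thesis by linarith
  qed
  obtain k where k: "\<And>z. E z = k" using zero_type_bounded_imp_constant[OF E(1) type bd] by blast
  have "((\<lambda>y. h (\<i> * of_real y) / sinpi (\<i> * of_real y) - csum c (\<i> * of_real y)) \<longlongrightarrow> 0 - 0) at_top"
    by (intro tendsto_diff lim csum_imag_tendsto_0 c)
  moreover have "\<forall>\<^sub>F y in at_top. h (\<i> * of_real y) / sinpi (\<i> * of_real y) - csum c (\<i> * of_real y) = k"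
    using eventually_gt_at_top[of 0]
  proof eventually_elim
    case (elim y)
    then have "\<i> * of_real y \<notin> \<int>" by (intro imag_not_int) simp
    from Ez[OF this] show ?case by (simp only: k)
  qed
  ultimately have "((\<lambda>y::real. k) \<longlongrightarrow> 0) at_top" by (simp add: tendsto_cong)
  then have "k = 0" by (simp add: tendsto_const_iff)
  then show ?thesis using E(2)[of z] k by simp
qed

section \<open>The spaces with bounded weight\<close>

lemma eq_at_int_if_eq_off_int:
  assumes f: "f holomorphic_on UNIV" and g: "g holomorphic_on UNIV"
    and eq: "\<And>z. z \<notin> \<int> \<Longrightarrow> f z = g z"
  shows "f = (g :: complex \<Rightarrow> complex)"
proof
  fix z
  show "f z = g z"
  proof (cases "z \<in> \<int>")
    case True
    then obtain n where n: "z = of_int n" by (rule Ints_cases)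
    have "eventually (\<lambda>w. w \<in> ball z 1 - {z}) (at z)"
      by (rule eventually_at_in_open) auto
    then have ev: "eventually (\<lambda>w. f w = g w) (at z)"
    proof eventually_elim
      case (elim w)
      have "w \<notin> \<int>"
      proof
        assume "w \<in> \<int>"
        then obtain m where m: "w = of_int m" by (rule Ints_cases)
        have "norm (of_int (n - m) :: complex) < 1" using elim by (simp add: n m dist_norm)
        then have "\<bar>n - m\<bar> < 1" unfolding norm_of_int by linarith
        then have "m = n" by simp
        then show False using elim m n by simp
      qed
      then show ?case by (rule eq)
    qed
    have "(f \<longlongrightarrow> f z) (at z)" "(g \<longlongrightarrow> g z) (at z)"
      using f g by (auto simp: holomorphic_on_imp_continuous_on continuous_on_eq_continuous_at isCont_def[symmetric] dest!: holomorphic_on_imp_continuous_on)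
    moreover have "(f \<longlongrightarrow> g z) (at z)"
      using tendsto_cong[OF ev] \<open>(g \<longlongrightarrow> g z) (at z)\<close> by blast
    ultimately show ?thesis using tendsto_unique[of "at z"] by auto
  qed (rule eq)
qed

text \<open>Boundedness makes \<open>a n * sqrt (b n)\<close> square summable again. Every member of
  the space is then an \<open>hsum\<close> of an l2 sequence, the form in which the interpolation
  formula delivers functions.\<close>

locale bounded_weight =
  fixes b :: "int \<Rightarrow> real" and \<beta> :: real
  assumes b_pos: "\<And>n. b n > 0" and b_le: "\<And>n. b n \<le> \<beta>"
begin

definition wt :: "(int \<Rightarrow> complex) \<Rightarrow> int \<Rightarrow> complex" where
  "wt a n = a n * of_real (sqrt (b n))"

definition H :: "(int \<Rightarrow> complex) \<Rightarrow> complex \<Rightarrow> complex" where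
  "H a = hsum (wt a)"

lemma weight_seq_b: "weight_seq b"
  unfolding weight_seq_def
proof (intro conjI allI b_pos)
  have "\<beta> \<ge> 0" using b_pos[of 0] b_le[of 0] by linarith
  have "(\<lambda>n::int. (2 * \<beta>) * (1 / (1 + \<bar>real_of_int n\<bar>)\<^sup>2)) summable_on UNIV"
    by (intro summable_on_cmult_right inverse_squares_summable)
  then show "(\<lambda>n. b n / (1 + (real_of_int n)\<^sup>2)) summable_on UNIV"
  proof (rule summable_on_comparison_test)
    fix n
    have "0 \<le> (1 - \<bar>real_of_int n\<bar>)\<^sup>2" by simp
    then have "(1 + \<bar>real_of_int n\<bar>)\<^sup>2 \<le> 2 * (1 + (real_of_int n)\<^sup>2)"
      by (simp add: power2_eq_square algebra_simps)
    moreover have "(1 + \<bar>real_of_int n\<bar>)\<^sup>2 > 0" by (intro zero_less_power) simp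
    moreover have "1 + (real_of_int n)\<^sup>2 > 0" by (intro add_pos_nonneg) auto
    ultimately have "1 / (1 + (real_of_int n)\<^sup>2) \<le> 2 * (1 / (1 + \<bar>real_of_int n\<bar>)\<^sup>2)"
      by (simp add: field_simps)
    then have "b n * (1 / (1 + (real_of_int n)\<^sup>2)) \<le> \<beta> * (2 * (1 / (1 + \<bar>real_of_int n\<bar>)\<^sup>2))"
      using b_le[of n] \<open>\<beta> \<ge> 0\<close> by (intro mult_mono) auto
    then show "b n / (1 + (real_of_int n)\<^sup>2) \<le> (2 * \<beta>) * (1 / (1 + \<bar>real_of_int n\<bar>)\<^sup>2)"
      by (simp add: mult.commute)
    show "0 \<le> b n / (1 + (real_of_int n)\<^sup>2)" using b_pos[of n] by (intro divide_nonneg_nonneg) auto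
  qed
qed

lemma wt_ell2: "a \<in> ell2 \<Longrightarrow> wt a \<in> ell2"
proof (erule ell2_dominated)
  fix n
  have "sqrt (b n) \<le> sqrt \<beta>" using b_le by simp
  then show "cmod (wt a n) \<le> sqrt \<beta> * cmod (a n)"
    using b_pos[of n] mult_right_mono[of "sqrt (b n)" "sqrt \<beta>" "cmod (a n)"]
    by (simp add: wt_def norm_mult mult.commute)
qed

lemma represents_H: "a \<in> ell2 \<Longrightarrow> represents b a (H a)"
  unfolding represents_def H_def cauchy_sum_def
  using csum_has_sum(2)[OF wt_ell2] holomorphic_hsum[OF wt_ell2] by (simp add: csum_def wt_def)

lemma represents_iff: "represents b a h \<longleftrightarrow> a \<in> ell2 \<and> h = H a"
proof
  assume r: "represents b a h"
  then have a: "a \<in> ell2" by (simp add: represents_def)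
  have "h = H a"
    by (rule eq_at_int_if_eq_off_int) (use r represents_H[OF a] in \<open>auto simp: represents_def\<close>)
  with a show "a \<in> ell2 \<and> h = H a" by simp
qed (auto intro: represents_H)

lemma H_of_int: "H a (of_int n) = of_real pi * cospi n * a n * of_real (sqrt (b n))"
  by (simp add: H_def hsum_of_int wt_def)

lemma H_inj: "H a = H a' \<Longrightarrow> a = a'"
proof
  fix n
  assume "H a = H a'"
  then have "H a (of_int n) = H a' (of_int n)" by simp
  then show "a n = a' n" using b_pos[of n] by (simp add: H_of_int)
qed

lemma hspace_eq: "hspace b = H ` ell2"
  by (auto simp: hspace_def represents_iff)

lemma hcoeff_H: "a \<in> ell2 \<Longrightarrow> hcoeff b (H a) = a"
  unfolding hcoeff_def represents_iff using H_inj by (intro the_equality) auto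

lemma hinner_H: "a \<in> ell2 \<Longrightarrow> a' \<in> ell2 \<Longrightarrow> hinner b (H a) (H a') = l2ip a a'"
  by (simp add: hinner_def l2ip_def hcoeff_H)

lemma hnorm_H: "a \<in> ell2 \<Longrightarrow> hnorm b (H a) = sqrt (l2sq a)"
  by (simp add: hnorm_def l2sq_def hcoeff_H)

lemma H_lin: "a \<in> ell2 \<Longrightarrow> a' \<in> ell2 \<Longrightarrow> H (\<lambda>n. a n + k * a' n) = (\<lambda>z. H a z + k * H a' z)"
proof
  fix z assume a: "a \<in> ell2" "a' \<in> ell2"
  have "wt (\<lambda>n. a n + k * a' n) = (\<lambda>n. wt a n + k * wt a' n)" by (auto simp: wt_def algebra_simps)
  then show "H (\<lambda>n. a n + k * a' n) z = H a z + k * H a' z"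
    unfolding H_def using hsum_add[OF wt_ell2[OF a(1)] wt_ell2[OF a(2)]] by simp
qed

lemma H_0: "H (\<lambda>n. 0) = (\<lambda>z. 0)"
  by (simp add: H_def wt_def[abs_def] hsum_def[abs_def])

text \<open>The conjugated coefficients of the evaluation functional at \<mu>:
  \<open>H a \<mu>\<close> is the sum of \<open>a n * sqrt (b n) * sker n \<mu>\<close>.\<close>

definition kcoef :: "complex \<Rightarrow> int \<Rightarrow> complex" where
  "kcoef \<mu> n = cnj (sker n \<mu>) * of_real (sqrt (b n))"

lemma kcoef_ell2: "kcoef \<mu> \<in> ell2"
proof -
  have "(\<lambda>n. cnj (sker n \<mu>)) \<in> ell2" using ell2_sker[of \<mu>] by (simp add: ell2_def)
  from wt_ell2[OF this] show ?thesis by (simp add: wt_def[abs_def] kcoef_def[abs_def])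
qed

lemma H_eval: "a \<in> ell2 \<Longrightarrow> l2ip a (kcoef \<mu>) = H a \<mu>"
  by (simp add: H_def hsum_def l2ip_def wt_def kcoef_def mult_ac)

lemma rkernel_eq: "rkernel b \<mu> = H (kcoef \<mu>)"
  unfolding rkernel_def
proof (rule the_equality)
  show "H (kcoef \<mu>) \<in> hspace b \<and> (\<forall>h\<in>hspace b. hinner b h (H (kcoef \<mu>)) = h \<mu>)"
    by (auto simp: hspace_eq kcoef_ell2 hinner_H H_eval)
  fix k assume k: "k \<in> hspace b \<and> (\<forall>h\<in>hspace b. hinner b h k = h \<mu>)"
  then obtain a where a: "a \<in> ell2" "k = H a" by (auto simp: hspace_eq)
  let ?d = "\<lambda>n. a n - kcoef \<mu> n"
  have d: "?d \<in> ell2" using a kcoef_ell2 by (intro ell2_diff)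
  have "l2ip ?d a = H ?d \<mu>" using k d a by (auto simp: hspace_eq hinner_H)
  then have "l2ip ?d a = l2ip ?d (kcoef \<mu>)" using H_eval[OF d] by simp
  then have "cnj (l2ip ?d a - l2ip ?d (kcoef \<mu>)) = 0" by simp
  then have "l2ip a ?d - l2ip (kcoef \<mu>) ?d = 0"
    unfolding complex_cnj_diff l2ip_commute[symmetric] .
  then have "l2ip ?d ?d = 0" using a d kcoef_ell2 by (simp add: l2ip_diff_left)
  then have "l2sq ?d = 0" using d by (simp add: l2ip_self)
  from l2sq_eq_0[OF d this] have "a = kcoef \<mu>" by auto
  then show "k = H (kcoef \<mu>)" using a by simp
qed

lemma hinner_rkernel: "h \<in> hspace b \<Longrightarrow> hinner b (rkernel b \<mu>) h = cnj (h \<mu>)"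
  by (auto simp: hspace_eq rkernel_eq hinner_H kcoef_ell2 H_eval[symmetric] l2ip_commute[of _ "kcoef \<mu>"])

lemma rkernel_in_hspace: "rkernel b \<mu> \<in> hspace b"
  by (simp add: hspace_eq rkernel_eq kcoef_ell2)

text \<open>The kernels at the integers correspond to multiples of the coordinate vectors, since
  \<open>sker n\<close> vanishes at all integers but \<open>n\<close>.\<close>

lemma hnorm_rkernel_of_int: "hnorm b (rkernel b (of_int m)) = pi * sqrt (b m)"
proof -
  have "l2sq (kcoef (of_int m)) = (\<Sum>\<^sub>\<infinity>n\<in>{m}. (cmod (kcoef (of_int m) n))\<^sup>2)"
    unfolding l2sq_def by (rule infsum_cong_neutral) (auto simp: kcoef_def sker_of_int)
  also have "\<dots> = (pi * sqrt (b m))\<^sup>2"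
    using b_pos[of m] by (simp add: kcoef_def sker_of_int norm_mult)
  finally show ?thesis using b_pos[of m] by (simp add: rkernel_eq hnorm_H kcoef_ell2)
qed

section \<open>Completeness and minimality of systems of kernels\<close>

lemma lin_span_add_scale:
  assumes "f \<in> lin_span V" "g \<in> lin_span V"
  shows "(\<lambda>z. f z + k * g z) \<in> lin_span V"
proof -
  obtain T c where T: "f = (\<lambda>z. \<Sum>v\<in>T. c v * v z)" "finite T" "T \<subseteq> V" using assms(1) by (auto simp: lin_span_def)
  obtain T' c' where T': "g = (\<lambda>z. \<Sum>v\<in>T'. c' v * v z)" "finite T'" "T' \<subseteq> V" using assms(2) by (auto simp: lin_span_def)
  define d where "d = (\<lambda>v. (if v \<in> T then c v else 0) + k * (if v \<in> T' then c' v else 0))"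
  have "f z + k * g z = (\<Sum>v\<in>T\<union>T'. d v * v z)" for z
  proof -
    have "f z = (\<Sum>v\<in>T\<union>T'. (if v \<in> T then c v else 0) * v z)"
      unfolding T(1) using T T' by (intro sum.mono_neutral_cong_left) auto
    moreover have "g z = (\<Sum>v\<in>T\<union>T'. (if v \<in> T' then c' v else 0) * v z)"
      unfolding T'(1) using T T' by (intro sum.mono_neutral_cong_left) auto
    ultimately show ?thesis
      by (simp only: d_def distrib_right sum.distrib sum_distrib_left mult.assoc)
  qed
  then show ?thesis unfolding lin_span_def using T T' by (auto intro!: exI[of _ "T \<union> T'"] exI[of _ d])
qed

lemma lin_span_0: "(\<lambda>z. 0) \<in> lin_span V"
  unfolding lin_span_def by (auto intro!: exI[of _ "{}"])

lemma lin_span_base: "v \<in> V \<Longrightarrow> v \<in> lin_span V"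
  unfolding lin_span_def by (auto intro!: exI[of _ "{v}"] exI[of _ "\<lambda>_. 1"])

text \<open>Orthogonality to a kernel is vanishing at its point, so for a uniqueness set nothing but
  0 is orthogonal to the span; the density criterion is applied to the coefficient
  sequences.\<close>

lemma closed_span_rkernel:
  assumes uniq: "\<And>h. h \<in> hspace b \<Longrightarrow> (\<And>\<mu>. \<mu> \<in> \<Lambda> \<Longrightarrow> h \<mu> = 0) \<Longrightarrow> h = (\<lambda>z. 0)"
  shows "closed_span b (rkernel b ` \<Lambda>) = hspace b"
proof
  show "closed_span b (rkernel b ` \<Lambda>) \<subseteq> hspace b" by (auto simp: closed_span_def)
  show "hspace b \<subseteq> closed_span b (rkernel b ` \<Lambda>)"
  proof
    fix h assume h: "h \<in> hspace b"
    then obtain x where x: "x \<in> ell2" "h = H x" by (auto simp: hspace_eq)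
    define V where "V = {a \<in> ell2. H a \<in> lin_span (rkernel b ` \<Lambda>)}"
    have "\<exists>g\<in>lin_span (rkernel b ` \<Lambda>). hnorm b (\<lambda>z. h z - g z) < \<epsilon>" if \<epsilon>: "\<epsilon> > 0" for \<epsilon>
    proof -
      have "\<exists>v\<in>V. l2sq (\<lambda>n. x n - v n) < \<epsilon>\<^sup>2"
      proof (rule ell2_dense_subspace)
        show "V \<subseteq> ell2" by (auto simp: V_def)
        show "(\<lambda>n. 0) \<in> V" by (simp add: V_def ell2_0 H_0 lin_span_0)
        show "(\<lambda>n. u n + c * v n) \<in> V" if "u \<in> V" "v \<in> V" for u v c
          using that by (simp add: V_def H_lin lin_span_add_scale ell2_add ell2_scale)
        show "u = (\<lambda>n. 0)" if u: "u \<in> ell2" and orth: "\<And>v. v \<in> V \<Longrightarrow> l2ip u v = 0" for u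
        proof -
          have "H u = (\<lambda>z. 0)"
          proof (rule uniq)
            show "H u \<in> hspace b" using u by (simp add: hspace_eq)
            fix \<mu> assume "\<mu> \<in> \<Lambda>"
            then have "kcoef \<mu> \<in> V" unfolding V_def by (auto simp: kcoef_ell2 rkernel_eq[symmetric] intro: lin_span_base)
            from orth[OF this] show "H u \<mu> = 0" using H_eval[OF u, of \<mu>] by simp
          qed
          then show ?thesis using H_inj[of u "\<lambda>n. 0"] by (simp add: H_0)
        qed
      qed (use x \<epsilon> in auto)
      then obtain v where v: "v \<in> V" "l2sq (\<lambda>n. x n - v n) < \<epsilon>\<^sup>2" by blast
      have vl: "v \<in> ell2" using v by (simp add: V_def)
      have "H (\<lambda>n. x n + (-1) * v n) = (\<lambda>z. h z + (-1) * H v z)" unfolding x(2) by (rule H_lin[OF x(1) vl])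
      then have "(\<lambda>z. h z - H v z) = H (\<lambda>n. x n - v n)" by simp
      moreover have "hnorm b (H (\<lambda>n. x n - v n)) = sqrt (l2sq (\<lambda>n. x n - v n))"
        using x vl by (intro hnorm_H ell2_diff)
      moreover have "sqrt (l2sq (\<lambda>n. x n - v n)) < \<epsilon>" using v(2) \<epsilon> by (simp add: real_less_lsqrt l2sq_nonneg)
      ultimately show ?thesis using v(1) unfolding V_def by (intro bexI[of _ "H v"]) auto
    qed
    then show "h \<in> closed_span b (rkernel b ` \<Lambda>)" using h by (simp add: closed_span_def)
  qed
qed

text \<open>\<open>w\<close> is orthogonal to the kernels at \<Lambda> and has inner product 1 with
  the kernel at \<mu>. By Cauchy-Schwarz that kernel keeps a distance of at least the reciprocal of
  the norm of \<open>w\<close> from their span.\<close>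

lemma closed_span_rkernel_proper:
  assumes w: "w \<in> hspace b" and w1: "w \<mu> = 1" and w0: "\<And>\<nu>. \<nu> \<in> \<Lambda> \<Longrightarrow> w \<nu> = 0"
  shows "closed_span b (rkernel b ` \<Lambda>) \<noteq> hspace b"
proof
  assume "closed_span b (rkernel b ` \<Lambda>) = hspace b"
  then have k: "rkernel b \<mu> \<in> closed_span b (rkernel b ` \<Lambda>)" using rkernel_in_hspace by simp
  obtain a where a: "a \<in> ell2" "w = H a" using w by (auto simp: hspace_eq)
  \<comment> \<open>The added 1 keeps the denominator positive and
    \<open>\<epsilon> * sqrt (l2sq a)\<close> strictly below 1.\<close>
  define \<epsilon> where "\<epsilon> = 1 / (1 + sqrt (l2sq a))"
  have s0: "sqrt (l2sq a) \<ge> 0" by (simp add: l2sq_nonneg)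
  then have \<epsilon>: "\<epsilon> > 0" unfolding \<epsilon>_def by (intro divide_pos_pos add_pos_nonneg) auto
  then obtain g where g: "g \<in> lin_span (rkernel b ` \<Lambda>)" "hnorm b (\<lambda>z. rkernel b \<mu> z - g z) < \<epsilon>"
    using k by (auto simp: closed_span_def)
  obtain T c where T: "g = (\<lambda>z. \<Sum>v\<in>T. c v * v z)" "finite T" "T \<subseteq> rkernel b ` \<Lambda>" using g(1) by (auto simp: lin_span_def)
  have "\<exists>u\<in>ell2. (\<lambda>z. \<Sum>v\<in>T. c v * v z) = H u \<and> l2ip u a = 0"
    using T(2,3)
  proof (induction T)
    case empty
    show ?case by (intro bexI[of _ "\<lambda>n. 0"]) (auto simp: H_0 ell2_0 l2ip_def)
  next
    case (insert v T)
    then obtain u where u: "u \<in> ell2" "(\<lambda>z. \<Sum>v\<in>T. c v * v z) = H u" "l2ip u a = 0" by auto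
    obtain \<nu> where \<nu>: "\<nu> \<in> \<Lambda>" "v = H (kcoef \<nu>)" using insert.prems by (auto simp: rkernel_eq)
    have "l2ip (kcoef \<nu>) a = 0"
      using w0[OF \<nu>(1)] H_eval[OF a(1), of \<nu>] a(2) l2ip_commute[of "kcoef \<nu>" a] by simp
    then have "l2ip (\<lambda>n. u n + c v * kcoef \<nu> n) a = 0"
      using u a kcoef_ell2 by (simp add: l2ip_add_left ell2_scale l2ip_scale_left)
    moreover have "(\<lambda>z. \<Sum>v\<in>insert v T. c v * v z) = H (\<lambda>n. u n + c v * kcoef \<nu> n)"
      unfolding H_lin[OF u(1) kcoef_ell2] u(2)[symmetric] using insert.hyps \<nu>(2) by (simp add: add.commute)
    moreover have "(\<lambda>n. u n + c v * kcoef \<nu> n) \<in> ell2" by (intro ell2_add ell2_scale u kcoef_ell2)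
    ultimately show ?case by blast
  qed
  then obtain u where u: "u \<in> ell2" "g = H u" "l2ip u a = 0" unfolding T(1) by blast
  have "H (\<lambda>n. kcoef \<mu> n + (-1) * u n) = (\<lambda>z. H (kcoef \<mu>) z + (-1) * H u z)" by (rule H_lin[OF kcoef_ell2 u(1)])
  then have "(\<lambda>z. rkernel b \<mu> z - g z) = H (\<lambda>n. kcoef \<mu> n - u n)" by (simp add: rkernel_eq u(2))
  moreover have d: "(\<lambda>n. kcoef \<mu> n - u n) \<in> ell2" by (intro ell2_diff kcoef_ell2 u)
  ultimately have le: "sqrt (l2sq (\<lambda>n. kcoef \<mu> n - u n)) < \<epsilon>" using g(2) by (simp add: hnorm_H)
  have "l2ip (kcoef \<mu>) a = 1"
    using w1 H_eval[OF a(1), of \<mu>] a(2) l2ip_commute[of "kcoef \<mu>" a] by simp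
  then have "l2ip (\<lambda>n. kcoef \<mu> n - u n) a = 1" using u a kcoef_ell2 by (simp add: l2ip_diff_left)
  then have "1 \<le> sqrt (l2sq (\<lambda>n. kcoef \<mu> n - u n)) * sqrt (l2sq a)"
    using l2_cauchy_schwarz[OF d a(1)] by simp
  also have "\<dots> \<le> \<epsilon> * sqrt (l2sq a)" using le s0 by (intro mult_right_mono) auto
  also have "\<dots> < 1"
  proof -
    have "0 < 1 + sqrt (l2sq a)" using s0 by linarith
    then show ?thesis unfolding \<epsilon>_def by (simp add: divide_less_eq_1_pos)
  qed
  finally show False by simp
qed

end

section \<open>The exact system\<close>

lemma norm_trig_imag:
  "(norm (sin (of_real pi * (\<i> * of_real y))))\<^sup>2 = (cosh (2 * (pi * y)) - 1) / 2"
  "(norm (cos (of_real pi * (\<i> * of_real y))))\<^sup>2 = (cosh (2 * (pi * y)) + 1) / 2"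
  by (simp_all only: norm_sin_cosh norm_cos_cosh) simp_all

lemma norm_cos_imag_le:
  assumes "\<bar>y\<bar> \<ge> 1"
  shows "norm (cos (of_real pi * (\<i> * of_real y))) \<le> 2 * norm (sinpi (\<i> * of_real y))"
proof (rule power2_le_imp_le)
  define t where "t = \<bar>2 * (pi * y)\<bar>"
  have "2 * (3 * 1) \<le> 2 * (pi * \<bar>y\<bar>)" using assms pi_gt3 by (intro mult_mono) auto
  then have "t \<ge> 6" by (simp add: t_def abs_mult)
  then have "exp t \<ge> 7" using exp_ge_add_one_self[of t] by linarith
  then have "exp t + exp (- t) \<ge> 7" using exp_ge_zero[of "- t"] by linarith
  then have "cosh t \<ge> 7/2" by (simp add: cosh_def)
  then have "cosh (2 * (pi * y)) \<ge> 7/2" unfolding t_def cosh_real_abs .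
  then show "(norm (cos (of_real pi * (\<i> * of_real y))))\<^sup>2 \<le> (2 * norm (sinpi (\<i> * of_real y)))\<^sup>2"
    unfolding power_mult_distrib sinpi_def norm_trig_imag by simp
qed simp

lemma norm_cos_imag_ge: "norm (cos (of_real pi * (\<i> * of_real y))) \<ge> exp (pi * \<bar>y\<bar>) / 2"
proof (rule power2_le_imp_le)
  have "(exp (pi * \<bar>y\<bar>) / 2)\<^sup>2 = exp \<bar>2 * (pi * y)\<bar> / 4"
    by (simp add: power_divide power2_eq_square abs_mult flip: exp_add)
  also have "\<dots> \<le> cosh \<bar>2 * (pi * y)\<bar> / 2" by (simp add: cosh_def)
  also have "\<dots> = cosh (2 * (pi * y)) / 2" by simp
  also have "\<dots> \<le> (cosh (2 * (pi * y)) + 1) / 2" by simp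
  also have "\<dots> = (norm (cos (of_real pi * (\<i> * of_real y))))\<^sup>2" by (rule norm_trig_imag(2)[symmetric])
  finally show "(exp (pi * \<bar>y\<bar>) / 2)\<^sup>2 \<le> (norm (cos (of_real pi * (\<i> * of_real y))))\<^sup>2" .
qed simp

context truncated_levels
begin

abbreviation S :: "complex \<Rightarrow> complex" where "S \<equiv> hprod B"

text \<open>The index 0 is left out too, which splits off \<open>1 - 4 * z\<^sup>2\<close>. This
  gives the product of \<open>G\<close> and \<open>S\<close> quadratic decay at the integers, enough
  to outweigh the linear loss in the lower bound for \<open>S\<close> and to make it square summable
  there.\<close>

definition G :: "complex \<Rightarrow> complex" where "G = hprod (- B - {0})"

definition weight :: "int \<Rightarrow> real" where "weight n = (norm (G (of_int n)))\<^sup>2"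

lemma holomorphic_G: "G holomorphic_on A" unfolding G_def by (rule holomorphic_hprod)

lemma cos_factorization: "cos (of_real pi * z) = (1 - 4 * z\<^sup>2) * (G z * S z)"
proof -
  have "hprod {0} z * (hprod (- B - {0}) z * hprod B z) = hprod {0} z * hprod ((- B - {0}) \<union> B) z"
    by (subst hprod_mult) auto
  also have "\<dots> = hprod ({0} \<union> ((- B - {0}) \<union> B)) z"
    using zero_notin_B by (subst hprod_mult) auto
  also have "{0} \<union> ((- B - {0}) \<union> B) = UNIV" by auto
  finally show ?thesis by (simp add: G_def hprod_UNIV hprod_finite hfac_def power_divide mult.commute)
qed

lemma S_imag_ne_0: "S (\<i> * of_real y) \<noteq> 0"
  using norm_hprod_imag_ge_1[of B y] by auto

text \<open>Zeros of \<open>G\<close> are zeros of the cosine, hence half-integers; a multiple zero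
  of \<open>G\<close> would be a multiple zero of the cosine, which has only simple ones.\<close>

lemma G_zero:
  assumes "G \<xi> = 0"
  shows "Im \<xi> = 0" "\<xi> \<notin> \<int>" "deriv G \<xi> \<noteq> 0"
proof -
  have c0: "cos (of_real pi * \<xi>) = 0" by (simp add: cos_factorization assms)
  then obtain n :: int where "of_real pi * \<xi> = of_real (of_int n * pi + pi / 2)"
    unfolding cos_eq_0 by auto
  also have "\<dots> = of_real pi * of_real (of_int n + 1/2)" by (simp add: algebra_simps)
  finally have l: "\<xi> = of_real (of_int n + 1/2)" by simp
  then show "Im \<xi> = 0" by simp
  show ni: "\<xi> \<notin> \<int>"
  proof
    assume "\<xi> \<in> \<int>"
    then obtain m where m: "\<xi> = of_int m" by (rule Ints_cases)
    have "cospi m = 0" using c0 unfolding m cospi_def .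
    then show False by simp
  qed
  have s0: "sin (of_real pi * \<xi>) \<noteq> 0" using ni sinpi_eq_0_iff[of \<xi>] unfolding sinpi_def by blast
  show "deriv G \<xi> \<noteq> 0"
  proof
    assume d0: "deriv G \<xi> = 0"
    have dG: "(G has_field_derivative 0) (at \<xi>)"
      using holomorphic_derivI[OF holomorphic_G open_UNIV, of \<xi>] d0 by simp
    have dS: "(S has_field_derivative deriv S \<xi>) (at \<xi>)"
      using holomorphic_derivI[OF holomorphic_hprod open_UNIV, of \<xi>] by simp
    have "((\<lambda>z. (1 - 4 * z\<^sup>2) * (G z * S z)) has_field_derivative 0) (at \<xi>)"
      by (rule derivative_eq_intros dG dS refl)+ (simp add: assms)
    moreover have "((\<lambda>z. cos (of_real pi * z)) has_field_derivative - sin (of_real pi * \<xi>) * of_real pi) (at \<xi>)"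
      by (auto intro!: derivative_eq_intros)
    ultimately have "- sin (of_real pi * \<xi>) * of_real pi = 0"
      unfolding cos_factorization[symmetric] by (rule DERIV_unique[rotated])
    with s0 show False by simp
  qed
qed

lemma G_of_int_ne_0: "G (of_int n) \<noteq> 0"
  using G_zero(2)[of "of_int n"] by auto

lemma weight_pos: "weight n > 0" using G_of_int_ne_0[of n] by (simp add: weight_def)

lemma sqrt_weight: "sqrt (weight n) = norm (G (of_int n))" by (simp add: weight_def)

lemma one_plus_square_le:
  fixes n :: int
  shows "(1 + \<bar>real_of_int n\<bar>)\<^sup>2 \<le> 4 * norm (1 - 4 * (of_int n)\<^sup>2 :: complex)"
    and "3 + \<bar>real_of_int n\<bar> \<le> 4 * norm (1 - 4 * (of_int n)\<^sup>2 :: complex)"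
proof -
  define k where "k = \<bar>real_of_int n\<bar>"
  have "norm (1 - 4 * (of_int n)\<^sup>2 :: complex) = \<bar>1 - 4 * k\<^sup>2\<bar>"
    using norm_of_real[of "1 - 4 * (real_of_int n)\<^sup>2", where 'a = complex] by (simp add: k_def)
  moreover have "(1 + k)\<^sup>2 \<le> 4 * \<bar>1 - 4 * k\<^sup>2\<bar> \<and> 3 + k \<le> 4 * \<bar>1 - 4 * k\<^sup>2\<bar>"
  proof (cases "n = 0")
    case False
    then have "k \<ge> 1" by (simp add: k_def)
    then have "1 * k \<le> k * k" by (intro mult_right_mono) auto
    then have kk: "k \<le> k * k" "1 \<le> k * k" using \<open>k \<ge> 1\<close> by linarith+
    have "1 - 4 * k\<^sup>2 = 1 - 4 * (k * k)" by (simp only: power2_eq_square)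
    then have "\<bar>1 - 4 * k\<^sup>2\<bar> = 4 * (k * k) - 1" using kk by simp
    moreover have "(1 + k)\<^sup>2 = 1 + 2 * k + k * k" by (simp add: power2_eq_square algebra_simps)
    ultimately show ?thesis using kk by simp
  qed (simp add: k_def)
  ultimately show "(1 + \<bar>real_of_int n\<bar>)\<^sup>2 \<le> 4 * norm (1 - 4 * (of_int n)\<^sup>2 :: complex)"
    "3 + \<bar>real_of_int n\<bar> \<le> 4 * norm (1 - 4 * (of_int n)\<^sup>2 :: complex)"
    unfolding k_def by simp_all
qed

text \<open>At an integer the cosine has modulus 1, so the factorization turns the lower bound for
  \<open>S\<close> from \<open>norm_hprod_B_ge_at_int\<close> into an upper bound for
  \<open>G\<close>.\<close>

lemma norm_G_of_int_le: "norm (G (of_int n)) \<le> 8"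
proof -
  define k where "k = \<bar>real_of_int n\<bar>"
  define m where "m = norm (1 - 4 * (of_int n)\<^sup>2 :: complex)"
  have e: "m * (norm (G (of_int n)) * norm (S (of_int n))) = 1"
    using cos_factorization[of "of_int n"] norm_cospi[of n] by (simp add: cospi_def m_def norm_mult[symmetric])
  have s: "norm (S (of_int n)) \<ge> 1 / (2 * (3 + k))" unfolding k_def by (rule norm_hprod_B_ge_at_int)
  have k0: "k \<ge> 0" by (simp add: k_def)
  have ks: "3 + k \<le> 4 * m" unfolding k_def m_def by (rule one_plus_square_le)
  then have m0: "m > 0" using k0 by linarith
  have "norm (G (of_int n)) * (m * (1 / (2 * (3 + k)))) \<le> norm (G (of_int n)) * (m * norm (S (of_int n)))"
    using s m0 by (intro mult_left_mono) auto
  also have "\<dots> = 1" using e by (simp add: mult_ac)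
  finally have "norm (G (of_int n)) * m \<le> 2 * (3 + k)" using k0 by (simp add: field_simps)
  also have "\<dots> \<le> 8 * m" using ks by simp
  finally have "norm (G (of_int n)) * m \<le> 8 * m" .
  then show ?thesis using m0 by (simp only: mult_le_cancel_right_pos)
qed

sublocale bounded_weight weight 64
proof
  show "weight n > 0" for n by (rule weight_pos)
  show "weight n \<le> 64" for n
    using power_mono[OF norm_G_of_int_le norm_ge_zero, of n 2] by (simp add: weight_def)
qed

lemma norm_quadratic_ge_1: "norm z \<ge> 1 \<Longrightarrow> norm (1 - 4 * z\<^sup>2 :: complex) \<ge> 1"
proof -
  assume "norm z \<ge> 1"
  then have "1 \<le> (norm z)\<^sup>2" by simp
  moreover have "norm (4 * z\<^sup>2) - norm (1::complex) \<le> norm (1 - 4 * z\<^sup>2)"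
    using norm_triangle_ineq2[of "4 * z\<^sup>2" 1] by (simp add: norm_minus_commute)
  ultimately show ?thesis by (simp add: norm_mult norm_power)
qed

lemma norm_quadratic_le: "norm (1 - 4 * z\<^sup>2 :: complex) \<le> 1 + 4 * (norm z)\<^sup>2"
  using norm_triangle_ineq4[of 1 "4 * z\<^sup>2"] by (simp add: norm_mult norm_power)

lemma norm_quadratic_imag: "norm (1 - 4 * (\<i> * of_real y)\<^sup>2 :: complex) = 1 + 4 * y\<^sup>2"
proof -
  have "(1 - 4 * (\<i> * of_real y)\<^sup>2 :: complex) = of_real (1 + 4 * y\<^sup>2)" by (simp add: power_mult_distrib)
  then show ?thesis by (simp only: norm_of_real) simp
qed

lemma norm_G_div_sinpi_circle:
  assumes z: "norm z = real n + 1/4" "n \<ge> 1"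
  shows "norm (G z) \<le> 6 * (3 + norm z) * norm (sinpi z)"
proof -
  have "norm (1 - 4 * z\<^sup>2) * (norm (G z) * norm (S z)) = norm (cos (of_real pi * z))"
    unfolding cos_factorization norm_mult ..
  also have "\<dots> \<le> 3 * norm (sinpi z)" unfolding sinpi_def by (rule trig_on_circle[OF z(1)])
  finally have u: "norm (1 - 4 * z\<^sup>2) * (norm (G z) * norm (S z)) \<le> 3 * norm (sinpi z)" .
  have "1 * (norm (G z) * (1 / (2 * (3 + norm z)))) \<le> norm (1 - 4 * z\<^sup>2) * (norm (G z) * norm (S z))"
    using norm_hprod_B_ge_on_circle[OF z(1)] z
    by (intro mult_mono norm_quadratic_ge_1) (auto intro: divide_nonneg_nonneg mult_nonneg_nonneg)
  with u have "norm (G z) * (1 / (2 * (3 + norm z))) \<le> 3 * norm (sinpi z)" by linarith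
  moreover have "3 + norm z > 0" by (intro add_pos_nonneg) auto
  ultimately show ?thesis by (simp add: field_simps)
qed

lemma norm_G_div_sinpi_imag:
  assumes "\<bar>y\<bar> \<ge> 1"
  shows "norm (G (\<i> * of_real y)) \<le> 2 * norm (sinpi (\<i> * of_real y))"
proof -
  have "1 * (norm (G (\<i> * of_real y)) * 1) \<le> norm (1 - 4 * (\<i> * of_real y)\<^sup>2) * (norm (G (\<i> * of_real y)) * norm (S (\<i> * of_real y)))"
    unfolding norm_quadratic_imag by (intro mult_mono norm_hprod_imag_ge_1) auto
  also have "\<dots> = norm (cos (of_real pi * (\<i> * of_real y)))" unfolding cos_factorization norm_mult ..
  also have "\<dots> \<le> 2 * norm (sinpi (\<i> * of_real y))" by (rule norm_cos_imag_le[OF assms])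
  finally show ?thesis by simp
qed

lemma linear_le_exp: "\<epsilon> > 0 \<Longrightarrow> r \<ge> 0 \<Longrightarrow> 3 + r \<le> (3 + 1 / \<epsilon>) * exp (\<epsilon> * (r::real))"
proof -
  assume e: "\<epsilon> > 0" "r \<ge> 0"
  have x: "exp (\<epsilon> * r) \<ge> 1 + \<epsilon> * r" by (rule exp_ge_add_one_self)
  have "\<epsilon> * r \<le> exp (\<epsilon> * r)" using x by linarith
  then have "r \<le> 1 / \<epsilon> * exp (\<epsilon> * r)" using e by (simp add: field_simps)
  moreover have "1 \<le> exp (\<epsilon> * r)" using e by simp
  ultimately show ?thesis unfolding distrib_right by linarith
qed

definition dual :: "complex \<Rightarrow> complex \<Rightarrow> complex" where
  "dual \<xi> z = (if z = \<xi> then 1 else G z / (deriv G \<xi> * (z - \<xi>)))"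

text \<open>Dividing the values at the integers by \<open>sqrt (weight n)\<close> removes the
  modulus of \<open>G\<close>, leaving coefficients of size comparable to the inverse distance from
  \<open>n\<close> to \<xi>. On the circles \<open>G\<close> exceeds the sine at most by a linear
  factor, thanks to the lower bound for \<open>S\<close>.\<close>

lemma dual_in_hspace:
  assumes \<xi>: "G \<xi> = 0"
  shows "dual \<xi> \<in> hspace weight"
proof -
  note G0 = G_zero[OF \<xi>]
  define d where "d = deriv G \<xi>"
  have d0: "d \<noteq> 0" using G0 by (simp add: d_def)
  have hol: "dual \<xi> holomorphic_on UNIV"
  proof -
    have "(\<lambda>z. (if z = \<xi> then deriv G \<xi> else (G z - G \<xi>) / (z - \<xi>)) * (1 / d)) holomorphic_on UNIV"
      by (intro holomorphic_intros pole_lemma_open[OF holomorphic_G] open_UNIV)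
    also have "(\<lambda>z. (if z = \<xi> then deriv G \<xi> else (G z - G \<xi>) / (z - \<xi>)) * (1 / d)) = dual \<xi>"
      using d0 by (auto simp: dual_def \<xi> d_def)
    finally show ?thesis .
  qed
  have s0: "sinpi \<xi> \<noteq> 0" using G0 by (simp add: sinpi_eq_0_iff)
  have ne: "\<xi> \<noteq> of_int n" for n using G0(2) by auto
  \<comment> \<open>\<open>sker n \<xi> / sinpi \<xi>\<close> is
    \<open>1 / (\<xi> - of_int n)\<close>; in this form the square summability is that of the
    kernels. The minus sign produces \<open>of_int n - \<xi>\<close>.\<close>
  define a where "a = (\<lambda>n. - cospi n * (G (of_int n) / of_real (norm (G (of_int n)))) * (sker n \<xi> / (of_real pi * d * sinpi \<xi>)))"
  have a: "a \<in> ell2"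
    by (rule ell2_dominated[OF ell2_sker[of \<xi>], where C = "1 / norm (of_real pi * d * sinpi \<xi>)"])
       (simp add: a_def norm_mult norm_divide G_of_int_ne_0)
  have "dual \<xi> z = hsum (wt a) z" for z
  proof (rule interpolation_formula[OF hol wt_ell2[OF a]])
    show "dual \<xi> (of_int n) = of_real pi * cospi n * wt a n" for n
    proof -
      have g: "G (of_int n) / of_real (norm (G (of_int n))) * of_real (norm (G (of_int n))) = G (of_int n)"
        using G_of_int_ne_0[of n] by simp
      have k: "sker n \<xi> / (of_real pi * d * sinpi \<xi>) = - 1 / (of_real pi * d * (of_int n - \<xi>))"
        using s0 ne[of n] d0 by (simp add: sker_def field_simps)
      have "of_real pi * cospi n * wt a n = of_real pi * (- (cospi n * cospi n)) *
          (G (of_int n) / of_real (norm (G (of_int n))) * of_real (norm (G (of_int n)))) * (sker n \<xi> / (of_real pi * d * sinpi \<xi>))"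
        by (simp only: wt_def a_def sqrt_weight) (simp only: mult_ac minus_mult_left[symmetric] minus_mult_right[symmetric])
      also have "\<dots> = G (of_int n) / (d * (of_int n - \<xi>))"
        unfolding g k cospi_square using ne[of n] d0 by (simp add: field_simps)
      finally show ?thesis using ne[of n] by (simp add: dual_def d_def)
    qed
    show "\<exists>C N. \<forall>n\<ge>N. \<forall>z. norm z = real n + 1/4 \<longrightarrow> norm (dual \<xi> z / sinpi z) \<le> C * exp (\<epsilon> * norm z)" if \<epsilon>: "\<epsilon> > 0" for \<epsilon>
    proof (intro exI allI impI)
      fix n and z :: complex assume n: "n \<ge> nat \<lceil>norm \<xi>\<rceil> + 1" and z: "norm z = real n + 1/4"
      have "norm \<xi> + 1 \<le> norm z" using n z by linarith
      then have zl: "norm (z - \<xi>) \<ge> 1" using norm_triangle_ineq2[of z \<xi>] by linarith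
      have "norm (dual \<xi> z / sinpi z) = norm (G z) / norm (sinpi z) * (1 / (norm d * norm (z - \<xi>)))"
        using zl by (auto simp: dual_def d_def norm_divide norm_mult)
      also have "\<dots> \<le> (6 * (3 + norm z)) * (1 / norm d)"
      proof (rule mult_mono)
        have "norm (sinpi z) > 0" using sinpi_ne_0_on_circle[OF z] by simp
        then show "norm (G z) / norm (sinpi z) \<le> 6 * (3 + norm z)"
          using norm_G_div_sinpi_circle[OF z] n by (simp add: pos_divide_le_eq)
        have "norm d * 1 \<le> norm d * norm (z - \<xi>)" using zl by (intro mult_left_mono) auto
        then show "1 / (norm d * norm (z - \<xi>)) \<le> 1 / norm d" using d0 zl by (intro divide_left_mono mult_pos_pos) auto
      qed auto
      also have "\<dots> \<le> (6 * ((3 + 1 / \<epsilon>) * exp (\<epsilon> * norm z))) * (1 / norm d)"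
        using linear_le_exp[OF \<epsilon>, of "norm z"] by (intro mult_right_mono mult_left_mono) auto
      finally show "norm (dual \<xi> z / sinpi z) \<le> (6 * (3 + 1 / \<epsilon>) * (1 / norm d)) * exp (\<epsilon> * norm z)"
        by (simp only: mult_ac)
    qed
    have imag: "norm (dual \<xi> (\<i> * of_real y) / sinpi (\<i> * of_real y)) \<le> 2 / norm d * (1 / \<bar>y\<bar>)" if y: "\<bar>y\<bar> \<ge> 1" for y
    proof -
      have zl: "norm (\<i> * of_real y - \<xi>) \<ge> \<bar>y\<bar>" using abs_Im_le_cmod[of "\<i> * of_real y - \<xi>"] G0(1) by simp
      have sp: "norm (sinpi (\<i> * of_real y)) > 0" using imag_not_int[of y] y by (auto simp: sinpi_eq_0_iff)
      have "\<i> * of_real y \<noteq> \<xi>" using zl y by auto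
      then have "norm (dual \<xi> (\<i> * of_real y) / sinpi (\<i> * of_real y)) =
          norm (G (\<i> * of_real y)) / norm (sinpi (\<i> * of_real y)) * (1 / (norm d * norm (\<i> * of_real y - \<xi>)))"
        by (auto simp: dual_def d_def norm_divide norm_mult)
      also have "\<dots> \<le> 2 * (1 / (norm d * \<bar>y\<bar>))"
      proof (rule mult_mono)
        show "norm (G (\<i> * of_real y)) / norm (sinpi (\<i> * of_real y)) \<le> 2"
          using norm_G_div_sinpi_imag[OF y] sp by (simp add: pos_divide_le_eq)
        show "1 / (norm d * norm (\<i> * of_real y - \<xi>)) \<le> 1 / (norm d * \<bar>y\<bar>)"
          using zl d0 y by (intro divide_left_mono mult_left_mono mult_pos_pos) auto
      qed auto
      finally show ?thesis by simp
    qed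
    show "norm (dual \<xi> (\<i> * of_real y) / sinpi (\<i> * of_real y)) \<le> 2 / norm d" if y: "\<bar>y\<bar> \<ge> 1" for y
    proof -
      have "2 / norm d * (1 / \<bar>y\<bar>) \<le> 2 / norm d * 1" using y by (intro mult_left_mono) auto
      with imag[OF y] show ?thesis by linarith
    qed
    show "((\<lambda>y. dual \<xi> (\<i> * of_real y) / sinpi (\<i> * of_real y)) \<longlongrightarrow> 0) at_top"
    proof (rule Lim_null_comparison)
      show "\<forall>\<^sub>F y in at_top. norm (dual \<xi> (\<i> * of_real y) / sinpi (\<i> * of_real y)) \<le> 2 / norm d * (1 / \<bar>y\<bar>)"
        using eventually_ge_at_top[of 1] by eventually_elim (rule imag, simp)
      show "((\<lambda>y. 2 / norm d * (1 / \<bar>y\<bar>)) \<longlongrightarrow> 0) at_top" by real_asymp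
    qed
  qed
  then have "dual \<xi> = H a" by (auto simp: H_def)
  with a show ?thesis by (simp add: hspace_eq)
qed

text \<open>The product \<open>U\<close> of \<open>G\<close> and \<open>S\<close> has modulus
  \<open>1 / norm (1 - 4 * (of_int n)\<^sup>2)\<close> at \<open>n\<close>, is at most 3 times the
  sine on the circles, and decays quadratically against it on the imaginary axis. So
  \<open>U / sinpi\<close> is the Cauchy sum of its residues \<open>c n\<close>.\<close>

lemma sspace_S: "S \<in> sspace weight G"
proof -
  define U where "U = (\<lambda>z. G z * S z)"
  have hol: "U holomorphic_on UNIV" unfolding U_def by (intro holomorphic_intros holomorphic_G holomorphic_hprod)
  have cosU: "cos (of_real pi * z) = (1 - 4 * z\<^sup>2) * U z" for z using cos_factorization by (simp add: U_def)
  define c where "c = (\<lambda>n. cospi n * U (of_int n) / of_real pi)"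
  have nU: "norm (U (of_int n)) \<le> 4 / (1 + \<bar>real_of_int n\<bar>)\<^sup>2" for n
  proof -
    define m where "m = norm (1 - 4 * (of_int n)\<^sup>2 :: complex)"
    have e: "m * norm (U (of_int n)) = 1"
      using cosU[of "of_int n"] norm_cospi[of n] by (simp add: cospi_def m_def norm_mult[symmetric])
    have "norm (U (of_int n)) * (1 + \<bar>real_of_int n\<bar>)\<^sup>2 \<le> norm (U (of_int n)) * (4 * m)"
      unfolding m_def by (intro mult_left_mono one_plus_square_le) auto
    also have "\<dots> = 4" using e by (simp add: mult_ac)
    finally have "norm (U (of_int n)) * (1 + \<bar>real_of_int n\<bar>)\<^sup>2 \<le> 4" .
    moreover have "(1 + \<bar>real_of_int n\<bar>)\<^sup>2 > 0" by (intro zero_less_power) simp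
    ultimately show ?thesis by (simp add: pos_le_divide_eq)
  qed
  have Ul: "(\<lambda>n. U (of_int n)) \<in> ell2"
  proof (rule ell2_dominated[OF inverse_ell2[of 4], where C = 1])
    fix n
    have "(1 + \<bar>real_of_int n\<bar>) * 1 \<le> (1 + \<bar>real_of_int n\<bar>) * (1 + \<bar>real_of_int n\<bar>)" by (intro mult_left_mono) auto
    then have "4 / (1 + \<bar>real_of_int n\<bar>)\<^sup>2 \<le> 4 / (1 + \<bar>real_of_int n\<bar>)"
      by (intro divide_left_mono) (auto simp: power2_eq_square intro: add_pos_nonneg)
    with nU[of n] show "cmod (U (of_int n)) \<le> 1 * cmod (of_real (4 / (1 + \<bar>real_of_int n\<bar>)))"
      unfolding norm_of_real by linarith
  qed
  have c: "c \<in> ell2"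
    by (rule ell2_dominated[OF Ul, where C = "1 / pi"]) (simp add: c_def norm_mult norm_divide)
  have "U z = hsum c z" for z
  proof (rule interpolation_formula[OF hol c])
    show "U (of_int n) = of_real pi * cospi n * c n" for n
    proof -
      have "of_real pi * cospi n * c n = (cospi n * cospi n) * U (of_int n)" by (simp add: c_def)
      then show ?thesis by simp
    qed
    show "\<exists>C N. \<forall>n\<ge>N. \<forall>z. norm z = real n + 1/4 \<longrightarrow> norm (U z / sinpi z) \<le> C * exp (\<epsilon> * norm z)" if \<epsilon>: "\<epsilon> > 0" for \<epsilon>
    proof (intro exI allI impI)
      fix n :: nat and z :: complex assume n: "n \<ge> 1" and z: "norm z = real n + 1/4"
      have sp: "norm (sinpi z) > 0" using sinpi_ne_0_on_circle[OF z] by simp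
      have "1 * norm (U z) \<le> norm (1 - 4 * z\<^sup>2) * norm (U z)" using n z by (intro mult_right_mono norm_quadratic_ge_1) auto
      also have "\<dots> \<le> 3 * norm (sinpi z)" using trig_on_circle(2)[OF z] unfolding cosU norm_mult sinpi_def .
      finally have "norm (U z / sinpi z) \<le> 3" using sp by (simp add: norm_divide pos_divide_le_eq)
      also have "3 * 1 \<le> 3 * exp (\<epsilon> * norm z)" using \<epsilon> by (intro mult_left_mono) auto
      finally show "norm (U z / sinpi z) \<le> 3 * exp (\<epsilon> * norm z)" by simp
    qed
    have imag: "norm (U (\<i> * of_real y) / sinpi (\<i> * of_real y)) \<le> 2 / (1 + 4 * y\<^sup>2)" if y: "\<bar>y\<bar> \<ge> 1" for y
    proof -
      have sp: "norm (sinpi (\<i> * of_real y)) > 0" using imag_not_int[of y] y by (auto simp: sinpi_eq_0_iff)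
      have p: "1 + 4 * y\<^sup>2 > 0" by (intro add_pos_nonneg) auto
      have "(1 + 4 * y\<^sup>2) * norm (U (\<i> * of_real y)) \<le> 2 * norm (sinpi (\<i> * of_real y))"
        using norm_cos_imag_le[OF y] unfolding cosU norm_mult norm_quadratic_imag .
      then show ?thesis using sp p by (simp add: norm_divide field_simps)
    qed
    show "norm (U (\<i> * of_real y) / sinpi (\<i> * of_real y)) \<le> 2" if y: "\<bar>y\<bar> \<ge> 1" for y
    proof -
      have "2 / (1 + 4 * y\<^sup>2) \<le> 2 / 1" by (intro divide_left_mono) (auto intro: add_pos_nonneg)
      with imag[OF y] show ?thesis by linarith
    qed
    show "((\<lambda>y. U (\<i> * of_real y) / sinpi (\<i> * of_real y)) \<longlongrightarrow> 0) at_top"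
    proof (rule Lim_null_comparison)
      show "\<forall>\<^sub>F y in at_top. norm (U (\<i> * of_real y) / sinpi (\<i> * of_real y)) \<le> 2 / (1 + 4 * y\<^sup>2)"
        using eventually_ge_at_top[of 1] by eventually_elim (rule imag, simp)
      show "((\<lambda>y::real. 2 / (1 + 4 * y\<^sup>2)) \<longlongrightarrow> 0) at_top" by real_asymp
    qed
  qed
  then have Uc: "U z / sinpi z = csum c z" if "z \<notin> \<int>" for z
    using csum_has_sum(2)[OF c that] that by (simp add: sinpi_eq_0_iff)
  \<comment> \<open>The kernel norm at \<open>n\<close> is pi times the modulus of \<open>G\<close>,
    so \<open>a\<close> and \<open>pi * c\<close> differ only by unimodular factors; the sign
    accounts for \<open>of_int m - z\<close> in \<open>sspace\<close> against
    \<open>z - of_int m\<close> in \<open>csum\<close>.\<close>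
  define a where "a = (\<lambda>n. - (of_real pi * c n * of_real (norm (G (of_int n))) / G (of_int n)))"
  have a: "a \<in> ell2"
    by (rule ell2_dominated[OF c, where C = pi]) (simp add: a_def norm_mult norm_divide G_of_int_ne_0)
  show ?thesis
    unfolding sspace_def mem_Collect_eq
  proof (intro conjI bexI[OF _ a] allI impI holomorphic_hprod)
    fix z :: complex assume z: "z \<notin> \<int>"
    have "a m / of_real (hnorm weight (rkernel weight (of_int m))) * (G (of_int m) / (of_int m - z)) = c m / (z - of_int m)" for m
    proof -
      have "of_int m - z \<noteq> 0" "z - of_int m \<noteq> 0" using z by auto
      then show ?thesis
        using G_of_int_ne_0[of m] by (simp add: a_def hnorm_rkernel_of_int sqrt_weight field_simps)
    qed
    then show "((\<lambda>m. a m / of_real (hnorm weight (rkernel weight (of_int m))) * (G (of_int m) / (of_int m - z)))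
       has_sum G z * S z / sinpi z) UNIV"
      using csum_has_sum(1)[OF c z] Uc[OF z] by (simp add: U_def)
  qed
qed

text \<open>\<open>h / sinpi\<close> is a Cauchy sum, bounded away from the integers, and
  \<open>1 / G\<close> is \<open>(1 - 4 * z\<^sup>2) * S z\<close> divided by the cosine. Where sine
  and cosine are comparable, the cofactor \<open>T\<close> therefore grows no faster than
  \<open>S\<close> times a polynomial, which carries type zero from \<open>S\<close> to
  \<open>T\<close>.\<close>

lemma vanishing_on_zeros_imp_0:
  assumes h: "h \<in> hspace weight" and h0: "\<And>\<mu>. G \<mu> = 0 \<Longrightarrow> h \<mu> = 0"
  shows "h = (\<lambda>z. 0)"
proof -
  obtain a where a: "a \<in> ell2" "h = H a" using h by (auto simp: hspace_eq)
  have hh: "h = hsum (wt a)" using a by (simp add: H_def)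
  have holh: "h holomorphic_on UNIV" unfolding hh by (rule holomorphic_hsum[OF wt_ell2[OF a(1)]])
  obtain T where T: "T holomorphic_on UNIV" "\<And>z. h z = G z * T z"
    using entire_quotient[OF holh holomorphic_G] h0 G_zero(3) by blast
  define L where "L = l2sq (wt a) + 64 * inv_sq_sum"
  have L: "norm (csum (wt a) z) \<le> L" if "\<And>n::int. norm (z - of_int n) \<ge> 1/4" for z
    unfolding L_def by (rule norm_csum_le[OF wt_ell2[OF a(1)] that])
  have key: "T z * cos (of_real pi * z) = sinpi z * csum (wt a) z * ((1 - 4 * z\<^sup>2) * S z)" if "z \<notin> \<int>" for z
  proof -
    have "T z * cos (of_real pi * z) = (G z * T z) * ((1 - 4 * z\<^sup>2) * S z)" unfolding cos_factorization by simp
    also have "G z * T z = sinpi z * csum (wt a) z"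
      using T(2)[of z] csum_has_sum(2)[OF wt_ell2[OF a(1)] that] hh by simp
    finally show ?thesis .
  qed
  have growth: "\<exists>C\<ge>0. \<forall>z. norm ((1 - 4 * z\<^sup>2) * S z) \<le> C * exp (\<epsilon> * norm z)" if \<epsilon>: "\<epsilon> > 0" for \<epsilon>
  proof -
    obtain C where C: "\<And>z. norm (S z) \<le> C * exp (\<epsilon>/2 * norm z)" using hprod_B_zero_type[of "\<epsilon>/2"] \<epsilon> by auto
    have C0: "C \<ge> 0" using order_trans[OF norm_ge_zero C[of 0]] by simp
    define K where "K = 1 + 8 / (\<epsilon>/2)\<^sup>2"
    have K0: "K \<ge> 0" by (simp add: K_def)
    have "norm ((1 - 4 * z\<^sup>2) * S z) \<le> (K * C) * exp (\<epsilon> * norm z)" for z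
    proof -
      have "norm (1 - 4 * z\<^sup>2) \<le> K * exp (\<epsilon>/2 * norm z)"
        using order_trans[OF norm_quadratic_le quadratic_le_exp[of "\<epsilon>/2" "norm z"]] \<epsilon> by (simp add: K_def)
      then have "norm ((1 - 4 * z\<^sup>2) * S z) \<le> (K * exp (\<epsilon>/2 * norm z)) * (C * exp (\<epsilon>/2 * norm z))"
        unfolding norm_mult using C[of z] K0 by (intro mult_mono) auto
      also have "\<dots> = (K * C) * exp (\<epsilon> * norm z)" by (simp add: mult_ac flip: exp_add)
      finally show ?thesis .
    qed
    then show ?thesis using K0 C0 by (intro exI[of _ "K * C"]) auto
  qed
  have circ: "\<exists>C\<ge>0. \<forall>n z. norm z = real n + 1/4 \<longrightarrow>
      norm (T z) \<le> C * exp (\<epsilon> * norm z) \<and> norm (T z / sinpi z) \<le> C * exp (\<epsilon> * norm z)" if \<epsilon>: "\<epsilon> > 0" for \<epsilon>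
  proof -
    obtain C where C0: "C \<ge> 0" and C: "\<And>z. norm ((1 - 4 * z\<^sup>2) * S z) \<le> C * exp (\<epsilon> * norm z)" using growth[OF \<epsilon>] by auto
    have "norm (T z) \<le> (4 * \<bar>L\<bar> * C) * exp (\<epsilon> * norm z) \<and> norm (T z / sinpi z) \<le> (4 * \<bar>L\<bar> * C) * exp (\<epsilon> * norm z)"
      if z: "norm z = real n + 1/4" for n z
    proof -
      note zi = sinpi_ne_0_on_circle[OF z]
      have cp: "norm (cos (of_real pi * z)) > 0" using trig_on_circle(4)[OF z] by linarith
      have sp: "norm (sinpi z) > 0" using zi by simp
      define E where "E = norm (csum (wt a) z) * norm ((1 - 4 * z\<^sup>2) * S z)"
      have E: "0 \<le> E" "E \<le> \<bar>L\<bar> * (C * exp (\<epsilon> * norm z))"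
        unfolding E_def using C[of z] C0 L[OF dist_int_on_circle[OF z]] by (auto intro!: mult_mono)
      have k: "norm (T z) * norm (cos (of_real pi * z)) = norm (sinpi z) * E"
        using arg_cong[OF key[OF zi(1)], of norm] by (simp add: norm_mult E_def)
      have "norm (sinpi z) * E \<le> (3 * norm (cos (of_real pi * z))) * E"
        using trig_on_circle(1)[OF z] E(1) unfolding sinpi_def by (rule mult_right_mono)
      then have "norm (T z) * norm (cos (of_real pi * z)) \<le> (3 * E) * norm (cos (of_real pi * z))"
        using k by (simp add: mult_ac)
      then have 1: "norm (T z) \<le> 3 * E" using cp by (simp only: mult_le_cancel_right_pos)
      have "norm (T z / sinpi z) * norm (cos (of_real pi * z)) = E"
        using k sp by (simp add: norm_divide field_simps)
      moreover have "norm (T z / sinpi z) * (1/4) \<le> norm (T z / sinpi z) * norm (cos (of_real pi * z))"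
        using trig_on_circle(4)[OF z] by (intro mult_left_mono) auto
      ultimately have 2: "norm (T z / sinpi z) \<le> 4 * E" by linarith
      have "4 * E \<le> (4 * \<bar>L\<bar> * C) * exp (\<epsilon> * norm z)" using E(2) by simp
      then show ?thesis using 1 2 E(1) by linarith
    qed
    then show ?thesis using C0 by (intro exI[of _ "4 * \<bar>L\<bar> * C"]) auto
  qed
  define c where "c = (\<lambda>n. a n * of_real (norm (G (of_int n))) / G (of_int n))"
  have c: "c \<in> ell2" by (rule ell2_dominated[OF a(1), where C = 1]) (simp add: c_def norm_mult norm_divide G_of_int_ne_0)
  have Tn: "T (of_int n) = of_real pi * cospi n * c n" for n
  proof -
    have "G (of_int n) * T (of_int n) = of_real pi * cospi n * a n * of_real (norm (G (of_int n)))"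
      using T(2)[of "of_int n"] a(2) H_of_int[of a n] by (simp add: sqrt_weight)
    then show ?thesis using G_of_int_ne_0[of n] by (simp add: c_def field_simps)
  qed
  \<comment> \<open>Type 1 is small enough here: on the imaginary axis the cosine is at least
    \<open>exp (2 * \<bar>y\<bar>) / 2\<close>, so \<open>T / sinpi\<close> still decays like
    \<open>exp (- \<bar>y\<bar>)\<close>.\<close>
  obtain C1 where C1: "C1 \<ge> 0" "\<And>z. norm ((1 - 4 * z\<^sup>2) * S z) \<le> C1 * exp (1 * norm z)" using growth[of 1] by auto
  have imag: "norm (T (\<i> * of_real y) / sinpi (\<i> * of_real y)) \<le> 2 * \<bar>L\<bar> * C1 * exp (- \<bar>y\<bar>)" if y: "\<bar>y\<bar> \<ge> 1" for y
  proof -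
    let ?z = "\<i> * of_real y"
    have zi: "?z \<notin> \<int>" using imag_not_int[of y] y by auto
    then have sp: "norm (sinpi ?z) > 0" by (simp add: sinpi_eq_0_iff)
    have cs: "norm (csum (wt a) ?z) \<le> L"
    proof (rule L)
      show "1/4 \<le> norm (?z - of_int n)" for n using norm_diff_of_int_imag(1)[where y = y and n = n] y by linarith
    qed
    define E where "E = norm (csum (wt a) ?z) * norm ((1 - 4 * ?z\<^sup>2) * S ?z)"
    have "norm ((1 - 4 * ?z\<^sup>2) * S ?z) \<le> C1 * exp \<bar>y\<bar>" using C1(2)[of ?z] by (simp add: norm_mult)
    then have E: "E \<le> \<bar>L\<bar> * (C1 * exp \<bar>y\<bar>)"
      unfolding E_def using C1(1) cs by (intro mult_mono) auto
    have "norm (T ?z) * norm (cos (of_real pi * ?z)) = norm (sinpi ?z) * E"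
      using arg_cong[OF key[OF zi], of norm] by (simp add: norm_mult E_def)
    then have "norm (T ?z / sinpi ?z) * norm (cos (of_real pi * ?z)) = E"
      using sp by (simp add: norm_divide field_simps)
    moreover have "norm (T ?z / sinpi ?z) * (exp (2 * \<bar>y\<bar>) / 2) \<le> norm (T ?z / sinpi ?z) * norm (cos (of_real pi * ?z))"
    proof (rule mult_left_mono)
      have "2 * \<bar>y\<bar> \<le> pi * \<bar>y\<bar>" using pi_gt3 by (intro mult_right_mono) auto
      then show "exp (2 * \<bar>y\<bar>) / 2 \<le> norm (cos (of_real pi * ?z))" using norm_cos_imag_ge[of y]
        by (meson divide_right_mono exp_le_cancel_iff order_trans zero_le_numeral)
    qed simp
    ultimately have "norm (T ?z / sinpi ?z) * (exp (2 * \<bar>y\<bar>) / 2) \<le> \<bar>L\<bar> * (C1 * exp \<bar>y\<bar>)" using E by linarith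
    then have "norm (T ?z / sinpi ?z) * exp (2 * \<bar>y\<bar>) \<le> 2 * \<bar>L\<bar> * C1 * exp \<bar>y\<bar>" by simp
    then have "norm (T ?z / sinpi ?z) * exp (2 * \<bar>y\<bar>) * exp (- (2 * \<bar>y\<bar>)) \<le> 2 * \<bar>L\<bar> * C1 * exp \<bar>y\<bar> * exp (- (2 * \<bar>y\<bar>))"
      by (rule mult_right_mono) simp
    then show ?thesis by (simp add: mult.assoc flip: exp_add)
  qed
  have Tc: "T z = hsum c z" for z
  proof (rule interpolation_formula[OF T(1) c Tn])
    show "\<exists>C N. \<forall>n\<ge>N. \<forall>z. norm z = real n + 1/4 \<longrightarrow> norm (T z / sinpi z) \<le> C * exp (\<epsilon> * norm z)" if "\<epsilon> > 0" for \<epsilon>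
      using circ[OF that] by blast
    show "norm (T (\<i> * of_real y) / sinpi (\<i> * of_real y)) \<le> 2 * \<bar>L\<bar> * C1" if y: "\<bar>y\<bar> \<ge> 1" for y
    proof -
      have "2 * \<bar>L\<bar> * C1 * exp (- \<bar>y\<bar>) \<le> 2 * \<bar>L\<bar> * C1 * 1" using C1(1) by (intro mult_left_mono) auto
      with imag[OF y] show ?thesis by linarith
    qed
    show "((\<lambda>y. T (\<i> * of_real y) / sinpi (\<i> * of_real y)) \<longlongrightarrow> 0) at_top"
    proof (rule Lim_null_comparison)
      show "\<forall>\<^sub>F y in at_top. norm (T (\<i> * of_real y) / sinpi (\<i> * of_real y)) \<le> 2 * \<bar>L\<bar> * C1 * exp (- \<bar>y\<bar>)"
        using eventually_ge_at_top[of 1] by eventually_elim (rule imag, simp)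
      show "((\<lambda>y::real. 2 * \<bar>L\<bar> * C1 * exp (- \<bar>y\<bar>)) \<longlongrightarrow> 0) at_top" by real_asymp
    qed
  qed
  \<comment> \<open>The substitution carries the imaginary axis to the line \<open>Im z = 1\<close>.
    That line keeps distance 1 from the integers and the sine is bounded on it, so the interpolation
    series bounds \<open>T\<close> there.\<close>
  define f where "f = (\<lambda>w. T (\<i> - \<i> * w))"
  have holf: "f holomorphic_on UNIV"
    unfolding f_def by (rule holomorphic_on_compose_gen[of "\<lambda>w. \<i> - \<i> * w" UNIV T UNIV, unfolded o_def])
      (use T(1) in \<open>auto intro!: holomorphic_intros\<close>)
  have typef: "\<exists>C. \<forall>w. norm (f w) \<le> C * exp (\<epsilon> * norm w)" if \<epsilon>: "\<epsilon> > 0" for \<epsilon>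
  proof -
    obtain C0 where C0: "C0 \<ge> 0" "\<And>n z. norm z = real n + 1/4 \<Longrightarrow> norm (T z) \<le> C0 * exp (\<epsilon> * norm z)" using circ[OF \<epsilon>] by blast
    obtain C where C: "\<And>z. norm (T z) \<le> C * exp (\<epsilon> * norm z)"
      using zero_type_from_circles[OF T(1) \<epsilon>, of 0 C0] C0(2) by blast
    have C': "C \<ge> 0" using order_trans[OF norm_ge_zero C[of 0]] by simp
    have "norm (f w) \<le> (C * exp \<epsilon>) * exp (\<epsilon> * norm w)" for w
    proof -
      have "norm (\<i> - \<i> * w) \<le> 1 + norm w" using norm_triangle_ineq4[of \<i> "\<i> * w"] by (simp add: norm_mult)
      then have "\<epsilon> * norm (\<i> - \<i> * w) \<le> \<epsilon> * (1 + norm w)" using \<epsilon> by (intro mult_left_mono) auto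
      then have "C * exp (\<epsilon> * norm (\<i> - \<i> * w)) \<le> C * exp (\<epsilon> * (1 + norm w))" using C' by (intro mult_left_mono) auto
      also have "\<dots> = (C * exp \<epsilon>) * exp (\<epsilon> * norm w)" by (simp add: distrib_left exp_add)
      finally show ?thesis using C[of "\<i> - \<i> * w"] unfolding f_def by linarith
    qed
    then show ?thesis by blast
  qed
  define L' where "L' = l2sq c + 64 * inv_sq_sum"
  have bdf: "norm (f w) \<le> exp pi * \<bar>L'\<bar>" if w: "Re w = 0" for w
  proof -
    define z where "z = \<i> - \<i> * w"
    have Imz: "Im z = 1" using w by (simp add: z_def)
    have zd: "norm (z - of_int n) \<ge> 1" for n using abs_Im_le_cmod[of "z - of_int n"] Imz by simp
    have zi: "z \<notin> \<int>"
    proof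
      assume "z \<in> \<int>"
      then obtain m where "z = of_int m" by (rule Ints_cases)
      with zd[of m] show False by simp
    qed
    have "norm (csum c z) \<le> L'" unfolding L'_def
    proof (rule norm_csum_le[OF c])
      show "1/4 \<le> norm (z - of_int n)" for n using zd[of n] by linarith
    qed
    moreover have "norm (sinpi z) \<le> exp pi"
    proof (rule power2_le_imp_le)
      have "(norm (sinpi z))\<^sup>2 = (cosh (2 * pi) - cos (2 * (pi * Re z))) / 2"
        unfolding sinpi_def norm_sin_cosh using Imz by simp
      also have "\<dots> \<le> (cosh (2 * pi) + 1) / 2"
        using cos_ge_minus_one[of "2 * (pi * Re z)"] by (intro divide_right_mono) linarith+
      also have "\<dots> \<le> exp (2 * pi)"
      proof -
        define e e' where "e = exp (2 * pi)" and "e' = exp (- (2 * pi))"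
        have "e' \<le> e" "1 \<le> e" by (simp_all add: e_def e'_def)
        then have "e + e' + 2 \<le> 4 * e" by linarith
        then show ?thesis unfolding cosh_field_def e_def[symmetric] e'_def[symmetric] by (simp add: field_simps)
      qed
      also have "\<dots> = (exp pi)\<^sup>2" by (simp add: power2_eq_square flip: exp_add)
      finally show "(norm (sinpi z))\<^sup>2 \<le> (exp pi)\<^sup>2" .
    qed simp
    ultimately have "norm (sinpi z) * norm (csum c z) \<le> exp pi * \<bar>L'\<bar>" by (intro mult_mono) auto
    then show ?thesis using Tc[of z] csum_has_sum(2)[OF c zi] by (simp add: f_def z_def norm_mult)
  qed
  obtain k where k: "\<And>w. f w = k" using zero_type_bounded_imp_constant[OF holf typef bdf] by blast
  have Tk: "T z = k" for z
  proof -
    have "\<i> - \<i> * (1 + \<i> * z) = z" by (simp add: algebra_simps)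
    then show ?thesis using k[of "1 + \<i> * z"] by (simp add: f_def)
  qed
  \<comment> \<open>A nonzero constant would give all \<open>c n\<close> the same positive modulus,
    against square summability.\<close>
  have "k = 0"
  proof (rule ccontr)
    assume k0: "k \<noteq> 0"
    have cn: "(cmod (c n))\<^sup>2 = (cmod k / pi)\<^sup>2" for n
      using arg_cong[OF Tn[of n], of norm] unfolding Tk by (simp add: norm_mult)
    have "(cmod k / pi)\<^sup>2 > 0" using k0 by simp
    then obtain j where "l2sq c < real j * (cmod k / pi)\<^sup>2"
      using reals_Archimedean3[of "(cmod k / pi)\<^sup>2"] by blast
    moreover have "real j * (cmod k / pi)\<^sup>2 \<le> l2sq c"
      using finite_sum_le_infsum[OF ell2D[OF c], of "{1..int j}"] by (simp only: cn l2sq_def) simp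
    ultimately show False by simp
  qed
  then show ?thesis using T(2) Tk by auto
qed

definition \<Lambda> :: "complex set" where "\<Lambda> = {z. G z = 0}"

lemma dual_delta: "G \<nu> = 0 \<Longrightarrow> dual \<xi> \<nu> = (if \<nu> = \<xi> then 1 else 0)"
  by (simp add: dual_def)

lemma exact_system_rkernel: "exact_system weight (rkernel weight) \<Lambda>"
  unfolding exact_system_def
proof (intro conjI ballI)
  show "rkernel weight ` \<Lambda> \<subseteq> hspace weight" using rkernel_in_hspace by auto
  show "closed_span weight (rkernel weight ` \<Lambda>) = hspace weight"
    by (rule closed_span_rkernel) (rule vanishing_on_zeros_imp_0, auto simp: \<Lambda>_def)
  show "closed_span weight (rkernel weight ` (\<Lambda> - {\<xi>})) \<noteq> hspace weight" if "\<xi> \<in> \<Lambda>" for \<xi>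
    using that by (intro closed_span_rkernel_proper[of "dual \<xi>" \<xi>] dual_in_hspace) (auto simp: \<Lambda>_def dual_delta)
qed

lemma generating_function_G: "generating_function weight \<Lambda> G"
  unfolding generating_function_def
proof (intro conjI holomorphic_G exI[of _ dual] ballI)
  show "biorthogonal weight (rkernel weight) dual \<Lambda>"
    unfolding biorthogonal_def
    using dual_in_hspace by (auto simp: \<Lambda>_def hinner_rkernel dual_delta)
  show "deriv G \<mu> \<noteq> 0" if "\<mu> \<in> \<Lambda>" for \<mu> using that G_zero by (simp add: \<Lambda>_def)
  show "\<forall>z. z \<noteq> \<mu> \<longrightarrow> dual \<mu> z = G z / (deriv G \<mu> * (z - \<mu>))" for \<mu> by (simp add: dual_def)
qed

lemma \<Lambda>_Ints: "\<Lambda> \<inter> \<int> = {}"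
  using G_zero(2) by (auto simp: \<Lambda>_def)

end

theorem proposition3p4:
  fixes M :: "real \<Rightarrow> real"
  assumes "\<forall>r>0. M r > 0"
    and "mono_on {0<..} M"
    and "antimono_on {0<..} (\<lambda>r. M r / r)"
    and "((\<lambda>r. M r / r) \<longlongrightarrow> 0) at_top"
  shows "\<exists>b \<Lambda>. weight_seq b \<and> \<Lambda> \<inter> \<int> = {} \<and> exact_system b (rkernel b) \<Lambda> \<and>
           complement_has_size b \<Lambda> M"
proof -
  have "\<forall>j::nat. \<exists>t. \<forall>y\<ge>t. M y \<le> ln 2 * (y / 3 ^ Suc (Suc j) - 1)"
  proof
    fix j :: nat
    \<comment> \<open>This is the rate that \<open>ln_norm_hprod_B_imag_ge\<close> gives for level
      \<open>Suc j\<close>. Asking for half the slope \<open>ln 2 / q\<close> leaves room to absorb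
      the \<open>- 1\<close> once \<open>y \<ge> 2 * q\<close>.\<close>
    define q :: real where "q = 3 ^ Suc (Suc j)"
    have q0: "q > 0" by (simp add: q_def)
    have "\<forall>\<^sub>F r in at_top. M r / r < ln 2 / (2 * q)"
      using q0 by (intro order_tendstoD(2)[OF assms(4)]) simp
    then obtain t where t: "\<And>r. r \<ge> t \<Longrightarrow> M r / r < ln 2 / (2 * q)" by (auto simp: eventually_at_top_linorder)
    have "M y \<le> ln 2 * (y / q - 1)" if y: "y \<ge> max t (2 * q)" for y
    proof -
      have y0: "y > 0" using y q0 by linarith
      have "M y < ln 2 / (2 * q) * y" using t[of y] y y0 by (simp add: pos_divide_less_eq)
      also have "\<dots> = ln 2 * (y / (2 * q))" by simp
      also have "\<dots> \<le> ln 2 * (y / q - 1)"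
      proof (rule mult_left_mono)
        show "y / (2 * q) \<le> y / q - 1" using y q0 by (simp add: field_simps)
      qed simp
      finally show ?thesis by simp
    qed
    then show "\<exists>t. \<forall>y\<ge>t. M y \<le> ln 2 * (y / 3 ^ Suc (Suc j) - 1)" unfolding q_def by blast
  qed
  from choice[OF this] obtain t where t: "\<And>j y. y \<ge> t j \<Longrightarrow> M y \<le> ln 2 * (y / 3 ^ Suc (Suc j) - 1)" by auto
  \<comment> \<open>Partial sums of positive integers give \<open>N 0 = 0\<close> and strict growth,
    while the last summand alone ensures \<open>N j \<ge> t j\<close>, hence
    \<open>R j \<ge> t j\<close>, for \<open>j \<ge> 1\<close>.\<close>
  define N where "N = (\<lambda>j. \<Sum>i\<in>{1..j}. Suc (nat \<lceil>t i\<rceil>))"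
  interpret truncated_levels N
  proof
    show "N 0 = 0" by (simp add: N_def)
    show "strict_mono N" unfolding strict_mono_Suc_iff by (simp add: N_def)
  qed
  have R_ge: "R j \<ge> t j" if "j \<ge> 1" for j
  proof -
    have "Suc (nat \<lceil>t j\<rceil>) \<le> N j" unfolding N_def using that by (intro member_le_sum) auto
    then have "t j \<le> real (N j)" by linarith
    also have "1 * real (N j) \<le> R j" unfolding R_def using one_le_power[of "3::real" "Suc j"] by (intro mult_right_mono) auto
    finally show ?thesis by simp
  qed
  have size: "M \<bar>y\<bar> \<le> ln (norm (S (\<i> * of_real y)))" if y: "\<bar>y\<bar> > R 1" for y
  proof -
    have "R 1 \<ge> 0" by (simp add: R_def)
    then have y0: "\<bar>y\<bar> > 0" using y by linarith
    \<comment> \<open>In this interval level \<open>Suc k\<close> is still complete, and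
      \<open>\<bar>y\<bar> \<ge> R k \<ge> t k\<close> is past the threshold for its growth rate.
      The condition \<open>\<bar>y\<bar> > R 1\<close> excludes \<open>k = 0\<close>, for which
      \<open>R\<close> has no threshold built in.\<close>
    obtain k where k: "R k \<le> \<bar>y\<bar>" "\<bar>y\<bar> \<le> R (Suc k)" using R_interval[of "\<bar>y\<bar>"] by auto
    have "k \<noteq> 0" using k(2) y by (intro notI) simp
    then have "M \<bar>y\<bar> \<le> ln 2 * (\<bar>y\<bar> / 3 ^ Suc (Suc k) - 1)" using t[of k "\<bar>y\<bar>"] R_ge[of k] k(1) by simp
    also have "\<dots> \<le> ln (norm (S (\<i> * of_real \<bar>y\<bar>)))" by (rule ln_norm_hprod_B_imag_ge[OF y0 k(2)])
    also have "norm (S (\<i> * of_real \<bar>y\<bar>)) = norm (S (\<i> * of_real y))"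
      by (intro antisym norm_hprod_mono) (auto simp: hfac_imag simp del: of_real_add of_real_divide of_real_power)
    finally show ?thesis .
  qed
  have "R 1 > 0" unfolding R_def using N_ge[of 1] by simp
  then have "complement_has_size weight \<Lambda> M"
    unfolding complement_has_size_def
    using generating_function_G sspace_S size S_imag_ne_0 by blast
  then show ?thesis using weight_seq_b exact_system_rkernel \<Lambda>_Ints by blast
qed

end
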